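(* Fix an integer $p\geq2$, a unit vector $\theta_1^0\in\mathbb{R}^p$, $v>0$ and a positive real sequence $(r_n)$ satisfying (iii) $r_n=1/\sqrt n$ or (iv) $r_n=o(1/\sqrt n)$. Let $\tau_n\to\tau$ be any convergent sequence in $\mathbb{R}^p$ such that $\theta_1^0+\tau_n$ is a unit vector for every $n$. Then: In case (iii), the statistic $Q_{\rm HPV}$ is, under $\mathrm{P}_{\theta_1^0+\tau_n,r_n,v}$, asymptotically non-central chi-square with $p-1$ degrees of freedom and with non-centrality parameter $$\frac{v^2}{16}\|\tau\|^2\big(4-\|\tau\|^2\big)\big(2-\|\tau\|^2\big)^2,$$ so that the test $\phi_{\rm HPV}$ is rate-consistent. In case (iv), the test $\phi_{\rm HPV}$ is locally asymptotically maximin at level $\alpha$ (for any $\alpha\in(0,1)$) when testing $\mathcal H_0^{(n)}:\theta_1=\theta_1^0$ against $\mathcal H_1^{(n)}:\theta_1\neq\theta_1^0$, but trivially so, since its asymptotic power against any sequence of alternatives $\mathrm{P}_{\theta_1^0+\tau_n,r_n,v}$, with $(\tau_n)\to\tau$, is equal to $\alpha$.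
   Context: Model: for a unit vector $\theta_1\in\mathbb{R}^p$, $v>0$ and a positive sequence $(r_n)$, $\mathrm{P}_{\theta_1,r_n,v}$ denotes the (sequence of) hypotheses under which, for each $n$, $X_{n1},\ldots,X_{nn}$ are i.i.d. $p$-variate normal with mean $0$ and covariance matrix $I_p+r_nv\,\theta_1\theta_1'$ (a triangular array; the dimension $p$ is fixed). Prime denotes transpose. Let $\bar X_n=\frac1n\sum_{i=1}^nX_{ni}$ and $S_n=\frac1n\sum_{i=1}^n(X_{ni}-\bar X_n)(X_{ni}-\bar X_n)'$. Let $\hat\lambda_{n1}\geq\cdots\geq\hat\lambda_{np}$ be the eigenvalues of $S_n$ and $\hat\theta_{nj}$ a unit eigenvector of $S_n$ associated with $\hat\lambda_{nj}$ (almost surely unique up to sign for $n>p$; the sign is irrelevant here). Let $\tilde\theta_{n2},\ldots,\tilde\theta_{np}$ be obtained by Gram–Schmidt orthogonalization of $\theta_1^0,\hat\theta_{n2},\ldots,\hat\theta_{np}$, i.e. recursively for $j=2,\ldots,p$, $$\tilde\theta_{nj}=\frac{(I_p-\theta_1^0\theta_1^{0\prime}-\sum_{k=2}^{j-1}\tilde\theta_{nk}\tilde\theta_{nk}')\hat\theta_{nj}}{\|(I_p-\theta_1^0\theta_1^{0\prime}-\sum_{k=2}^{j-1}\tilde\theta_{nk}\tilde\theta_{nk}')\hat\theta_{nj}\|}.$$ Then $Q_{\rm HPV}=\frac{n}{\hat\lambda_{n1}}\sum_{j=2}^p\hat\lambda_{nj}^{-1}(\tilde\theta_{nj}'S_n\theta_1^0)^2$,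 and $\phi_{\rm HPV}$ rejects the null hypothesis at asymptotic level $\alpha$ when $Q_{\rm HPV}>\chi^2_{p-1,1-\alpha}$, the $\alpha$-upper quantile of the $\chi^2_{p-1}$ distribution. The test $\phi_{\rm HPV}$ is identified with its rejection indicator. In case (iii), the contiguity rate is $\nu_n\equiv1$ (the alternatives $\theta_1^0+\tau_n$ do not shrink to $\theta_1^0$), and "rate-consistent" means that the test has asymptotic power strictly larger than $\alpha$ against alternatives at this rate (those $\tau$ for which the displayed non-centrality parameter is positive). Local asymptotic maximinity in case (iv) (standard Le Cam notion, for fixed $v$ and $(r_n)$, with localization rate $\nu_n\equiv1$): a sequence of tests $\phi_n$ is locally asymptotically maximin at level $\alpha$ if $\limsup_n\mathrm{E}_{\mathrm{P}_{\theta_1^0,r_n,v}}[\phi_n]\leq\alpha$ and, for all $0<c\leq C$ with $c\leq2$ and every sequence of tests $\psi_n$ with $\limsup_n\mathrm{E}_{\mathrm{P}_{\theta_1^0,r_n,v}}[\psi_n]\leq\alpha$, $$\limsup_n\inf_{\theta\in A(c,C)}\mathrm{E}_{\mathrm{P}_{\theta,r_n,v}}[\psi_n]\leq\liminf_n\inf_{\theta\in A(c,C)}\mathrm{E}_{\mathrm{P}_{\theta,r_n,v}}[\phi_n],$$ where $A(c,C)=\{\theta\in\mathbb{R}^p:\|\theta\|=1,\ c\leq\|\theta-\theta_1^0\|\leq C\}$. *)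

theory Defs
  imports "HOL-Probability.Probability"
begin

section \<open>Multinormal triangular arrays\<close>

definition outer :: "real ^ 'p \<Rightarrow> real ^ 'p \<Rightarrow> real ^ 'p ^ 'p"
  where "outer x y = (\<chi> i j. x $ i * y $ j)"

definition multivariate_normal :: "real ^ 'p \<Rightarrow> real ^ 'p ^ 'p \<Rightarrow> (real ^ 'p) measure"
  where "multivariate_normal \<mu> \<Sigma> = density lborel
    (\<lambda>x. ennreal (exp (- ((x - \<mu>) \<bullet> (matrix_inv \<Sigma> *v (x - \<mu>))) / 2)
                   / sqrt ((2 * pi) ^ CARD('p) * det \<Sigma>)))"

text \<open>A sample of size \<open>n\<close> is a function on the index set \<open>{1..n}\<close>; row \<open>n\<close> of the
  triangular array is its own product space. Statistics and tests are sequences indexed by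
  \<open>n\<close>, where \<open>n = 0\<close> is irrelevant.\<close>

type_synonym 'p sample = "nat \<Rightarrow> real ^ 'p"

abbreviation sample_space :: "nat \<Rightarrow> ('p::finite) sample measure"
  where "sample_space n \<equiv> PiM {1..n} (\<lambda>_. borel)"

definition sample_law ::
    "real ^ 'p \<Rightarrow> (nat \<Rightarrow> real) \<Rightarrow> real \<Rightarrow> nat \<Rightarrow> ('p::finite) sample measure"
  where "sample_law \<theta> r v n =
    PiM {1..n} (\<lambda>_. multivariate_normal 0 (mat 1 + (r n * v) *\<^sub>R outer \<theta> \<theta>))"

definition sample_mean :: "nat \<Rightarrow> ('p::finite) sample \<Rightarrow> real ^ 'p"
  where "sample_mean n X = (1 / real n) *\<^sub>R (\<Sum>i\<in>{1..n}. X i)"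

definition sample_cov :: "nat \<Rightarrow> ('p::finite) sample \<Rightarrow> real ^ 'p ^ 'p"
  where "sample_cov n X =
    (1 / real n) *\<^sub>R (\<Sum>i\<in>{1..n}. outer (X i - sample_mean n X) (X i - sample_mean n X))"


section \<open>Eigenvalues and eigenvectors\<close>

text \<open>The eigenvalues, repeated with multiplicity, in nonincreasing order. They are read off
  the characteristic polynomial; the list exists and is unique if this polynomial splits over
  the reals, in particular for symmetric matrices.\<close>

definition ordered_eigenvalues :: "real ^ 'p ^ 'p \<Rightarrow> real list"
  where "ordered_eigenvalues A =
    (THE ls. length ls = CARD('p) \<and> sorted_wrt (\<ge>) ls \<and>
             (\<forall>t. det (mat t - A) = (\<Prod>l\<leftarrow>ls. t - l)))"

text \<open>The \<open>j\<close>-th largest eigenvalue, for \<open>j\<close> from \<open>1\<close> to \<open>CARD('p)\<close>.\<close>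

definition eigval :: "real ^ 'p ^ 'p \<Rightarrow> nat \<Rightarrow> real"
  where "eigval A j = ordered_eigenvalues A ! (j - 1)"

text \<open>\<open>eigvec n X j\<close> is a unit eigenvector of the sample covariance matrix for its \<open>j\<close>-th
  largest eigenvalue. As signs are arbitrary (and, on a null set if \<open>n > p\<close>, eigenspaces need
  not be lines), any measurable choice is admitted.\<close>

definition sample_eigenvectors ::
    "(nat \<Rightarrow> ('p::finite) sample \<Rightarrow> nat \<Rightarrow> real ^ 'p) \<Rightarrow> bool"
  where "sample_eigenvectors eigvec \<longleftrightarrow>
    (\<forall>n\<ge>1. \<forall>j\<in>{1..CARD('p)}.
       (\<lambda>X. eigvec n X j) \<in> borel_measurable (sample_space n) \<and>
       (\<forall>X\<in>space (sample_space n).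
          norm (eigvec n X j) = 1 \<and>
          sample_cov n X *v eigvec n X j = eigval (sample_cov n X) j *\<^sub>R eigvec n X j))"


section \<open>The chi-square distributions\<close>

text \<open>The law of \<open>\<parallel>Z\<parallel>\<^sup>2\<close> for a \<open>k\<close>-variate normal \<open>Z\<close> with identity covariance and
  mean \<open>(sqrt \<delta>, 0, ..., 0)\<close>, for \<open>k \<ge> 1\<close> and \<open>\<delta> \<ge> 0\<close>.\<close>

definition noncentral_chi_square :: "nat \<Rightarrow> real \<Rightarrow> real measure"
  where "noncentral_chi_square k \<delta> =
    distr (PiM {..<k} (\<lambda>i. density lborel (normal_density (if i = 0 then sqrt \<delta> else 0) 1)))
      borel (\<lambda>z. \<Sum>i<k. (z i)\<^sup>2)"

definition chi_square_quantile :: "nat \<Rightarrow> real \<Rightarrow> real"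
  where "chi_square_quantile k u = Inf {q. u \<le> cdf (noncentral_chi_square k 0) q}"


section \<open>The test statistic and the test\<close>

text \<open>Gram--Schmidt orthogonalization of \<open>\<theta>0, h 2, h 3, ...\<close>; meaningful for indices
  \<open>j \<ge> 2\<close>.\<close>

fun gs_orthonormalized :: "real ^ 'p \<Rightarrow> (nat \<Rightarrow> real ^ 'p) \<Rightarrow> nat \<Rightarrow> real ^ ('p::finite)"
  where "gs_orthonormalized \<theta>0 h j =
    (let w = (mat 1 - outer \<theta>0 \<theta>0
              - (\<Sum>k\<in>{2..<j}. outer (gs_orthonormalized \<theta>0 h k) (gs_orthonormalized \<theta>0 h k)))
             *v h j
     in w /\<^sub>R norm w)"

declare gs_orthonormalized.simps [simp del]

definition Q_HPV ::
    "real ^ 'p \<Rightarrow> (nat \<Rightarrow> 'p sample \<Rightarrow> nat \<Rightarrow> real ^ 'p) \<Rightarrow> nat \<Rightarrow> ('p::finite) sample \<Rightarrow> real"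
  where "Q_HPV \<theta>0 eigvec n X =
    real n / eigval (sample_cov n X) 1 *
    (\<Sum>j\<in>{2..CARD('p)}. inverse (eigval (sample_cov n X) j) *
       (gs_orthonormalized \<theta>0 (eigvec n X) j \<bullet> (sample_cov n X *v \<theta>0))\<^sup>2)"

definition \<phi>_HPV ::
    "real \<Rightarrow> real ^ 'p \<Rightarrow> (nat \<Rightarrow> 'p sample \<Rightarrow> nat \<Rightarrow> real ^ 'p) \<Rightarrow> nat \<Rightarrow> ('p::finite) sample \<Rightarrow> real"
  where "\<phi>_HPV \<alpha> \<theta>0 eigvec n X =
    (if Q_HPV \<theta>0 eigvec n X > chi_square_quantile (CARD('p) - 1) (1 - \<alpha>) then 1 else 0)"


section \<open>Asymptotic properties of tests\<close>

text \<open>Tests may be randomized.\<close>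

definition is_test_sequence :: "(nat \<Rightarrow> ('p::finite) sample \<Rightarrow> real) \<Rightarrow> bool"
  where "is_test_sequence \<phi> \<longleftrightarrow>
    (\<forall>n\<ge>1. \<phi> n \<in> borel_measurable (sample_space n) \<and>
           (\<forall>X\<in>space (sample_space n). 0 \<le> \<phi> n X \<and> \<phi> n X \<le> 1))"

definition test_power ::
    "(nat \<Rightarrow> ('p::finite) sample \<Rightarrow> real) \<Rightarrow> real ^ 'p \<Rightarrow> (nat \<Rightarrow> real) \<Rightarrow> real \<Rightarrow> nat \<Rightarrow> real"
  where "test_power \<phi> \<theta> r v n = (\<integral>X. \<phi> n X \<partial>(sample_law \<theta> r v n))"

definition hpv_noncentrality :: "real \<Rightarrow> real ^ ('p::finite) \<Rightarrow> real"
  where "hpv_noncentrality v \<tau> =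
    v\<^sup>2 / 16 * (norm \<tau>)\<^sup>2 * (4 - (norm \<tau>)\<^sup>2) * (2 - (norm \<tau>)\<^sup>2)\<^sup>2"

text \<open>Rate-consistency when the contiguity rate is constantly \<open>1\<close>: asymptotic power larger
  than \<open>\<alpha>\<close> against all alternatives \<open>\<theta>0 + \<tau>s n\<close>, with \<open>\<tau>s\<close> converging to some \<open>\<tau>\<close> that has
  a positive noncentrality parameter.\<close>

definition rate_consistent ::
    "real \<Rightarrow> (nat \<Rightarrow> ('p::finite) sample \<Rightarrow> real) \<Rightarrow> real ^ 'p \<Rightarrow> (nat \<Rightarrow> real) \<Rightarrow> real \<Rightarrow> bool"
  where "rate_consistent \<alpha> \<phi> \<theta>0 r v \<longleftrightarrow>
    is_test_sequence \<phi> \<and>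
    (\<forall>\<tau>s \<tau>. (\<forall>n\<ge>1. norm (\<theta>0 + \<tau>s n) = 1) \<longrightarrow> \<tau>s \<longlonglongrightarrow> \<tau> \<longrightarrow> 0 < hpv_noncentrality v \<tau> \<longrightarrow>
       (\<exists>\<beta>>\<alpha>. (\<lambda>n. test_power \<phi> (\<theta>0 + \<tau>s n) r v n) \<longlonglongrightarrow> \<beta>))"

definition alternatives :: "real ^ 'p \<Rightarrow> real \<Rightarrow> real \<Rightarrow> (real ^ ('p::finite)) set"
  where "alternatives \<theta>0 c C = {\<theta>. norm \<theta> = 1 \<and> c \<le> norm (\<theta> - \<theta>0) \<and> norm (\<theta> - \<theta>0) \<le> C}"

definition asymptotic_level ::
    "real \<Rightarrow> (nat \<Rightarrow> ('p::finite) sample \<Rightarrow> real) \<Rightarrow> real ^ 'p \<Rightarrow> (nat \<Rightarrow> real) \<Rightarrow> real \<Rightarrow> bool"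
  where "asymptotic_level \<alpha> \<phi> \<theta>0 r v \<longleftrightarrow> limsup (\<lambda>n. ereal (test_power \<phi> \<theta>0 r v n)) \<le> ereal \<alpha>"

text \<open>Again for localization rate constantly \<open>1\<close>.\<close>

definition locally_asymptotically_maximin ::
    "real \<Rightarrow> (nat \<Rightarrow> ('p::finite) sample \<Rightarrow> real) \<Rightarrow> real ^ 'p \<Rightarrow> (nat \<Rightarrow> real) \<Rightarrow> real \<Rightarrow> bool"
  where "locally_asymptotically_maximin \<alpha> \<phi> \<theta>0 r v \<longleftrightarrow>
    is_test_sequence \<phi> \<and> asymptotic_level \<alpha> \<phi> \<theta>0 r v \<and>
    (\<forall>c C \<psi>. 0 < c \<longrightarrow> c \<le> C \<longrightarrow> c \<le> 2 \<longrightarrow> is_test_sequence \<psi> \<longrightarrow> asymptotic_level \<alpha> \<psi> \<theta>0 r v \<longrightarrow>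
       limsup (\<lambda>n. INF \<theta>\<in>alternatives \<theta>0 c C. ereal (test_power \<psi> \<theta> r v n))
       \<le> liminf (\<lambda>n. INF \<theta>\<in>alternatives \<theta>0 c C. ereal (test_power \<phi> \<theta> r v n)))"

end

theory Submission
  imports Defs
begin

text \<open>
  Write \<open>s\<^sub>n = r n * v\<close> and \<open>k\<^sub>n = sqrt (1 + s\<^sub>n) - 1\<close>. The matrix \<open>I + k\<^sub>n \<theta>\<theta>'\<close> is the
  square root of \<open>I + s\<^sub>n \<theta>\<theta>'\<close>, so a sample under the direction \<open>\<theta>\<close> can be realized as
  \<open>X\<^sub>i = (I + k\<^sub>n \<theta>\<theta>') Y\<^sub>i\<close> with independent standard Gaussian \<open>Y\<^sub>i\<close>. In both regimes
  \<open>sqrt n * s\<^sub>n\<close> has a limit \<open>\<rho>\<close>, namely \<open>v\<close> if \<open>r n = 1 / sqrt n\<close> and \<open>0\<close> if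
  \<open>r n = o (1 / sqrt n)\<close>; both limit laws come from one theorem with parameter \<open>\<rho>\<close>.

  Let \<open>P = I - \<theta>0 \<theta>0'\<close> and let \<open>S\<close>, \<open>T\<close> be the sample covariance matrices of \<open>X\<close>, \<open>Y\<close>.
  All eigenvalues of \<open>S\<close> tend to \<open>1\<close> in probability, because \<open>T \<rightarrow> I\<close> and \<open>k\<^sub>n \<rightarrow> 0\<close>.
  The Gram--Schmidt vectors complete \<open>\<theta>0\<close> to an orthonormal basis, so by Parseval the
  statistic is asymptotically \<open>\<parallel>u\<parallel>\<^sup>2\<close> with \<open>u = sqrt n P S \<theta>0\<close>. Expanding
  \<open>S = (I + k\<^sub>n \<theta>\<theta>') T (I + k\<^sub>n \<theta>\<theta>')\<close> gives \<open>u = sqrt n P T \<theta>0 + m + o(1)\<close>, where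
  \<open>m = \<rho> (\<theta>0 \<bullet> \<theta>) P \<theta>\<close> with the limit direction \<open>\<theta> = \<theta>0 + \<tau>\<close>;
  half of \<open>m\<close> comes from each of the two factors.

  The leading term has an exact law: up to the factor \<open>sqrt (\<theta>0 \<bullet> T \<theta>0) \<rightarrow> 1\<close>, the vector
  \<open>sqrt n P T \<theta>0\<close> is a linear combination of the vectors \<open>P Y\<^sub>i\<close> whose weights form a unit
  vector and depend only on the coordinates \<open>\<theta>0 \<bullet> Y\<^sub>i\<close>, which are independent of the
  \<open>P Y\<^sub>i\<close>. It therefore is exactly Gaussian on the orthogonal complement of \<open>\<theta>0\<close>, for every
  \<open>n\<close> (lemma \<open>distr_score\<close>). Hence the limit law is noncentral chi-square with
  noncentrality \<open>\<parallel>m\<parallel>\<^sup>2 = \<rho>\<^sup>2 c\<^sup>2 (1 - c\<^sup>2)\<close>, where \<open>c = \<theta>0 \<bullet> \<theta> = 1 - \<parallel>\<tau>\<parallel>\<^sup>2 / 2\<close>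
  (lemmas \<open>Q_HPV_minus_score_tendsto\<close> and \<open>Q_HPV_cdf_tendsto\<close>).

  Gram--Schmidt can divide by zero when some eigenvector of \<open>S\<close> is orthogonal to \<open>\<theta>0\<close>. For
  large \<open>n\<close> this happens with probability zero: the determinant of
  \<open>\<theta>0, S \<theta>0, S\<^sup>2 \<theta>0, \<dots>\<close> is a polynomial in the sample that does not vanish identically,
  and it vanishes whenever such an eigenvector exists
  (lemma \<open>AE_sample_law_no_orthogonal_eigenvector\<close>). The same condition forces the
  eigenvalues to be distinct, so that the eigenvectors are orthonormal whatever choice is made.

  Rate-consistency holds because a positive noncentrality strictly lowers the distribution
  function wherever it is positive. In the second regime the limit law is central, so the
  asymptotic power is \<open>\<alpha>\<close>. There the likelihood ratio against the standard Gaussian has second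
  moment \<open>(1 - s\<^sub>n\<^sup>2) powr (- n / 2) \<rightarrow> 1\<close>, whence the power of any sequence of tests is asymptotically
  the same at all directions, uniformly over tests and directions. No level-\<open>\<alpha>\<close> test can then
  exceed \<open>\<alpha>\<close> anywhere in the limit, and the maximin property follows.\<close>

section \<open>Orthonormal bases\<close>

definition orthonormal_basis :: "'a::euclidean_space set \<Rightarrow> bool"
  where "orthonormal_basis B \<longleftrightarrow>
    pairwise orthogonal B \<and> (\<forall>b\<in>B. norm b = 1) \<and> card B = DIM('a)"

lemma orthonormal_basis_finite: "orthonormal_basis B \<Longrightarrow> finite B"
  unfolding orthonormal_basis_def by (metis DIM_positive card.infinite less_irrefl)

lemma orthonormal_basis_inner:
  assumes "orthonormal_basis B" "b \<in> B" "c \<in> B"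
  shows "b \<bullet> c = (if b = c then 1 else 0)"
  using assms unfolding orthonormal_basis_def pairwise_def orthogonal_def
  by (auto simp: norm_eq_1)

lemma orthonormal_basis_inner_sum:
  assumes "orthonormal_basis B" "c \<in> B"
  shows "(\<Sum>b\<in>B. z b *\<^sub>R b) \<bullet> c = z c"
proof -
  have "(\<Sum>b\<in>B. z b *\<^sub>R b) \<bullet> c = (\<Sum>b\<in>B. if b = c then z b else 0)"
    unfolding inner_sum_left using assms by (intro sum.cong) (auto simp: orthonormal_basis_inner)
  then show ?thesis using assms orthonormal_basis_finite[OF assms(1)] by (simp add: sum.delta)
qed

lemma orthonormal_basis_span:
  assumes "orthonormal_basis B"
  shows "span B = UNIV" "independent B"
proof -
  have "0 \<notin> B" using assms by (auto simp: orthonormal_basis_def)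
  then show i: "independent B"
    using assms pairwise_orthogonal_independent by (auto simp: orthonormal_basis_def)
  show "span B = UNIV"
    using card_ge_dim_independent[of B UNIV] i assms by (auto simp: orthonormal_basis_def)
qed

lemma orthonormal_basis_expansion:
  assumes "orthonormal_basis B"
  shows "(\<Sum>b\<in>B. (x \<bullet> b) *\<^sub>R b) = x"
proof -
  let ?d = "x - (\<Sum>b\<in>B. (x \<bullet> b) *\<^sub>R b)"
  have "orthogonal ?d y" if "y \<in> B" for y
    using orthonormal_basis_inner_sum[OF assms that, of "\<lambda>b. x \<bullet> b"]
    by (simp add: orthogonal_def inner_diff_left)
  then have "orthogonal ?d ?d"
    using orthogonal_to_span[of ?d B ?d] by (simp only: orthonormal_basis_span(1)[OF assms] UNIV_I)
  then show ?thesis by (simp add: orthogonal_self)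
qed

lemma orthonormal_basis_inner_eq:
  assumes "orthonormal_basis B"
  shows "x \<bullet> y = (\<Sum>b\<in>B. (x \<bullet> b) * (y \<bullet> b))"
proof -
  have "(\<Sum>b\<in>B. (x \<bullet> b) *\<^sub>R b) \<bullet> y = (\<Sum>b\<in>B. (x \<bullet> b) * (y \<bullet> b))"
    by (simp add: inner_sum_left inner_commute[of y])
  then show ?thesis by (simp add: orthonormal_basis_expansion[OF assms])
qed

lemma orthonormal_basis_norm:
  assumes "orthonormal_basis B"
  shows "(norm x)\<^sup>2 = (\<Sum>b\<in>B. (x \<bullet> b)\<^sup>2)"
  using orthonormal_basis_inner_eq[OF assms, of x x]
  by (simp add: power2_norm_eq_inner flip: power2_eq_square)

lemma orthonormal_basis_Basis: "orthonormal_basis (Basis :: 'a::euclidean_space set)"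
  by (auto simp: orthonormal_basis_def pairwise_def orthogonal_def inner_Basis)

lemma orthonormal_basis_extend:
  fixes S :: "'a::euclidean_space set"
  assumes S: "pairwise orthogonal S" "\<And>x. x \<in> S \<Longrightarrow> norm x = 1"
  shows "\<exists>B. orthonormal_basis B \<and> S \<subseteq> B"
proof -
  obtain U where U: "U \<inter> insert 0 S = {}" "pairwise orthogonal (S \<union> U)"
    "span (S \<union> U) = span (S \<union> UNIV)"
    using orthogonal_extension_strong[OF S(1), of UNIV] by metis
  have zero: "0 \<notin> S \<union> U" using U(1) S(2) by force
  define B where "B = (\<lambda>x. x /\<^sub>R norm x) ` (S \<union> U)"
  have ind: "independent (S \<union> U)" using U zero by (simp add: pairwise_orthogonal_independent)
  have card: "card (S \<union> U) = DIM('a)"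
    using ind U(3) by (metis dim_UNIV indep_card_eq_dim_span independent_imp_finite span_UNIV sup_top_right dim_span)
  have inj: "inj_on (\<lambda>x. x /\<^sub>R norm x) (S \<union> U)"
  proof (rule inj_onI, rule ccontr)
    fix x y assume xy: "x \<in> S \<union> U" "y \<in> S \<union> U" "x /\<^sub>R norm x = y /\<^sub>R norm y" "x \<noteq> y"
    then have "x \<bullet> y = 0" using U(2) by (auto simp: pairwise_def orthogonal_def)
    then have "(x /\<^sub>R norm x) \<bullet> (y /\<^sub>R norm y) = 0" by simp
    then have "(x /\<^sub>R norm x) \<bullet> (x /\<^sub>R norm x) = 0" using xy(3) by simp
    then show False using xy(1) zero by auto
  qed
  have "orthonormal_basis B"
    unfolding orthonormal_basis_def
  proof (intro conjI ballI)
    show "pairwise orthogonal B" 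
      unfolding B_def pairwise_image using U(2)
      by (rule pairwise_mono) (auto simp: orthogonal_def)
    show "card B = DIM('a)" unfolding B_def using card inj by (simp add: card_image)
    show "norm b = 1" if bB: "b \<in> B" for b
    proof -
      obtain x where "x \<in> S \<union> U" "b = x /\<^sub>R norm x" using bB unfolding B_def by blast
      moreover then have "x \<noteq> 0" using zero by metis
      ultimately show ?thesis by simp
    qed
  qed
  moreover have "S \<subseteq> B"
  proof
    fix x assume "x \<in> S"
    moreover then have "x = x /\<^sub>R norm x" using S(2) by simp
    ultimately show "x \<in> B" unfolding B_def by blast
  qed
  ultimately show ?thesis by blast
qed

lemma exists_orthogonal_unit_vector:
  fixes x :: "'a::euclidean_space"
  assumes "2 \<le> DIM('a)" "norm x = 1"
  obtains e where "norm e = 1" "x \<bullet> e = 0"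
proof -
  obtain B where B: "orthonormal_basis B" "x \<in> B"
    using orthonormal_basis_extend[of "{x}"] assms by auto
  have "card (B - {x}) > 0"
    using B assms orthonormal_basis_finite[OF B(1)] by (simp add: orthonormal_basis_def)
  then obtain e where "e \<in> B" "e \<noteq> x" by (metis Diff_iff card_gt_0_iff ex_in_conv singletonI)
  then show thesis
    using that[of e] orthonormal_basis_inner[OF B(1)] B by (auto simp: orthonormal_basis_def)
qed

section \<open>Product measures and translation invariance\<close>

lemma PiM_density:
  assumes I: "finite I"
    and M: "product_sigma_finite M"
    and f: "\<And>i. i \<in> I \<Longrightarrow> f i \<in> borel_measurable (M i)"
    and D: "product_sigma_finite (\<lambda>i. density (M i) (f i))"
  shows "PiM I (\<lambda>i. density (M i) (f i)) = density (PiM I M) (\<lambda>x. \<Prod>i\<in>I. f i (x i))"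
proof -
  interpret M: product_sigma_finite M by fact
  interpret D: product_sigma_finite "\<lambda>i. density (M i) (f i)" by fact
  have meas: "(\<lambda>x. \<Prod>i\<in>I. f i (x i)) \<in> borel_measurable (PiM I M)"
    using f by (intro borel_measurable_prod_ennreal measurable_compose[OF measurable_component_singleton])
  show ?thesis
  proof (rule D.PiM_eqI[symmetric])
    show "sets (density (PiM I M) (\<lambda>x. \<Prod>i\<in>I. f i (x i))) = sets (PiM I (\<lambda>i. density (M i) (f i)))"
      by (simp cong: sets_PiM_cong)
    fix A assume "\<And>i. i \<in> I \<Longrightarrow> A i \<in> sets (density (M i) (f i))"
    then have A: "\<And>i. i \<in> I \<Longrightarrow> A i \<in> sets (M i)" by simp
    have ind: "indicator (Pi\<^sub>E I A) x = (\<Prod>i\<in>I. indicator (A i) (x i) :: ennreal)"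
      if "x \<in> space (PiM I M)" for x
      using that I by (auto simp: indicator_def space_PiM PiE_iff prod_zero_iff)
    have "emeasure (density (PiM I M) (\<lambda>x. \<Prod>i\<in>I. f i (x i))) (Pi\<^sub>E I A)
      = (\<integral>\<^sup>+x. (\<Prod>i\<in>I. f i (x i)) * indicator (Pi\<^sub>E I A) x \<partial>PiM I M)"
      using meas A I by (intro emeasure_density) (auto intro: sets_PiM_I_finite)
    also have "\<dots> = (\<integral>\<^sup>+x. (\<Prod>i\<in>I. f i (x i) * indicator (A i) (x i)) \<partial>PiM I M)"
      by (intro nn_integral_cong) (simp add: ind prod.distrib)
    also have "\<dots> = (\<Prod>i\<in>I. \<integral>\<^sup>+x. f i x * indicator (A i) x \<partial>M i)"
      using f A I by (intro M.product_nn_integral_prod) auto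
    also have "\<dots> = (\<Prod>i\<in>I. emeasure (density (M i) (f i)) (A i))"
      using f A by (intro prod.cong) (auto simp: emeasure_density)
    finally show "emeasure (density (PiM I M) (\<lambda>x. \<Prod>i\<in>I. f i (x i))) (Pi\<^sub>E I A)
      = (\<Prod>i\<in>I. emeasure (density (M i) (f i)) (A i))" .
  qed (use I in simp)
qed

lemma PiM_distr:
  assumes I: "finite I"
    and M: "product_sigma_finite M"
    and f: "\<And>i. i \<in> I \<Longrightarrow> f i \<in> measurable (M i) (N i)"
    and D: "product_sigma_finite (\<lambda>i. distr (M i) (N i) (f i))"
  shows "distr (PiM I M) (PiM I N) (\<lambda>x. \<lambda>i\<in>I. f i (x i)) = PiM I (\<lambda>i. distr (M i) (N i) (f i))"
proof -
  interpret M: product_sigma_finite M by fact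
  interpret D: product_sigma_finite "\<lambda>i. distr (M i) (N i) (f i)" by fact
  have meas: "(\<lambda>x. \<lambda>i\<in>I. f i (x i)) \<in> measurable (PiM I M) (PiM I N)"
    using f by (intro measurable_restrict measurable_compose[OF measurable_component_singleton])
  show ?thesis
  proof (rule D.PiM_eqI)
    show "sets (distr (PiM I M) (PiM I N) (\<lambda>x. \<lambda>i\<in>I. f i (x i))) = sets (PiM I (\<lambda>i. distr (M i) (N i) (f i)))"
      by (simp cong: sets_PiM_cong)
    fix A assume "\<And>i. i \<in> I \<Longrightarrow> A i \<in> sets (distr (M i) (N i) (f i))"
    then have A: "\<And>i. i \<in> I \<Longrightarrow> A i \<in> sets (N i)" by simp
    have *: "(\<lambda>x. \<lambda>i\<in>I. f i (x i)) -` Pi\<^sub>E I A \<inter> space (PiM I M) = Pi\<^sub>E I (\<lambda>i. f i -` A i \<inter> space (M i))"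
      by (auto simp: space_PiM PiE_iff)
    have "emeasure (distr (PiM I M) (PiM I N) (\<lambda>x. \<lambda>i\<in>I. f i (x i))) (Pi\<^sub>E I A)
      = emeasure (PiM I M) (Pi\<^sub>E I (\<lambda>i. f i -` A i \<inter> space (M i)))"
      using A I meas by (subst emeasure_distr) (auto simp: * intro: sets_PiM_I_finite)
    also have "\<dots> = (\<Prod>i\<in>I. emeasure (M i) (f i -` A i \<inter> space (M i)))"
      using A f I by (intro M.emeasure_PiM) (auto intro: measurable_sets)
    also have "\<dots> = (\<Prod>i\<in>I. emeasure (distr (M i) (N i) (f i)) (A i))"
      using A f by (intro prod.cong) (auto simp: emeasure_distr)
    finally show "emeasure (distr (PiM I M) (PiM I N) (\<lambda>x. \<lambda>i\<in>I. f i (x i))) (Pi\<^sub>E I A)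
      = (\<Prod>i\<in>I. emeasure (distr (M i) (N i) (f i)) (A i))" .
  qed (use I in simp)
qed

lemma product_sigma_finite_lborel: "product_sigma_finite (\<lambda>_. lborel)"
  by (simp add: product_sigma_finite_def sigma_finite_lborel)

lemma distr_lborel_translate: "distr lborel borel (\<lambda>x. x + a) = (lborel :: 'a::euclidean_space measure)"
  unfolding add.commute[of _ a] by (rule lborel_distr_plus)

lemma distr_PiM_lborel_translate:
  fixes d :: "'i \<Rightarrow> 'a::euclidean_space"
  assumes "finite I"
  shows "distr (PiM I (\<lambda>_. lborel)) (PiM I (\<lambda>_. borel)) (\<lambda>x. \<lambda>i\<in>I. x i + d i) = PiM I (\<lambda>_. lborel)"
  using PiM_distr[of I "\<lambda>_. lborel" "\<lambda>i x. x + d i" "\<lambda>_. borel"] assms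
  by (simp add: product_sigma_finite_lborel distr_lborel_translate)

text \<open>Uniqueness of Haar measure, by Weil's argument. Integrate
  \<open>g y * indicator A (x + y)\<close> against \<open>\<mu>\<close> in \<open>x\<close> and Lebesgue measure in \<open>y\<close>. Translating
  \<open>x\<close> by \<open>y\<close> shows that the double integral is \<open>\<mu> A\<close>; exchanging the order, translating \<open>y\<close> by
  \<open>x\<close>, exchanging again and translating \<open>x\<close>, with \<open>g\<close> even, shows that it is the Lebesgue measure of \<open>A\<close>.
  The weight \<open>g\<close> normalizes both measures, and its positivity makes \<open>\<mu>\<close> \<open>\<sigma>\<close>-finite, so that
  Fubini's theorem applies.\<close>

lemma lborel_eqI_translation_invariant:
  fixes \<mu> :: "'a::euclidean_space measure" and g :: "'a \<Rightarrow> ennreal"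
  assumes sets: "sets \<mu> = sets borel"
    and inv: "\<And>a. distr \<mu> borel (\<lambda>x. x + a) = \<mu>"
    and g: "g \<in> borel_measurable borel" "\<And>x. g (- x) = g x" "\<And>x. 0 < g x"
      "(\<integral>\<^sup>+x. g x \<partial>lborel) = 1" "(\<integral>\<^sup>+x. g x \<partial>\<mu>) = 1"
  shows "\<mu> = lborel"
proof (rule measure_eqI)
  note [measurable_cong] = sets and g(1)[measurable]
  have [simp]: "space \<mu> = UNIV" using sets_eq_imp_space_eq[OF sets] by simp
  interpret \<mu>: sigma_finite_measure \<mu>
  proof
    \<comment> \<open>These sets exhaust the space because \<open>g > 0\<close>, and Markov's inequality bounds their measure.\<close>
    let ?A = "\<lambda>n::nat. {x. 1 \<le> of_nat n * g x}"
    have "\<exists>n. 1 \<le> of_nat n * g x" for x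
    proof (cases "g x = \<top>")
      case True then show ?thesis by (intro exI[of _ 1]) simp
    next
      case False
      then obtain r where r: "g x = ennreal r" "0 < r"
        using g(3)[of x] by (metis ennreal_cases ennreal_less_zero_iff infinity_ennreal_def)
      obtain n :: nat where "1 / r < n" using reals_Archimedean2 by blast
      then have "1 \<le> n * r" using r by (simp add: field_simps)
      then have "1 \<le> ennreal (n * r)" by (simp add: ennreal_ge_1)
      then show ?thesis using r by (auto simp: ennreal_mult' ennreal_of_nat_eq_real_of_nat)
    qed
    moreover have "emeasure \<mu> (?A n) < \<infinity>" for n
    proof -
      have "emeasure \<mu> (?A n) \<le> of_nat n * (\<integral>\<^sup>+x. g x * indicator UNIV x \<partial>\<mu>)"
        using nn_integral_Markov_inequality[of g UNIV \<mu> "of_nat n"] by simp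
      then show ?thesis using g(5) by (simp add: of_nat_less_top order_le_less_trans)
    qed
    moreover have "(\<Union>n. ?A n) = UNIV" using calculation(1) by auto
    ultimately show "\<exists>A. countable A \<and> A \<subseteq> sets \<mu> \<and> \<Union> A = space \<mu> \<and> (\<forall>a\<in>A. emeasure \<mu> a \<noteq> \<infinity>)"
      by (intro exI[of _ "range ?A"]) (auto simp: sets less_top)
  qed
  interpret pair_sigma_finite lborel \<mu> ..
  have inv': "(\<integral>\<^sup>+x. f (x + a) \<partial>\<mu>) = (\<integral>\<^sup>+x. f x \<partial>\<mu>)"
    if [measurable]: "f \<in> borel_measurable borel" for f :: "'a \<Rightarrow> ennreal" and a
    by (subst (2) inv[of a, symmetric], subst nn_integral_distr) auto
  have invl: "(\<integral>\<^sup>+x. f (x + a) \<partial>lborel) = (\<integral>\<^sup>+x. f x \<partial>lborel)"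
    if [measurable]: "f \<in> borel_measurable borel" for f :: "'a \<Rightarrow> ennreal" and a
    by (subst (2) distr_lborel_translate[of a, symmetric], subst nn_integral_distr) auto
  fix A assume "A \<in> sets \<mu>"
  then have [measurable]: "A \<in> sets borel" using sets by simp
  let ?f = "indicator A :: 'a \<Rightarrow> ennreal"
  have "emeasure \<mu> A = (\<integral>\<^sup>+y. g y * (\<integral>\<^sup>+x. ?f x \<partial>\<mu>) \<partial>lborel)"
    using g(4) by (simp add: nn_integral_multc sets)
  also have "\<dots> = (\<integral>\<^sup>+y. g y * (\<integral>\<^sup>+x. ?f (x + y) \<partial>\<mu>) \<partial>lborel)"
    by (subst inv') auto
  also have "\<dots> = (\<integral>\<^sup>+y. (\<integral>\<^sup>+x. g y * ?f (x + y) \<partial>\<mu>) \<partial>lborel)"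
    by (intro nn_integral_cong nn_integral_cmult[symmetric]) measurable
  also have "\<dots> = (\<integral>\<^sup>+x. (\<integral>\<^sup>+y. g y * ?f (x + y) \<partial>lborel) \<partial>\<mu>)"
    by (rule Fubini'[symmetric]) measurable
  also have "\<dots> = (\<integral>\<^sup>+x. (\<integral>\<^sup>+y. g (y - x) * ?f y \<partial>lborel) \<partial>\<mu>)"
  proof (rule nn_integral_cong)
    fix x
    show "(\<integral>\<^sup>+y. g y * ?f (x + y) \<partial>lborel) = (\<integral>\<^sup>+y. g (y - x) * ?f y \<partial>lborel)"
      using invl[of "\<lambda>y. g (y - x) * ?f y" x] by (simp add: add.commute)
  qed
  also have "\<dots> = (\<integral>\<^sup>+y. (\<integral>\<^sup>+x. g (y - x) * ?f y \<partial>\<mu>) \<partial>lborel)"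
    by (rule Fubini') measurable
  also have "\<dots> = (\<integral>\<^sup>+y. ?f y * (\<integral>\<^sup>+x. g (x + - y) \<partial>\<mu>) \<partial>lborel)"
  proof (rule nn_integral_cong)
    fix y
    have "(\<integral>\<^sup>+x. g (y - x) * ?f y \<partial>\<mu>) = (\<integral>\<^sup>+x. ?f y * g (x + - y) \<partial>\<mu>)"
      using g(2)[of "y - _"] by (intro nn_integral_cong) (metis add_uminus_conv_diff minus_diff_eq mult.commute)
    then show "(\<integral>\<^sup>+x. g (y - x) * ?f y \<partial>\<mu>) = ?f y * (\<integral>\<^sup>+x. g (x + - y) \<partial>\<mu>)"
      by (simp add: nn_integral_cmult)
  qed
  also have "\<dots> = emeasure lborel A"
    by (subst inv') (use g(5) in auto)
  finally show "emeasure \<mu> A = emeasure lborel A" .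
qed (simp add: sets)

section \<open>Standard and spiked Gaussian measures\<close>

definition std_gaussian :: "'a::euclidean_space measure"
  where "std_gaussian =
    density lborel (\<lambda>x. ennreal (exp (- (norm x)\<^sup>2 / 2) / sqrt ((2 * pi) ^ DIM('a))))"

abbreviation iid_normal :: "'i set \<Rightarrow> ('i \<Rightarrow> real) measure"
  where "iid_normal I \<equiv> PiM I (\<lambda>_. density lborel std_normal_density)"

lemma sets_std_gaussian [measurable_cong, simp]: "sets std_gaussian = sets borel"
  and space_std_gaussian [simp]: "space std_gaussian = UNIV"
  by (simp_all add: std_gaussian_def)

lemma prob_space_normal: "prob_space (density lborel (normal_density \<mu> 1))"
  by (rule prob_space_normal_density) simp

lemma prob_space_std_normal: "prob_space (density lborel std_normal_density)"
  by (rule prob_space_normal)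

lemma prob_space_iid_normal: "prob_space (iid_normal I)"
  by (intro prob_space_PiM prob_space_std_normal)

lemma product_sigma_finite_prob_spaces: "(\<And>i. prob_space (M i)) \<Longrightarrow> product_sigma_finite M"
  by (simp add: product_sigma_finite_def prob_space_imp_sigma_finite)

text \<open>By Parseval the product depends on \<open>x\<close> through its norm only: this is the
  source of the rotation invariance of the Gaussian law.\<close>

lemma prod_normal_density_orthonormal:
  fixes B :: "'a::euclidean_space set"
  assumes "orthonormal_basis B"
  shows "(\<Prod>b\<in>B. std_normal_density (x \<bullet> b)) = exp (- (norm x)\<^sup>2 / 2) / sqrt ((2 * pi) ^ DIM('a))"
proof -
  have fin: "finite B" and card: "card B = DIM('a)"
    using assms orthonormal_basis_finite by (auto simp: orthonormal_basis_def)
  have "(\<Prod>b\<in>B. std_normal_density (x \<bullet> b))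
      = (1 / sqrt (2 * pi)) ^ DIM('a) * exp (\<Sum>b\<in>B. - (x \<bullet> b)\<^sup>2 / 2)"
    using fin by (simp add: std_normal_density_def prod.distrib prod_dividef card exp_sum power_one_over)
  also have "(\<Sum>b\<in>B. - (x \<bullet> b)\<^sup>2 / 2) = - (norm x)\<^sup>2 / 2"
    by (simp add: orthonormal_basis_norm[OF assms] sum_negf sum_divide_distrib)
  finally show ?thesis unfolding real_sqrt_power by (simp add: power_one_over)
qed

lemma nn_integral_gaussian_orthonormal:
  fixes B :: "'a::euclidean_space set"
  assumes B: "orthonormal_basis B"
  shows "(\<integral>\<^sup>+x. ennreal (exp (- (norm x)\<^sup>2 / 2) / sqrt ((2 * pi) ^ DIM('a)))
    \<partial>distr (PiM B (\<lambda>_. lborel)) borel (\<lambda>z. \<Sum>b\<in>B. z b *\<^sub>R b)) = 1"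
proof -
  interpret product_sigma_finite "\<lambda>_::'a. lborel :: real measure" by (rule product_sigma_finite_lborel)
  note fin = orthonormal_basis_finite[OF B]
  have "(\<integral>\<^sup>+x. ennreal (exp (- (norm x)\<^sup>2 / 2) / sqrt ((2 * pi) ^ DIM('a)))
    \<partial>distr (PiM B (\<lambda>_. lborel)) borel (\<lambda>z. \<Sum>b\<in>B. z b *\<^sub>R b))
    = (\<integral>\<^sup>+z. (\<Prod>b\<in>B. ennreal (std_normal_density (z b))) \<partial>PiM B (\<lambda>_. lborel))"
    unfolding prod_normal_density_orthonormal[OF B, symmetric]
    by (subst nn_integral_distr)
       (auto simp: orthonormal_basis_inner_sum[OF B] prod_ennreal intro!: nn_integral_cong)
  also have "\<dots> = (\<Prod>b\<in>B. \<integral>\<^sup>+x. ennreal (std_normal_density x) \<partial>lborel)"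
    by (rule product_nn_integral_prod[OF fin]) simp
  also have "(\<integral>\<^sup>+x. ennreal (std_normal_density x) \<partial>lborel) = 1"
    using prob_space.emeasure_space_1[OF prob_space_std_normal] by (simp add: emeasure_density)
  finally show ?thesis by simp
qed

text \<open>Lebesgue measure is the product of one-dimensional Lebesgue measures in
  every orthonormal coordinate system: the image measure is translation invariant and gives the
  Gaussian density the total mass \<open>1\<close>, as Lebesgue measure does.\<close>

lemma distr_PiM_lborel_orthonormal:
  fixes B :: "'a::euclidean_space set"
  assumes B: "orthonormal_basis B"
  shows "distr (PiM B (\<lambda>_. lborel)) borel (\<lambda>z. \<Sum>b\<in>B. z b *\<^sub>R b) = lborel" (is "?\<mu> = _")
proof (rule lborel_eqI_translation_invariant)
  let ?g = "\<lambda>x::'a. ennreal (exp (- (norm x)\<^sup>2 / 2) / sqrt ((2 * pi) ^ DIM('a)))"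
  have T [measurable]: "(\<lambda>z. \<Sum>b\<in>B. z b *\<^sub>R b) \<in> borel_measurable (PiM B (\<lambda>_. lborel))"
    by measurable
  note fin = orthonormal_basis_finite[OF B]
  show "(\<integral>\<^sup>+x. ?g x \<partial>lborel) = 1"
    by (subst lborel_eq) (rule nn_integral_gaussian_orthonormal[OF orthonormal_basis_Basis])
  show "(\<integral>\<^sup>+x. ?g x \<partial>?\<mu>) = 1" by (rule nn_integral_gaussian_orthonormal[OF B])
  fix a :: 'a
  have "distr ?\<mu> borel (\<lambda>x. x + a) = distr (PiM B (\<lambda>_. lborel)) borel (\<lambda>z. (\<Sum>b\<in>B. z b *\<^sub>R b) + a)"
    by (simp add: distr_distr comp_def)
  also have "\<dots> = distr (PiM B (\<lambda>_. lborel)) borel (\<lambda>z. \<Sum>b\<in>B. (\<lambda>c\<in>B. z c + a \<bullet> c) b *\<^sub>R b)"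
    by (simp add: scaleR_add_left sum.distrib orthonormal_basis_expansion[OF B] cong: sum.cong)
  also have "\<dots> = distr (distr (PiM B (\<lambda>_. lborel)) (PiM B (\<lambda>_. borel)) (\<lambda>z. \<lambda>c\<in>B. z c + a \<bullet> c))
      borel (\<lambda>z. \<Sum>b\<in>B. z b *\<^sub>R b)"
    by (subst distr_distr) (auto simp: comp_def)
  also have "\<dots> = ?\<mu>" by (subst distr_PiM_lborel_translate[OF fin]) simp
  finally show "distr ?\<mu> borel (\<lambda>x. x + a) = ?\<mu>" .
qed simp_all

lemma distr_PiM_density_orthonormal:
  fixes B :: "'a::euclidean_space set" and f :: "'a \<Rightarrow> real \<Rightarrow> ennreal"
  assumes B: "orthonormal_basis B"
    and f [measurable]: "\<And>b. f b \<in> borel_measurable borel"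
    and D: "product_sigma_finite (\<lambda>b. density lborel (f b))"
  shows "distr (PiM B (\<lambda>b. density lborel (f b))) borel (\<lambda>z. \<Sum>b\<in>B. z b *\<^sub>R b)
    = density lborel (\<lambda>x. \<Prod>b\<in>B. f b (x \<bullet> b))"
proof -
  note fin = orthonormal_basis_finite[OF B]
  have "PiM B (\<lambda>b. density lborel (f b)) = density (PiM B (\<lambda>_. lborel)) (\<lambda>z. \<Prod>b\<in>B. f b (z b))"
    using fin D by (intro PiM_density) (auto simp: product_sigma_finite_lborel)
  also have "\<dots> = density (PiM B (\<lambda>_. lborel)) (\<lambda>z. \<Prod>b\<in>B. f b ((\<Sum>b\<in>B. z b *\<^sub>R b) \<bullet> b))"
    by (simp add: orthonormal_basis_inner_sum[OF B] cong: prod.cong)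
  finally have "distr (PiM B (\<lambda>b. density lborel (f b))) borel (\<lambda>z. \<Sum>b\<in>B. z b *\<^sub>R b)
    = density (distr (PiM B (\<lambda>_. lborel)) borel (\<lambda>z. \<Sum>b\<in>B. z b *\<^sub>R b)) (\<lambda>x. \<Prod>b\<in>B. f b (x \<bullet> b))"
    by (simp add: density_distr)
  then show ?thesis by (simp only: distr_PiM_lborel_orthonormal[OF B])
qed

text \<open>The coordinates of a standard Gaussian vector in any orthonormal basis are
  independent standard normal variables. Adapting the basis to a given direction is what makes
  all Gaussian computations below one-dimensional.\<close>

lemma std_gaussian_orthonormal:
  fixes B :: "'a::euclidean_space set"
  assumes B: "orthonormal_basis B"
  shows "distr (iid_normal B) borel (\<lambda>z. \<Sum>b\<in>B. z b *\<^sub>R b) = std_gaussian"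
proof -
  have "distr (iid_normal B) borel (\<lambda>z. \<Sum>b\<in>B. z b *\<^sub>R b)
    = density lborel (\<lambda>x. \<Prod>b\<in>B. ennreal (std_normal_density (x \<bullet> b)))"
    by (rule distr_PiM_density_orthonormal[OF B])
       (auto intro!: product_sigma_finite_prob_spaces prob_space_std_normal)
  then show ?thesis
    by (simp add: std_gaussian_def prod_ennreal prod_normal_density_orthonormal[OF B])
qed

lemma prob_space_std_gaussian: "prob_space std_gaussian"
  unfolding std_gaussian_orthonormal[OF orthonormal_basis_Basis, symmetric]
  by (rule prob_space.prob_space_distr[OF prob_space_iid_normal]) measurable

text \<open>For a unit vector \<open>\<theta>\<close> this is the matrix \<open>I + k \<theta>\<theta>'\<close>, which multiplies the
  direction \<open>\<theta>\<close> by \<open>1 + k\<close> and fixes its orthogonal complement.\<close>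

definition stretch :: "real \<Rightarrow> 'a::real_inner \<Rightarrow> 'a \<Rightarrow> 'a"
  where "stretch k \<theta> x = x + (k * (\<theta> \<bullet> x)) *\<^sub>R \<theta>"

lemma measurable_stretch [measurable]: "stretch k \<theta> \<in> borel_measurable (borel :: 'a::euclidean_space measure)"
  unfolding stretch_def by measurable

lemma distr_std_normal_scale:
  assumes "0 < \<sigma>"
  shows "distr (density lborel std_normal_density) borel (\<lambda>x. \<sigma> * x) = density lborel (normal_density 0 \<sigma>)"
proof -
  interpret prob_space "density lborel std_normal_density" by (rule prob_space_std_normal)
  have "distributed (density lborel std_normal_density) lborel (\<lambda>x. x) (normal_density 0 1)"
    by (auto simp: distributed_def distr_id2 sets_lborel)
  then have "distributed (density lborel std_normal_density) lborel (\<lambda>x. 0 + \<sigma> * x) (normal_density (0 + \<sigma> * 0) (\<bar>\<sigma>\<bar> * 1))"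
    using assms by (intro normal_density_affine) auto
  then show ?thesis using assms by (auto simp: distributed_def cong: distr_cong)
qed

text \<open>In an orthonormal basis that contains \<open>\<theta>\<close>, only the coordinate along
  \<open>\<theta>\<close> is rescaled, so the image is again a product of normal laws.\<close>

lemma distr_stretch_std_gaussian:
  fixes \<theta> :: "'a::euclidean_space"
  assumes \<theta>: "norm \<theta> = 1" and \<sigma>: "0 < \<sigma>"
  shows "distr std_gaussian borel (stretch (\<sigma> - 1) \<theta>)
    = density lborel (\<lambda>x. ennreal (exp (- (norm x)\<^sup>2 / 2 + (1 - 1 / \<sigma>\<^sup>2) * (\<theta> \<bullet> x)\<^sup>2 / 2)
        / (\<sigma> * sqrt ((2 * pi) ^ DIM('a)))))"
proof -
  obtain B where B: "orthonormal_basis B" "\<theta> \<in> B"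
    using orthonormal_basis_extend[of "{\<theta>}"] \<theta> by auto
  note fin = orthonormal_basis_finite[OF B(1)]
  define s where "s = (\<lambda>b. if b = \<theta> then \<sigma> else 1)"
  have s: "0 < s b" for b using \<sigma> by (simp add: s_def)
  have eq: "stretch (\<sigma> - 1) \<theta> (\<Sum>b\<in>B. z b *\<^sub>R b) = (\<Sum>b\<in>B. (\<lambda>b\<in>B. s b * z b) b *\<^sub>R b)" for z
  proof -
    have "(\<Sum>b\<in>B. (\<lambda>b\<in>B. s b * z b) b *\<^sub>R b)
        = (\<Sum>b\<in>B. z b *\<^sub>R b + (if b = \<theta> then ((\<sigma> - 1) * z b) *\<^sub>R b else 0))"
      by (intro sum.cong) (auto simp: s_def algebra_simps)
    also have "\<dots> = (\<Sum>b\<in>B. z b *\<^sub>R b) + ((\<sigma> - 1) * z \<theta>) *\<^sub>R \<theta>"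
      using fin B(2) by (simp add: sum.distrib)
    also have "z \<theta> = \<theta> \<bullet> (\<Sum>b\<in>B. z b *\<^sub>R b)"
      using orthonormal_basis_inner_sum[OF B] by (simp add: inner_commute)
    finally show ?thesis by (simp add: stretch_def)
  qed
  have 1: "distr std_gaussian borel (stretch (\<sigma> - 1) \<theta>)
    = distr (distr (iid_normal B) (PiM B (\<lambda>_. borel)) (\<lambda>z. \<lambda>b\<in>B. s b * z b)) borel (\<lambda>z. \<Sum>b\<in>B. z b *\<^sub>R b)"
    unfolding std_gaussian_orthonormal[OF B(1), symmetric]
    by (subst (1 2) distr_distr) (auto simp: comp_def eq)
  have 2: "distr (iid_normal B) (PiM B (\<lambda>_. borel)) (\<lambda>z. \<lambda>b\<in>B. s b * z b)
    = PiM B (\<lambda>b. density lborel (normal_density 0 (s b)))"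
    using PiM_distr[of B "\<lambda>_. density lborel std_normal_density" "\<lambda>b x. s b * x" "\<lambda>_. borel"] fin s
    by (simp add: distr_std_normal_scale product_sigma_finite_prob_spaces prob_space_std_normal prob_space_normal_density)
  have 3: "distr (PiM B (\<lambda>b. density lborel (normal_density 0 (s b)))) borel (\<lambda>z. \<Sum>b\<in>B. z b *\<^sub>R b)
    = density lborel (\<lambda>x. \<Prod>b\<in>B. ennreal (normal_density 0 (s b) (x \<bullet> b)))"
    by (rule distr_PiM_density_orthonormal[OF B(1)])
       (simp_all add: product_sigma_finite_prob_spaces prob_space_normal_density s)
  have "(\<Prod>b\<in>B. normal_density 0 (s b) (x \<bullet> b)) = exp (- (norm x)\<^sup>2 / 2 + (1 - 1 / \<sigma>\<^sup>2) * (\<theta> \<bullet> x)\<^sup>2 / 2)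
        / (\<sigma> * sqrt ((2 * pi) ^ DIM('a)))" for x
    proof -
      have "(\<Prod>b\<in>B. normal_density 0 (s b) (x \<bullet> b)) = (\<Prod>b\<in>B. std_normal_density (x \<bullet> b) *
        (if b = \<theta> then exp ((1 - 1 / \<sigma>\<^sup>2) * (\<theta> \<bullet> x)\<^sup>2 / 2) / \<sigma> else 1))"
      proof (intro prod.cong refl)
        fix b
        show "normal_density 0 (s b) (x \<bullet> b) = std_normal_density (x \<bullet> b) *
          (if b = \<theta> then exp ((1 - 1 / \<sigma>\<^sup>2) * (\<theta> \<bullet> x)\<^sup>2 / 2) / \<sigma> else 1)"
        proof (cases "b = \<theta>")
          case True
          have "- (x \<bullet> \<theta>)\<^sup>2 / (2 * \<sigma>\<^sup>2) = - (x \<bullet> \<theta>)\<^sup>2 / 2 + (1 - 1 / \<sigma>\<^sup>2) * (x \<bullet> \<theta>)\<^sup>2 / 2"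
            using \<sigma> by (simp add: field_simps)
          then show ?thesis using \<sigma> True
            by (simp add: s_def normal_density_def exp_add[symmetric] real_sqrt_mult inner_commute[of \<theta>])
        qed (simp add: s_def)
      qed
      also have "\<dots> = (\<Prod>b\<in>B. std_normal_density (x \<bullet> b)) * (exp ((1 - 1 / \<sigma>\<^sup>2) * (\<theta> \<bullet> x)\<^sup>2 / 2) / \<sigma>)"
        using fin B(2) by (simp add: prod.distrib prod.delta)
      finally show ?thesis
        unfolding prod_normal_density_orthonormal[OF B(1)] exp_add by (simp add: mult.commute)
    qed
  then show ?thesis unfolding 1 2 3 by (simp only: prod_ennreal normal_density_nonneg)
qed

text \<open>The matrix \<open>Q\<close> whose rows are the basis vectors is orthogonal, and
  \<open>Q S Q'\<close> is diagonal. The basis is enumerated by \<open>'p\<close> because this type indexes the rows.\<close>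

lemma det_orthonormal_eigenbasis:
  fixes S :: "real ^ 'p ^ 'p"
  assumes B: "orthonormal_basis B" and S: "\<And>b. b \<in> B \<Longrightarrow> S *v b = d b *\<^sub>R b"
  shows "det S = (\<Prod>b\<in>B. d b)"
proof -
  have "finite B" "card B = card (UNIV :: 'p set)"
    using orthonormal_basis_finite[OF B] B by (auto simp: orthonormal_basis_def)
  then obtain h :: "'p \<Rightarrow> real ^ 'p" where h: "bij_betw h UNIV B"
    using finite_same_card_bij[of "UNIV :: 'p set" B] by auto
  have hB: "h i \<in> B" for i using h by (auto simp: bij_betw_def)
  have hh: "h i \<bullet> h j = (if i = j then 1 else 0)" for i j
    using orthonormal_basis_inner[OF B hB hB, of i j] h by (auto simp: bij_betw_def inj_on_def)
  let ?Q = "(\<chi> i. h i) :: real ^ 'p ^ 'p"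
  have QSQ: "?Q ** S ** transpose ?Q = (\<chi> i j. if i = j then d (h i) else 0)"
  proof -
    have "(?Q ** S ** transpose ?Q) $ i $ j = (if i = j then d (h i) else 0)" for i j
    proof -
      have "column j (S ** transpose ?Q) = S *v h j"
        by (simp add: column_def transpose_def matrix_matrix_mult_def matrix_vector_mult_def vec_eq_iff)
      moreover have "(?Q ** (S ** transpose ?Q)) $ i $ j = h i \<bullet> column j (S ** transpose ?Q)"
        by (simp add: matrix_matrix_mult_def column_def inner_vec_def)
      ultimately show ?thesis
        using S[OF hB, of j] hh[of i j] by (simp add: matrix_mul_assoc)
    qed
    then show ?thesis by (simp add: vec_eq_iff)
  qed
  have QQ: "?Q ** transpose ?Q = mat 1"
    using hh by (simp add: vec_eq_iff matrix_matrix_mult_def transpose_def mat_def inner_vec_def)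
  have "det ?Q * det ?Q = 1"
    using arg_cong[OF QQ, of det] by (simp add: det_mul)
  then have "det S = det (?Q ** S ** transpose ?Q)"
    by (simp add: det_mul)
  also have "\<dots> = (\<Prod>i\<in>UNIV. d (h i))"
    unfolding QSQ by (subst det_diagonal) auto
  also have "\<dots> = (\<Prod>b\<in>B. d b)"
    using prod.reindex_bij_betw[OF h, of d] .
  finally show ?thesis .
qed

lemma outer_mult_vec: "outer x y *v z = (y \<bullet> z) *\<^sub>R x"
  by (simp add: outer_def matrix_vector_mult_def vec_eq_iff inner_vec_def sum_distrib_left sum_distrib_right mult_ac)

lemma sum_matrix_vector_mult: "(\<Sum>k\<in>K. A k) *v x = (\<Sum>k\<in>K. A k *v x)"
  for A :: "'k \<Rightarrow> real ^ 'm ^ 'n"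
  by (induction K rule: infinite_finite_induct) (auto simp: matrix_vector_mult_add_rdistrib)

lemma spiked_mult_vec: "(mat 1 + s *\<^sub>R outer \<theta> \<theta>) *v x = stretch s \<theta> x"
  by (simp add: matrix_vector_mult_add_rdistrib outer_mult_vec stretch_def scaleR_matrix_vector_assoc[symmetric])

text \<open>An orthonormal basis containing \<open>\<theta>\<close> consists of eigenvectors of the spiked
  matrix.\<close>

lemma det_spiked:
  fixes \<theta> :: "real ^ 'p"
  assumes \<theta>: "norm \<theta> = 1"
  shows "det (mat 1 + s *\<^sub>R outer \<theta> \<theta>) = 1 + s"
proof -
  obtain B where B: "orthonormal_basis B" "\<theta> \<in> B"
    using orthonormal_basis_extend[of "{\<theta>}"] \<theta> by auto
  have "det (mat 1 + s *\<^sub>R outer \<theta> \<theta>) = (\<Prod>b\<in>B. if b = \<theta> then 1 + s else 1)"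
  proof (rule det_orthonormal_eigenbasis[OF B(1)], unfold spiked_mult_vec)
    fix b assume "b \<in> B"
    then show "stretch s \<theta> b = (if b = \<theta> then 1 + s else 1) *\<^sub>R b"
      using orthonormal_basis_inner[OF B(1,2), of b] by (auto simp: stretch_def algebra_simps)
  qed
  then show ?thesis using B(2) orthonormal_basis_finite[OF B(1)] by (simp add: prod.delta)
qed

lemma matrix_inv_spiked:
  fixes \<theta> :: "real ^ 'p"
  assumes \<theta>: "norm \<theta> = 1" and s: "-1 < s"
  shows "matrix_inv (mat 1 + s *\<^sub>R outer \<theta> \<theta>) *v x = stretch (- s / (1 + s)) \<theta> x"
proof -
  let ?M = "mat 1 + s *\<^sub>R outer \<theta> \<theta>"
  let ?y = "stretch (- s / (1 + s)) \<theta> x"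
  have "invertible ?M" using s by (simp add: invertible_det_nz det_spiked[OF \<theta>])
  then have inv: "matrix_inv ?M ** ?M = mat 1"
    by (metis (mono_tags, lifting) invertible_def matrix_inv_def someI_ex)
  have "\<theta> \<bullet> \<theta> = 1" using \<theta> by (simp add: norm_eq_1)
  then have "?M *v ?y = x + (- s / (1 + s) * (\<theta> \<bullet> x) + s * (\<theta> \<bullet> x + - s / (1 + s) * (\<theta> \<bullet> x))) *\<^sub>R \<theta>"
    unfolding spiked_mult_vec by (simp add: stretch_def inner_add_right algebra_simps)
  also have "- s / (1 + s) * (\<theta> \<bullet> x) + s * (\<theta> \<bullet> x + - s / (1 + s) * (\<theta> \<bullet> x)) = 0"
    using s by (simp add: divide_simps) (simp add: algebra_simps)
  finally have "?M *v ?y = x" by simp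
  then show ?thesis by (metis inv matrix_vector_mul_assoc matrix_vector_mul_lid)
qed

lemma multivariate_normal_spiked:
  fixes \<theta> :: "real ^ 'p"
  assumes \<theta>: "norm \<theta> = 1" and s: "-1 < s"
  shows "multivariate_normal 0 (mat 1 + s *\<^sub>R outer \<theta> \<theta>)
    = density lborel (\<lambda>x. ennreal (exp (- (norm x)\<^sup>2 / 2 + s / (1 + s) * (\<theta> \<bullet> x)\<^sup>2 / 2)
        / (sqrt (1 + s) * sqrt ((2 * pi) ^ CARD('p)))))"
proof -
  have "exp (- (x \<bullet> (matrix_inv (mat 1 + s *\<^sub>R outer \<theta> \<theta>) *v x)) / 2)
      / sqrt ((2 * pi) ^ CARD('p) * det (mat 1 + s *\<^sub>R outer \<theta> \<theta>))
    = exp (- (norm x)\<^sup>2 / 2 + s / (1 + s) * (\<theta> \<bullet> x)\<^sup>2 / 2) / (sqrt (1 + s) * sqrt ((2 * pi) ^ CARD('p)))" for x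
  proof -
    have "- (x \<bullet> stretch (- s / (1 + s)) \<theta> x) / 2 = - (norm x)\<^sup>2 / 2 + s / (1 + s) * (\<theta> \<bullet> x)\<^sup>2 / 2"
      unfolding power2_norm_eq_inner stretch_def
      by (simp add: inner_diff_right inner_add_right inner_commute[of \<theta> x] power2_eq_square
          diff_divide_distrib)
    then show ?thesis
      by (simp add: matrix_inv_spiked[OF assms] det_spiked[OF \<theta>] real_sqrt_mult mult.commute)
  qed
  then show ?thesis by (simp add: multivariate_normal_def)
qed

text \<open>The spiked law is the image of the standard Gaussian law under
  the square root \<open>I + (sqrt (1 + s) - 1) \<theta>\<theta>'\<close> of its covariance matrix.\<close>

lemma multivariate_normal_spiked_eq_distr:
  fixes \<theta> :: "real ^ 'p"
  assumes \<theta>: "norm \<theta> = 1" and s: "-1 < s"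
  shows "multivariate_normal 0 (mat 1 + s *\<^sub>R outer \<theta> \<theta>)
    = distr std_gaussian borel (stretch (sqrt (1 + s) - 1) \<theta>)"
proof -
  have "1 - 1 / (sqrt (1 + s))\<^sup>2 = s / (1 + s)" using s by (simp add: field_simps)
  then show ?thesis
    using s by (simp add: multivariate_normal_spiked[OF assms] distr_stretch_std_gaussian[OF \<theta>])
qed

section \<open>Eigenvalues of symmetric matrices\<close>

text \<open>The spectral theorem. Take an orthonormal set \<open>B\<close> of eigenvectors of
  maximal size. Its orthogonal complement \<open>V\<close> is invariant under \<open>f\<close>. If \<open>V\<close> were nonzero, a
  maximizer \<open>u\<close> of \<open>x \<bullet> f x\<close> on its unit sphere would be a further eigenvector, so \<open>B\<close> would
  not be maximal.\<close>

lemma self_adjoint_orthonormal_eigenbasis: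
  fixes f :: "'a::euclidean_space \<Rightarrow> 'a"
  assumes f: "linear f" and sym: "\<And>x y. f x \<bullet> y = x \<bullet> f y"
  obtains B d where "orthonormal_basis B" "\<And>b. b \<in> B \<Longrightarrow> f b = d b *\<^sub>R b"
proof -
  define P where "P = (\<lambda>B. pairwise orthogonal B \<and> (\<forall>b\<in>B. norm b = 1 \<and> (\<exists>l. f b = l *\<^sub>R b)))"
  have bound: "finite B \<and> card B \<le> DIM('a)" if B: "P B" for B
  proof -
    obtain B' where B': "orthonormal_basis B'" "B \<subseteq> B'"
      using orthonormal_basis_extend[of B] B by (auto simp: P_def)
    then show ?thesis
      using orthonormal_basis_finite[OF B'(1)] card_mono[of B' B] finite_subset
      by (auto simp: orthonormal_basis_def)
  qed
  have "P {}" by (simp add: P_def)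
  then obtain B where B: "P B" and max: "\<And>C. P C \<Longrightarrow> card C \<le> card B"
    using ex_has_greatest_nat[of P "{}" card "Suc DIM('a)"] bound by (auto simp: less_Suc_eq_le)
  define V where "V = {x. \<forall>b\<in>B. b \<bullet> x = 0}"
  have V: "subspace V" unfolding V_def
    by (rule subspaceI) (auto simp: inner_add_right)
  have fV: "f x \<in> V" if "x \<in> V" for x
    using that B by (auto simp: V_def P_def) (metis inner_scaleR_left mult_zero_right sym)
  have triv: "V = {0}"
  proof (rule ccontr)
    assume "V \<noteq> {0}"
    then obtain x where x: "x \<in> V" "x \<noteq> 0" using subspace_0[OF V] by blast
    let ?C = "V \<inter> sphere 0 1"
    have "compact ?C" using closed_subspace[OF V] by (simp add: closed_Int_compact)
    moreover have "x /\<^sub>R norm x \<in> ?C" using x V by (simp add: subspace_scale)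
    moreover have "continuous_on ?C (\<lambda>x. x \<bullet> f x)"
      using f by (intro continuous_on_inner continuous_on_id linear_continuous_on)
        (simp add: linear_conv_bounded_linear)
    moreover have "?C \<noteq> {}" using calculation(2) by blast
    ultimately obtain u where u: "u \<in> V" "norm u = 1" and umax: "\<And>y. y \<in> ?C \<Longrightarrow> y \<bullet> f y \<le> u \<bullet> f u"
      using continuous_attains_sup[of ?C "\<lambda>x. x \<bullet> f x"] by (metis IntE mem_sphere_0)
    define l where "l = u \<bullet> f u"
    have le: "y \<bullet> f y \<le> l * (y \<bullet> y)" if y: "y \<in> V" for y
    proof (cases "y = 0")
      case False
      have "(y /\<^sub>R norm y) \<bullet> f (y /\<^sub>R norm y) \<le> l"
        unfolding l_def using False y V by (intro umax) (simp add: subspace_scale)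
      then have "(y \<bullet> f y) / (norm y)\<^sup>2 \<le> l"
        using f by (simp add: linear_scale power2_eq_square divide_inverse mult_ac)
      then show ?thesis using False by (simp add: divide_le_eq power2_norm_eq_inner)
    qed simp
    define w where "w = f u - l *\<^sub>R u"
    have uu: "u \<bullet> u = 1" using u by (simp add: norm_eq_1)
    have wV: "w \<in> V" unfolding w_def using u fV V by (simp add: subspace_diff subspace_scale)
    have wu: "w \<bullet> u = 0" using inner_commute[of u "f u"] by (simp add: w_def inner_diff_left uu l_def)
    have wfu: "w \<bullet> f u = w \<bullet> w"
      using wu by (simp add: w_def inner_diff_right)
    have "w = 0"
    proof (rule ccontr)
      assume "w \<noteq> 0"
      then have a: "w \<bullet> w > 0" by simp
      \<comment> \<open>Moving from \<open>u\<close> by \<open>t w\<close> changes \<open>x \<bullet> f x - l * (x \<bullet> x)\<close> by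
        \<open>2 t (w \<bullet> w) - t\<^sup>2 c\<close>; the step \<open>t\<close> is so small that the first-order gain wins, against
        the maximality of \<open>u\<close>.\<close>
      define c where "c = l * (w \<bullet> w) - w \<bullet> f w"
      define t where "t = (w \<bullet> w) / (\<bar>c\<bar> + 1)"
      have t: "t > 0" using a by (simp add: t_def)
      have "u + t *\<^sub>R w \<in> V" using u wV V by (simp add: subspace_add subspace_scale)
      note mem = le[OF this]
      have e1: "(u + t *\<^sub>R w) \<bullet> f (u + t *\<^sub>R w) = l + 2 * t * (w \<bullet> w) + t\<^sup>2 * (w \<bullet> f w)"
        using wfu sym[of w u] f
        by (simp add: linear_add linear_scale inner_add_left inner_add_right l_def[symmetric] inner_commute
            power2_eq_square algebra_simps)
      have e2: "(u + t *\<^sub>R w) \<bullet> (u + t *\<^sub>R w) = 1 + t\<^sup>2 * (w \<bullet> w)"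
        using wu by (simp add: inner_add_left inner_add_right uu inner_commute power2_eq_square)
      have "2 * t * (w \<bullet> w) \<le> t\<^sup>2 * c"
        using mem unfolding e1 e2 c_def by (simp add: algebra_simps)
      then have "2 * (w \<bullet> w) \<le> t * c" using t by (simp add: power2_eq_square)
      also have "t * c \<le> t * (\<bar>c\<bar> + 1)" using t by (intro mult_left_mono) auto
      also have "\<dots> = w \<bullet> w" by (simp add: t_def)
      finally show False using a by simp
    qed
    then have fu: "f u = l *\<^sub>R u" by (simp add: w_def)
    have "u \<notin> B" using u(1) uu by (auto simp: V_def)
    have "P (insert u B)"
      using B u fu unfolding P_def by (auto simp: pairwise_insert V_def orthogonal_def inner_commute)
    then have "card (insert u B) \<le> card B" by (rule max)
    then show False using \<open>u \<notin> B\<close> bound[OF B] by simp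
  qed
  obtain B' where B': "orthonormal_basis B'" "B \<subseteq> B'"
    using orthonormal_basis_extend[of B] B by (auto simp: P_def)
  have "B' \<subseteq> B"
  proof
    fix b assume b: "b \<in> B'"
    show "b \<in> B"
    proof (rule ccontr)
      assume "b \<notin> B"
      then have "b \<in> V" using b B' orthonormal_basis_inner[OF B'(1)] by (auto simp: V_def)
      then have "b = 0" using triv by simp
      then show False using b B'(1) by (auto simp: orthonormal_basis_def)
    qed
  qed
  then have "B' = B" using B' by auto
  moreover have "\<exists>d. \<forall>b\<in>B. f b = d b *\<^sub>R b" using B unfolding P_def by metis
  ultimately show ?thesis using that B'(1) by metis
qed

text \<open>Polynomials that agree everywhere are equal, so they have the same
  roots with the same multiplicities.\<close>

lemma mset_eq_if_prod_linear_factors_eq: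
  fixes ls ks :: "real list"
  assumes "\<And>t. (\<Prod>l\<leftarrow>ls. t - l) = (\<Prod>k\<leftarrow>ks. t - k)"
  shows "mset ls = mset ks"
proof -
  have roots: "proots (\<Prod>l\<leftarrow>ls. [:- l, 1:]) = mset ls" for ls :: "real list"
  proof -
    have "proots (\<Prod>l\<leftarrow>ls. [:- l, 1:]) = (\<Sum>l\<leftarrow>ls. {#l#})"
    proof -
      have "0 \<notin> set (map (\<lambda>l. [:- l, 1:]) ls)" by auto
      from proots_prod_list[OF this] show ?thesis by (simp add: comp_def)
    qed
    also have "\<dots> = mset ls" by (induction ls) auto
    finally show ?thesis .
  qed
  have "poly (\<Prod>l\<leftarrow>ls. [:- l, 1:]) t = (\<Prod>l\<leftarrow>ls. t - l)" for t and ls :: "real list"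
    by (induction ls) (auto simp: algebra_simps)
  then have "(\<Prod>l\<leftarrow>ls. [:- l, 1:]) = (\<Prod>l\<leftarrow>ks. [:- l, 1:])"
    using assms by (intro poly_eqI_degree_lead_coeff poly_ext) (simp add: fun_eq_iff)
  then show ?thesis using roots by metis
qed

lemma mat_mult_vec: "mat t *v b = (t :: real) *\<^sub>R b"
  by (simp add: matrix_vector_mult_def mat_def vec_eq_iff if_distrib[of "\<lambda>x. x * _"] cong: if_cong)

text \<open>In an orthonormal eigenbasis the characteristic polynomial splits into the
  linear factors \<open>t - d b\<close>. This identifies the definite description of the eigenvalue list, as
  a sorted list is determined by its multiset.\<close>

lemma ordered_eigenvalues_eq:
  fixes S :: "real ^ 'p ^ 'p"
  assumes B: "orthonormal_basis B" and S: "\<And>b. b \<in> B \<Longrightarrow> S *v b = d b *\<^sub>R b"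
  shows "length (ordered_eigenvalues S) = CARD('p)"
    and "mset (ordered_eigenvalues S) = image_mset d (mset_set B)"
proof -
  have fin: "finite B" and card: "card B = CARD('p)"
    using orthonormal_basis_finite[OF B] B by (auto simp: orthonormal_basis_def)
  have det: "det (mat t - S) = (\<Prod>b\<in>B. t - d b)" for t
    using S by (intro det_orthonormal_eigenbasis[OF B])
      (simp add: matrix_vector_mult_diff_rdistrib mat_mult_vec scaleR_diff_left)
  define ls where "ls = rev (sorted_list_of_multiset (image_mset d (mset_set B)))"
  have mset: "mset ls = image_mset d (mset_set B)" by (simp add: ls_def)
  have prod_mset: "(\<Prod>l\<leftarrow>ks. t - l) = (\<Prod>l\<in>#mset ks. t - l)" for t :: real and ks
    by (metis mset_map prod_mset_prod_list)
  let ?Q = "\<lambda>ls. length ls = CARD('p) \<and> sorted_wrt (\<ge>) ls \<and> (\<forall>t. det (mat t - S) = (\<Prod>l\<leftarrow>ls. t - l))"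
  have Qls: "?Q ls"
  proof (intro conjI allI)
    show "length ls = CARD('p)" using arg_cong[OF mset, of size] by (simp add: card)
    show "sorted_wrt (\<ge>) ls" by (simp add: ls_def sorted_wrt_rev sorted_sorted_list_of_multiset)
    show "det (mat t - S) = (\<Prod>l\<leftarrow>ls. t - l)" for t
      by (simp add: det prod_mset mset image_mset.compositionality comp_def prod_unfold_prod_mset)
  qed
  moreover have "ks = ls" if "?Q ks" for ks
  proof -
    have "mset ks = mset ls"
      using that Qls by (intro mset_eq_if_prod_linear_factors_eq) metis
    then have "sort ls = rev ks"
      using that by (intro properties_for_sort) (simp_all add: sorted_wrt_rev)
    moreover have "sort ls = rev ls"
      using Qls by (intro properties_for_sort) (simp_all add: sorted_wrt_rev)
    ultimately show ?thesis by simp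
  qed
  ultimately have "ordered_eigenvalues S = ls"
    unfolding ordered_eigenvalues_def by (intro the_equality) auto
  then show "length (ordered_eigenvalues S) = CARD('p)" "mset (ordered_eigenvalues S) = image_mset d (mset_set B)"
    using Qls mset by auto
qed

section \<open>Gram--Schmidt orthogonalization of eigenvectors\<close>

text \<open>For a symmetric \<open>S\<close> this says that \<open>\<theta>\<close> is a cyclic vector of \<open>S\<close>.
  It is the condition under which the Gram--Schmidt recursion never divides by zero.\<close>

definition no_orthogonal_eigenvector :: "real ^ 'p ^ 'p \<Rightarrow> real ^ 'p \<Rightarrow> bool"
  where "no_orthogonal_eigenvector S \<theta> \<longleftrightarrow> (\<forall>u l. S *v u = l *\<^sub>R u \<longrightarrow> \<theta> \<bullet> u = 0 \<longrightarrow> u = 0)"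

lemma symmetric_matrix_inner:
  fixes S :: "real ^ 'p ^ 'p"
  assumes "transpose S = S"
  shows "(S *v x) \<bullet> y = x \<bullet> (S *v y)"
  using assms by (metis dot_lmul_matrix vector_transpose_matrix)

text \<open>A multiple eigenvalue has an eigenspace of dimension at least two, and this
  contains a nonzero vector \<open>u\<close> orthogonal to \<open>\<theta>\<close>.\<close>

lemma eigval_distinct:
  fixes S :: "real ^ 'p ^ 'p"
  assumes sym: "transpose S = S" and cyc: "no_orthogonal_eigenvector S \<theta>"
    and jk: "j \<in> {1..CARD('p)}" "k \<in> {1..CARD('p)}" "j \<noteq> k"
  shows "eigval S j \<noteq> eigval S k"
proof -
  obtain B d where B: "orthonormal_basis B" and d: "\<And>b. b \<in> B \<Longrightarrow> S *v b = d b *\<^sub>R b"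
    by (rule self_adjoint_orthonormal_eigenbasis[OF matrix_vector_mul_linear[of S]])
      (use symmetric_matrix_inner[OF sym] in auto)
  note eq = ordered_eigenvalues_eq[OF B d]
  have "inj_on d B"
  proof (rule inj_onI, rule ccontr)
    fix b c assume bc: "b \<in> B" "c \<in> B" "d b = d c" "b \<noteq> c"
    define u where "u = (\<theta> \<bullet> c) *\<^sub>R b - (\<theta> \<bullet> b) *\<^sub>R c"
    have "S *v u = d b *\<^sub>R u"
      using d bc by (simp add: u_def matrix_vector_mult_diff_distrib matrix_vector_mult_scaleR algebra_simps)
    moreover have "\<theta> \<bullet> u = 0" by (simp add: u_def inner_diff_right)
    ultimately have "u = 0" using cyc by (auto simp: no_orthogonal_eigenvector_def)
    then have "u \<bullet> b = 0" by simp
    then have "\<theta> \<bullet> c = 0"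
      using orthonormal_basis_inner[OF B] bc by (simp add: u_def inner_diff_left)
    then have "c = 0" using cyc d bc by (auto simp: no_orthogonal_eigenvector_def)
    then show False using bc B by (auto simp: orthonormal_basis_def)
  qed
  then have "distinct (ordered_eigenvalues S)"
  proof -
    obtain xs where xs: "set xs = d ` B" "distinct xs"
      using finite_distinct_list orthonormal_basis_finite[OF B] by (metis finite_imageI)
    have "mset (ordered_eigenvalues S) = mset xs"
      using eq(2) image_mset_mset_set[OF \<open>inj_on d B\<close>] mset_set_set[OF xs(2)] xs(1) by simp
    then show ?thesis using mset_eq_imp_distinct_iff[of "ordered_eigenvalues S" xs] xs(2) by simp
  qed
  moreover have "j - 1 < length (ordered_eigenvalues S)" "k - 1 < length (ordered_eigenvalues S)"
    using jk eq(1) by auto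
  ultimately have "eigval S j = eigval S k \<longleftrightarrow> j - 1 = k - 1"
    unfolding eigval_def by (rule nth_eq_iff_index_eq)
  then show ?thesis using jk by auto
qed

lemma gs_orthonormalized_eq:
  fixes \<theta> :: "real ^ 'p"
  defines "w h j \<equiv> h j - (\<theta> \<bullet> h j) *\<^sub>R \<theta>
    - (\<Sum>k\<in>{2..<j}. (gs_orthonormalized \<theta> h k \<bullet> h j) *\<^sub>R gs_orthonormalized \<theta> h k)"
  shows "gs_orthonormalized \<theta> h j = w h j /\<^sub>R norm (w h j)"
  by (subst gs_orthonormalized.simps)
    (simp add: Let_def w_def matrix_vector_mult_diff_rdistrib sum_matrix_vector_mult outer_mult_vec)

text \<open>The recursion only fails if the residual \<open>w\<close> of \<open>h j\<close> vanishes. Then \<open>h j\<close>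
  is a combination of \<open>\<theta>\<close> and the earlier \<open>h k\<close>: with a nonzero coefficient of \<open>\<theta>\<close> this
  puts \<open>\<theta>\<close> into the span of the \<open>h k\<close>, and with coefficient zero it contradicts the
  orthogonality of \<open>h j\<close> to the earlier ones.\<close>

lemma gs_orthonormalized_props:
  fixes \<theta> :: "real ^ 'p" and h :: "nat \<Rightarrow> real ^ 'p"
  assumes \<theta>: "norm \<theta> = 1"
    and h: "\<And>j k. j \<in> {2..m} \<Longrightarrow> k \<in> {2..m} \<Longrightarrow> h j \<bullet> h k = (if j = k then 1 else 0)"
    and ind: "\<theta> \<notin> span (h ` {2..m})"
    and j: "j \<in> {2..m}"
  shows "norm (gs_orthonormalized \<theta> h j) = 1 \<and> \<theta> \<bullet> gs_orthonormalized \<theta> h j = 0 \<and>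
    (\<forall>k\<in>{2..<j}. gs_orthonormalized \<theta> h k \<bullet> gs_orthonormalized \<theta> h j = 0) \<and>
    gs_orthonormalized \<theta> h j \<in> span (insert \<theta> (h ` {2..j}))"
  using j
proof (induction j rule: less_induct)
  case (less j)
  let ?g = "gs_orthonormalized \<theta> h"
  have IH: "norm (?g k) = 1" "\<theta> \<bullet> ?g k = 0" "\<And>i. i \<in> {2..<k} \<Longrightarrow> ?g i \<bullet> ?g k = 0"
    "?g k \<in> span (insert \<theta> (h ` {2..k}))" if "k \<in> {2..<j}" for k
    using less.IH[of k] less.prems that by auto
  have gg: "?g i \<bullet> ?g k = (if i = k then 1 else 0)" if "i \<in> {2..<j}" "k \<in> {2..<j}" for i k
  proof (cases i k rule: linorder_cases)
    case less
    then show ?thesis using IH(3)[OF that(2), of i] that by simp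
  next
    case equal
    then show ?thesis using IH(1)[OF that(1)] by (simp add: norm_eq_1)
  next
    case greater
    then show ?thesis using IH(3)[OF that(1), of k] that by (simp add: inner_commute)
  qed
  define w where "w = h j - (\<theta> \<bullet> h j) *\<^sub>R \<theta> - (\<Sum>k\<in>{2..<j}. (?g k \<bullet> h j) *\<^sub>R ?g k)"
  have g: "?g j = w /\<^sub>R norm w" unfolding w_def by (rule gs_orthonormalized_eq)
  have w\<theta>: "\<theta> \<bullet> w = 0"
    using IH(2) \<theta> by (simp add: w_def inner_diff_right inner_sum_right norm_eq_1)
  have wg: "?g i \<bullet> w = 0" if i: "i \<in> {2..<j}" for i
  proof -
    have "(\<Sum>k\<in>{2..<j}. (?g k \<bullet> h j) * (?g i \<bullet> ?g k)) = (\<Sum>k\<in>{2..<j}. if i = k then ?g k \<bullet> h j else 0)"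
      using gg[OF i] by (intro sum.cong) auto
    then show ?thesis
      using IH(2)[OF i] i by (simp add: w_def inner_diff_right inner_sum_right inner_commute[of _ \<theta>])
  qed
  have span_g: "?g k \<in> span (insert \<theta> (h ` {2..<j}))" if "k \<in> {2..<j}" for k
    using IH(4)[OF that] that by (auto elim!: set_mp[OF span_mono, rotated])
  have "w \<noteq> 0"
  proof
    assume "w = 0"
    then have "h j = (\<theta> \<bullet> h j) *\<^sub>R \<theta> + (\<Sum>k\<in>{2..<j}. (?g k \<bullet> h j) *\<^sub>R ?g k)"
      unfolding w_def by (simp add: algebra_simps)
    also have "\<dots> \<in> span (insert \<theta> (h ` {2..<j}))"
      by (intro span_add span_sum span_scale span_g) (auto intro: span_base)
    finally obtain c where c: "h j - c *\<^sub>R \<theta> \<in> span (h ` {2..<j})"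
      by (auto simp: span_breakdown_eq)
    show False
    proof (cases "c = 0")
      case True
      have "orthogonal (h j) (h j)"
        using c True less.prems h by (intro orthogonal_to_span[of "h j" "h ` {2..<j}"]) (auto simp: orthogonal_def)
      then show False using h[OF less.prems less.prems] by (simp add: orthogonal_def)
    next
      case False
      have sub: "span (h ` {2..<j}) \<subseteq> span (h ` {2..m})"
        using less.prems by (intro span_mono) auto
      have "h j \<in> span (h ` {2..m})" using less.prems by (intro span_base) auto
      from span_diff[OF this set_mp[OF sub c]] have "c *\<^sub>R \<theta> \<in> span (h ` {2..m})" by simp
      from span_scale[OF this, of "1 / c"] show False using ind False by simp
    qed
  qed
  moreover have "w \<in> span (insert \<theta> (h ` {2..j}))"
  proof -
    have "span (insert \<theta> (h ` {2..<j})) \<subseteq> span (insert \<theta> (h ` {2..j}))" by (intro span_mono) auto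
    then show ?thesis unfolding w_def using less.prems span_g
      by (intro span_diff span_sum span_scale) (auto intro: span_base)
  qed
  ultimately show ?case
    unfolding g using w\<theta> wg by (simp add: span_scale)
qed

text \<open>Together with \<open>\<theta>\<close>, the Gram--Schmidt vectors form an orthonormal basis,
  in which \<open>y\<close> has no component along \<open>\<theta>\<close>.\<close>

lemma gs_orthonormalized_parseval:
  fixes \<theta> :: "real ^ 'p" and h :: "nat \<Rightarrow> real ^ 'p"
  assumes \<theta>: "norm \<theta> = 1"
    and h: "\<And>j k. j \<in> {2..CARD('p)} \<Longrightarrow> k \<in> {2..CARD('p)} \<Longrightarrow> h j \<bullet> h k = (if j = k then 1 else 0)"
    and ind: "\<theta> \<notin> span (h ` {2..CARD('p)})" and y: "\<theta> \<bullet> y = 0"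
  shows "(\<Sum>j\<in>{2..CARD('p)}. (gs_orthonormalized \<theta> h j \<bullet> y)\<^sup>2) = (norm y)\<^sup>2"
proof -
  let ?g = "gs_orthonormalized \<theta> h" and ?J = "{2..CARD('p)}"
  note props = gs_orthonormalized_props[OF \<theta> h ind]
  have gg: "?g i \<bullet> ?g k = (if i = k then 1 else 0)" if "i \<in> ?J" "k \<in> ?J" for i k
  proof (cases i k rule: linorder_cases)
    case less
    then show ?thesis using props[OF _ _ that(2)] that by simp
  next
    case equal
    then show ?thesis using props[OF _ _ that(1)] by (simp add: norm_eq_1)
  next
    case greater
    then show ?thesis using props[OF _ _ that(1)] that inner_commute[of "?g i" "?g k"] by simp
  qed
  have inj: "inj_on ?g ?J"
  proof (rule inj_onI)
    fix i k assume ik: "i \<in> ?J" "k \<in> ?J" "?g i = ?g k"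
    then show "i = k" using gg[of i i] gg[of i k] by (simp split: if_splits)
  qed
  have \<theta>g: "\<theta> \<bullet> ?g k = 0" if "k \<in> ?J" for k using props[OF _ _ that] by auto
  have n: "\<theta> \<notin> ?g ` ?J" using \<theta>g \<theta> by (force simp: norm_eq_1)
  have B: "orthonormal_basis (insert \<theta> (?g ` ?J))"
    unfolding orthonormal_basis_def
  proof (intro conjI)
    show "pairwise orthogonal (insert \<theta> (?g ` ?J))"
      using \<theta>g gg by (auto simp: pairwise_insert orthogonal_def inner_commute pairwise_def split: if_splits)
    show "\<forall>b\<in>insert \<theta> (?g ` ?J). norm b = 1" using \<theta> gg by (auto simp: norm_eq_1)
    have "CARD('p) \<ge> 1" by (simp add: Suc_leI)
    then show "card (insert \<theta> (?g ` ?J)) = DIM(real ^ 'p)"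
      using n inj by (simp add: card_image)
  qed
  have "(norm y)\<^sup>2 = (y \<bullet> \<theta>)\<^sup>2 + (\<Sum>b\<in>?g ` ?J. (y \<bullet> b)\<^sup>2)"
    using orthonormal_basis_norm[OF B, of y] n by simp
  also have "(\<Sum>b\<in>?g ` ?J. (y \<bullet> b)\<^sup>2) = (\<Sum>j\<in>?J. (y \<bullet> ?g j)\<^sup>2)"
    using inj by (rule sum.reindex_cong) simp_all
  finally have "(\<Sum>j\<in>?J. (y \<bullet> ?g j)\<^sup>2) = (norm y)\<^sup>2" using y inner_commute[of \<theta> y] by simp
  then show ?thesis by (subst inner_commute)
qed

section \<open>Gaussian samples and the law of large numbers for their covariance\<close>

abbreviation gaussian_sample :: "nat \<Rightarrow> ('p::finite) sample measure"
  where "gaussian_sample n \<equiv> PiM {1..n} (\<lambda>_. std_gaussian)"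

lemma prob_space_gaussian_sample: "prob_space (gaussian_sample n)"
  by (intro prob_space_PiM prob_space_std_gaussian)

lemma sets_gaussian_sample [measurable_cong]: "sets (gaussian_sample n) = sets (sample_space n)"
  by (intro sets_PiM_cong) auto

text \<open>All spiked samples are thus functions of one standard Gaussian sample, whose law
  does not depend on the direction or on the size of the spike.\<close>

lemma sample_law_eq_distr:
  fixes \<theta> :: "real ^ 'p"
  assumes \<theta>: "norm \<theta> = 1" and s: "-1 < r n * v"
  shows "sample_law \<theta> r v n = distr (gaussian_sample n) (sample_space n)
    (\<lambda>Y. \<lambda>i\<in>{1..n}. stretch (sqrt (1 + r n * v) - 1) \<theta> (Y i))"
  unfolding sample_law_def multivariate_normal_spiked_eq_distr[OF assms]
  by (intro PiM_distr[symmetric] product_sigma_finite_prob_spaces prob_space_std_gaussian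
      prob_space.prob_space_distr) simp_all

lemma distr_inner_std_gaussian:
  fixes u :: "'a::euclidean_space"
  assumes "norm u = 1"
  shows "distr std_gaussian borel (\<lambda>y. u \<bullet> y) = density lborel std_normal_density"
proof -
  obtain B where B: "orthonormal_basis B" "u \<in> B"
    using orthonormal_basis_extend[of "{u}"] assms by auto
  have "distr std_gaussian borel (\<lambda>y. u \<bullet> y) = distr (iid_normal B) borel (\<lambda>z. z u)"
    unfolding std_gaussian_orthonormal[OF B(1), symmetric]
    by (subst distr_distr) (auto simp: comp_def orthonormal_basis_inner_sum[OF B] inner_commute[of u])
  also have "\<dots> = distr (iid_normal B) (density lborel std_normal_density) (\<lambda>z. z u)"
    by (rule distr_cong) auto
  also have "\<dots> = density lborel std_normal_density"
    using B(2) by (intro distr_PiM_component prob_space_std_normal)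
  finally show ?thesis .
qed

lemma std_gaussian_moments:
  fixes u :: "'a::euclidean_space"
  shows "integrable std_gaussian (\<lambda>y. (u \<bullet> y) ^ k)"
    and "(\<integral>y. u \<bullet> y \<partial>std_gaussian) = 0"
    and "(\<integral>y. (u \<bullet> y)\<^sup>2 \<partial>std_gaussian) = (norm u)\<^sup>2"
proof -
  have unit: "integrable std_gaussian (\<lambda>y. (u \<bullet> y) ^ k) \<and> (\<integral>y. u \<bullet> y \<partial>std_gaussian) = 0
     \<and> (\<integral>y. (u \<bullet> y)\<^sup>2 \<partial>std_gaussian) = 1" if u: "norm u = 1" for u :: 'a and k
  proof -
    have int: "integrable std_gaussian (\<lambda>y. f (u \<bullet> y)) \<longleftrightarrow> integrable (density lborel std_normal_density) f"
      and eq: "(\<integral>y. f (u \<bullet> y) \<partial>std_gaussian) = (\<integral>x. f x \<partial>density lborel std_normal_density)"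
      if "f \<in> borel_measurable borel" for f :: "real \<Rightarrow> real"
      using that unfolding distr_inner_std_gaussian[OF u, symmetric]
      by (simp_all add: integrable_distr_eq integral_distr)
    have "integrable (density lborel std_normal_density) (\<lambda>x. x ^ k)"
      using integrable_std_normal_moment[of k] by (subst integrable_density) (auto simp: mult.commute)
    moreover have "(\<integral>x. x \<partial>density lborel std_normal_density) = 0"
      using integral_std_normal_moment_odd[of 0] by (subst integral_density) auto
    moreover have "(\<integral>x. x\<^sup>2 \<partial>density lborel std_normal_density) = 1"
      using integral_std_normal_moment_even[of 1] by (subst integral_density) (auto simp: fact_numeral)
    ultimately show ?thesis
      using int[of "\<lambda>x. x ^ k"] eq[of "\<lambda>x. x"] eq[of "\<lambda>x. x\<^sup>2"] by simp
  qed
  have "integrable std_gaussian (\<lambda>y. (u \<bullet> y) ^ k) \<and> (\<integral>y. u \<bullet> y \<partial>std_gaussian) = 0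
     \<and> (\<integral>y. (u \<bullet> y)\<^sup>2 \<partial>std_gaussian) = (norm u)\<^sup>2"
  proof (cases "u = 0")
    case True
    interpret prob_space "std_gaussian :: 'a measure" by (rule prob_space_std_gaussian)
    show ?thesis using True by simp
  next
    case False
    then have eq: "(\<bullet>) u = (\<lambda>y. norm u * ((u /\<^sub>R norm u) \<bullet> y))" by (simp add: fun_eq_iff)
    have "norm (u /\<^sub>R norm u) = 1" using False by simp
    from unit[OF this, of k] show ?thesis
      unfolding eq by (simp add: power_mult_distrib del: inner_scaleR_left)
  qed
  then show "integrable std_gaussian (\<lambda>y. (u \<bullet> y) ^ k)"
    "(\<integral>y. u \<bullet> y \<partial>std_gaussian) = 0" "(\<integral>y. (u \<bullet> y)\<^sup>2 \<partial>std_gaussian) = (norm u)\<^sup>2" by auto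
qed

text \<open>The mixed moment follows from the second moments by polarization, and
  square integrability from the fourth moments by the inequality \<open>2 a b \<le> a\<^sup>2 + b\<^sup>2\<close>.\<close>

lemma std_gaussian_product_moments:
  fixes u w :: "'a::euclidean_space"
  shows "integrable std_gaussian (\<lambda>y. (u \<bullet> y) * (w \<bullet> y))"
    and "integrable std_gaussian (\<lambda>y. ((u \<bullet> y) * (w \<bullet> y))\<^sup>2)"
    and "(\<integral>y. (u \<bullet> y) * (w \<bullet> y) \<partial>std_gaussian) = u \<bullet> w"
proof -
  have eq: "(u \<bullet> y) * (w \<bullet> y) = (((u + w) \<bullet> y)\<^sup>2 - (u \<bullet> y)\<^sup>2 - (w \<bullet> y)\<^sup>2) / 2" for y
    by (simp add: inner_add_left power2_sum)
  show "integrable std_gaussian (\<lambda>y. (u \<bullet> y) * (w \<bullet> y))"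
    unfolding eq by (intro integrable_divide_zero Bochner_Integration.integrable_diff std_gaussian_moments(1))
  show "(\<integral>y. (u \<bullet> y) * (w \<bullet> y) \<partial>std_gaussian) = u \<bullet> w"
  proof -
    have "(\<integral>y. (((u + w) \<bullet> y)\<^sup>2 - (u \<bullet> y)\<^sup>2 - (w \<bullet> y)\<^sup>2) / 2 \<partial>std_gaussian)
      = ((norm (u + w))\<^sup>2 - (norm u)\<^sup>2 - (norm w)\<^sup>2) / 2"
      by (simp only: integral_divide_zero Bochner_Integration.integral_diff Bochner_Integration.integrable_diff
          std_gaussian_moments)
    also have "\<dots> = u \<bullet> w"
      by (simp add: power2_norm_eq_inner inner_add_left inner_add_right inner_commute)
    finally show ?thesis unfolding eq .
  qed
  show "integrable std_gaussian (\<lambda>y. ((u \<bullet> y) * (w \<bullet> y))\<^sup>2)"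
  proof (rule Bochner_Integration.integrable_bound)
    show "integrable std_gaussian (\<lambda>y. (u \<bullet> y) ^ 4 + (w \<bullet> y) ^ 4)"
      by (intro Bochner_Integration.integrable_add std_gaussian_moments(1))
    show "AE y in std_gaussian. norm (((u \<bullet> y) * (w \<bullet> y))\<^sup>2) \<le> norm ((u \<bullet> y) ^ 4 + (w \<bullet> y) ^ 4)"
    proof (intro AE_I2)
      fix y
      have "2 * ((u \<bullet> y)\<^sup>2 * (w \<bullet> y)\<^sup>2) \<le> (u \<bullet> y) ^ 4 + (w \<bullet> y) ^ 4"
        using sum_squares_bound[of "(u \<bullet> y)\<^sup>2" "(w \<bullet> y)\<^sup>2"] by simp
      moreover have "0 \<le> (u \<bullet> y)\<^sup>2 * (w \<bullet> y)\<^sup>2" by simp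
      ultimately have "(u \<bullet> y)\<^sup>2 * (w \<bullet> y)\<^sup>2 \<le> (u \<bullet> y) ^ 4 + (w \<bullet> y) ^ 4"
        by linarith
      then show "norm (((u \<bullet> y) * (w \<bullet> y))\<^sup>2) \<le> norm ((u \<bullet> y) ^ 4 + (w \<bullet> y) ^ 4)"
        by (simp add: power_mult_distrib)
    qed
  qed measurable
qed

lemma indep_vars_PiM_coordinates:
  assumes "\<And>i. i \<in> I \<Longrightarrow> prob_space (M i)" "I \<noteq> {}"
  shows "prob_space.indep_vars (PiM I M) M (\<lambda>i x. x i) I"
proof (subst prob_space.indep_vars_iff_distr_eq_PiM')
  show "prob_space (PiM I M)" using assms by (intro prob_space_PiM)
  have "distr (PiM I M) (PiM I M) (\<lambda>x. restrict x I) = distr (PiM I M) (PiM I M) (\<lambda>x. x)"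
    by (rule distr_cong) (auto simp: space_PiM)
  also have "\<dots> = PiM I M" by simp
  also have "\<dots> = PiM I (\<lambda>i. distr (PiM I M) (M i) (\<lambda>x. x i))"
    using assms by (intro PiM_cong) (auto simp: distr_PiM_component)
  finally show "distr (PiM I M) (PiM I M) (\<lambda>x. restrict x I) = PiM I (\<lambda>i. distr (PiM I M) (M i) (\<lambda>x. x i))" .
qed (use assms in auto)

text \<open>The variance of the sum is \<open>n\<close> times the single variance, because the cross terms
  of the centred summands \<open>h (X i)\<close> vanish by independence.\<close>

lemma Chebyshev_iid_mean:
  fixes g :: "'a \<Rightarrow> real"
  assumes M: "prob_space M" and g [measurable]: "g \<in> borel_measurable M"
    and sq: "integrable M (\<lambda>x. (g x)\<^sup>2)" and n: "n \<ge> 1" and \<epsilon>: "\<epsilon> > 0"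
  defines "\<mu> \<equiv> \<integral>x. g x \<partial>M"
  shows "measure (PiM {1..n} (\<lambda>_. M)) {X \<in> space (PiM {1..n} (\<lambda>_. M)). \<epsilon> \<le> \<bar>(1 / real n) * (\<Sum>i\<in>{1..n}. g (X i)) - \<mu>\<bar>}
    \<le> (\<integral>x. (g x - \<mu>)\<^sup>2 \<partial>M) / (real n * \<epsilon>\<^sup>2)"
proof -
  interpret M: prob_space M by fact
  let ?P = "PiM {1..n} (\<lambda>_. M)"
  interpret P: prob_space ?P by (intro prob_space_PiM M)
  have int: "integrable M g" using M.square_integrable_imp_integrable[OF g sq] .
  define h where "h = (\<lambda>x. g x - \<mu>)"
  have h [measurable]: "h \<in> borel_measurable M" unfolding h_def by measurable
  have h0: "(\<integral>x. h x \<partial>M) = 0" and hint: "integrable M h"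
    using int by (simp_all add: h_def \<mu>_def M.prob_space)
  have hsq: "integrable M (\<lambda>x. (h x)\<^sup>2)" unfolding h_def power2_diff using int sq by auto
  have comp: "distr ?P M (\<lambda>X. X i) = M" if "i \<in> {1..n}" for i
    using that by (intro distr_PiM_component M)
  have int1: "integrable ?P (\<lambda>X. f (X i)) \<and> (\<integral>X. f (X i) \<partial>?P) = (\<integral>x. f x \<partial>M)"
    if f [measurable]: "integrable M f" and i: "i \<in> {1..n}" for f :: "'a \<Rightarrow> real" and i
    using integrable_distr_eq[of "\<lambda>X. X i" ?P M f] integral_distr[of "\<lambda>X. X i" ?P M f] f i comp[OF i]
    by auto
  have "1 \<in> {1..n}" using n by auto
  then have ne: "{1..n} \<noteq> {}" by blast
  have indep: "P.indep_vars (\<lambda>_. borel) (\<lambda>i X. h (X i)) {1..n}"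
    using indep_vars_PiM_coordinates[of "{1..n}" "\<lambda>_. M"] ne M
    by (intro P.indep_vars_compose2[where M'="\<lambda>_. M" and Y="\<lambda>_. h"]) auto
  have cross: "integrable ?P (\<lambda>X. h (X i) * h (X j)) \<and>
     (\<integral>X. h (X i) * h (X j) \<partial>?P) = (if i = j then \<integral>x. (h x)\<^sup>2 \<partial>M else 0)"
    if ij: "i \<in> {1..n}" "j \<in> {1..n}" for i j
  proof (cases "i = j")
    case True
    then show ?thesis using int1[OF hsq ij(1)] by (simp add: power2_eq_square)
  next
    case False
    have sub: "P.indep_vars (\<lambda>_. borel) (\<lambda>i X. h (X i)) {i, j}"
      by (rule P.indep_vars_subset[OF indep]) (use ij in auto)
    have "integrable ?P (\<lambda>X. \<Prod>k\<in>{i, j}. h (X k))"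
      using int1[OF hint] ij by (intro P.indep_vars_integrable sub) auto
    moreover have "(\<integral>X. (\<Prod>k\<in>{i, j}. h (X k)) \<partial>?P) = (\<Prod>k\<in>{i, j}. \<integral>X. h (X k) \<partial>?P)"
      using int1[OF hint] ij by (intro P.indep_vars_lebesgue_integral sub) auto
    ultimately show ?thesis using False int1[OF hint ij(1)] h0 by simp
  qed
  define H where "H X = (\<Sum>i\<in>{1..n}. h (X i))" for X
  have Hm [measurable]: "H \<in> borel_measurable ?P" unfolding H_def by measurable
  have Hsq: "(H X)\<^sup>2 = (\<Sum>i\<in>{1..n}. \<Sum>j\<in>{1..n}. h (X i) * h (X j))" for X
    by (simp add: H_def power2_eq_square sum_product)
  have Hint: "integrable ?P (\<lambda>X. (H X)\<^sup>2)"
    unfolding Hsq by (intro Bochner_Integration.integrable_sum) (use cross in auto)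
  have "(\<integral>X. (H X)\<^sup>2 \<partial>?P) = (\<Sum>i\<in>{1..n}. \<Sum>j\<in>{1..n}. if i = j then \<integral>x. (h x)\<^sup>2 \<partial>M else 0)"
  proof -
    have "(\<integral>X. (H X)\<^sup>2 \<partial>?P) = (\<Sum>i\<in>{1..n}. \<integral>X. (\<Sum>j\<in>{1..n}. h (X i) * h (X j)) \<partial>?P)"
      unfolding Hsq
      by (rule Bochner_Integration.integral_sum, rule Bochner_Integration.integrable_sum) (use cross in blast)
    also have "\<dots> = (\<Sum>i\<in>{1..n}. \<Sum>j\<in>{1..n}. \<integral>X. h (X i) * h (X j) \<partial>?P)"
      by (rule sum.cong[OF refl], rule Bochner_Integration.integral_sum) (use cross in blast)
    also have "\<dots> = (\<Sum>i\<in>{1..n}. \<Sum>j\<in>{1..n}. if i = j then \<integral>x. (h x)\<^sup>2 \<partial>M else 0)"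
      by (intro sum.cong refl) (use cross in blast)
    finally show ?thesis .
  qed
  also have "\<dots> = real n * (\<integral>x. (h x)\<^sup>2 \<partial>M)" by simp
  finally have HE: "(\<integral>X. (H X)\<^sup>2 \<partial>?P) = real n * (\<integral>x. (h x)\<^sup>2 \<partial>M)" .
  have H0: "P.expectation H = 0"
    unfolding H_def using int1[OF hint] h0 by (subst Bochner_Integration.integral_sum) auto
  have "{X \<in> space ?P. \<epsilon> \<le> \<bar>(1 / real n) * (\<Sum>i\<in>{1..n}. g (X i)) - \<mu>\<bar>} = {X \<in> space ?P. real n * \<epsilon> \<le> \<bar>H X - P.expectation H\<bar>}"
  proof -
    have eq: "(1 / real n) * (\<Sum>i\<in>{1..n}. g (X i)) - \<mu> = H X / real n" for X
      using n by (simp add: H_def h_def sum_subtractf field_simps)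
    show ?thesis unfolding eq H0 using n by (simp add: abs_divide le_divide_eq mult.commute)
  qed
  also have "measure ?P \<dots> \<le> P.variance H / (real n * \<epsilon>)\<^sup>2"
    using n \<epsilon> by (intro P.Chebyshev_inequality Hint Hm) simp
  also have "P.variance H = real n * (\<integral>x. (h x)\<^sup>2 \<partial>M)" by (simp only: H0 HE diff_zero)
  also have "real n * (\<integral>x. (h x)\<^sup>2 \<partial>M) / (real n * \<epsilon>)\<^sup>2 = (\<integral>x. (h x)\<^sup>2 \<partial>M) / (real n * \<epsilon>\<^sup>2)"
    using n by (simp add: power2_eq_square)
  finally show ?thesis by (simp add: h_def)
qed

lemma weak_law_gaussian_sample:
  fixes g :: "real ^ 'p \<Rightarrow> real"
  assumes "g \<in> borel_measurable borel" "integrable std_gaussian (\<lambda>x. (g x)\<^sup>2)" "\<epsilon> > 0"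
  shows "(\<lambda>n. measure (gaussian_sample n) {X \<in> space (gaussian_sample n).
     \<epsilon> \<le> \<bar>(1 / real n) * (\<Sum>i\<in>{1..n}. g (X i)) - (\<integral>x. g x \<partial>std_gaussian)\<bar>}) \<longlonglongrightarrow> 0"
proof (rule tendsto_sandwich[OF _ _ tendsto_const])
  let ?C = "(\<integral>x. (g x - (\<integral>x. g x \<partial>std_gaussian))\<^sup>2 \<partial>std_gaussian)"
  show "eventually (\<lambda>n. measure (gaussian_sample n) {X \<in> space (gaussian_sample n).
     \<epsilon> \<le> \<bar>(1 / real n) * (\<Sum>i\<in>{1..n}. g (X i)) - (\<integral>x. g x \<partial>std_gaussian)\<bar>} \<le> ?C / (real n * \<epsilon>\<^sup>2)) sequentially"
    by (rule eventually_sequentiallyI[of 1], rule Chebyshev_iid_mean)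
      (use assms in \<open>simp_all add: prob_space_std_gaussian\<close>)
  have "(\<lambda>n. (?C / \<epsilon>\<^sup>2) * (1 / real n)) \<longlonglongrightarrow> (?C / \<epsilon>\<^sup>2) * 0"
    by (intro tendsto_mult tendsto_const lim_1_over_n)
  then show "(\<lambda>n. ?C / (real n * \<epsilon>\<^sup>2)) \<longlonglongrightarrow> 0" by (simp add: field_simps)
qed simp

lemma sample_cov_component:
  "n \<ge> 1 \<Longrightarrow> sample_cov n X $ k $ l = (1 / real n) * (\<Sum>i\<in>{1..n}. X i $ k * X i $ l)
    - sample_mean n X $ k * sample_mean n X $ l"
proof -
  assume n: "n \<ge> 1"
  let ?m = "sample_mean n X"
  have m: "(\<Sum>i\<in>{1..n}. X i $ j) = real n * ?m $ j" for j
    using n by (simp add: sample_mean_def sum_component)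
  have "sample_cov n X $ k $ l = (1 / real n) * (\<Sum>i\<in>{1..n}. (X i $ k - ?m $ k) * (X i $ l - ?m $ l))"
    by (simp add: sample_cov_def outer_def sum_component)
  also have "(\<Sum>i\<in>{1..n}. (X i $ k - ?m $ k) * (X i $ l - ?m $ l))
    = (\<Sum>i\<in>{1..n}. X i $ k * X i $ l) - real n * ?m $ k * ?m $ l"
    using m[of k] m[of l] by (simp add: algebra_simps sum.distrib sum_subtractf flip: sum_distrib_left sum_distrib_right)
  finally show ?thesis using n by (simp add: field_simps)
qed

lemma measurable_vec_nth [measurable]:
  "(\<lambda>x :: 'b::topological_space ^ 'k. x $ i) \<in> borel_measurable borel"
  by (intro borel_measurable_continuous_onI continuous_intros)

lemma measurable_sample_mean [measurable]: "sample_mean n \<in> borel_measurable (sample_space n)"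
  unfolding sample_mean_def[abs_def] by measurable

lemma borel_measurable_matrix:
  fixes f :: "'a \<Rightarrow> real ^ 'm ^ 'k"
  assumes "\<And>i j. (\<lambda>x. f x $ i $ j) \<in> borel_measurable M"
  shows "f \<in> borel_measurable M"
proof (subst borel_measurable_euclidean_space, intro ballI)
  fix b :: "real ^ 'm ^ 'k" assume "b \<in> Basis"
  then obtain i j where "b = axis i (axis j 1)" by (auto simp: Basis_vec_def)
  then have "(\<lambda>x. f x \<bullet> b) = (\<lambda>x. f x $ i $ j)" by (simp add: inner_axis)
  then show "(\<lambda>x. f x \<bullet> b) \<in> borel_measurable M" using assms by simp
qed

lemma measurable_sample_cov [measurable]: "sample_cov n \<in> borel_measurable (sample_space n)"
proof (rule borel_measurable_matrix)
  fix i j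
  have "(\<lambda>X. (1 / real n) * (\<Sum>k\<in>{1..n}. (X k $ i - sample_mean n X $ i) * (X k $ j - sample_mean n X $ j)))
     \<in> borel_measurable (sample_space n)"
    by measurable
  then show "(\<lambda>X. sample_cov n X $ i $ j) \<in> borel_measurable (sample_space n)"
    by (simp add: sample_cov_def outer_def sum_component)
qed

text \<open>The weak law of large numbers applies to the entries of the matrix of raw
  second moments and to the components of the mean; the product of two means is negligible.\<close>

lemma sample_cov_tendsto_identity:
  assumes \<epsilon>: "\<epsilon> > 0"
  shows "(\<lambda>n. measure (gaussian_sample n) {X \<in> space (gaussian_sample n).
     \<epsilon> \<le> norm (sample_cov n X - (mat 1 :: real ^ 'p ^ 'p))}) \<longlonglongrightarrow> 0"
proof -
  define \<eta> where "\<eta> = \<epsilon> / (real CARD('p) * real CARD('p))"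
  have \<eta>: "\<eta> > 0" using \<epsilon> by (simp add: \<eta>_def)
  \<comment> \<open>Each of the \<open>CARD('p)\<^sup>2\<close> entries is allowed the error \<open>\<eta>\<close>: one half for the second moment,
    the other for a product of two means that are below \<open>\<zeta>\<close>.\<close>
  define \<zeta> where "\<zeta> = sqrt (\<eta> / 2)"
  have \<zeta>: "\<zeta> > 0" "\<zeta> * \<zeta> = \<eta> / 2" using \<eta> by (simp_all add: \<zeta>_def)
  let ?G = "\<lambda>n. gaussian_sample n :: 'p sample measure"
  define A where "A n k l = {X \<in> space (?G n). \<eta> / 2 \<le> \<bar>(1 / real n) * (\<Sum>i\<in>{1..n}. X i $ k * X i $ l) - (if k = l then 1 else 0)\<bar>}"
    for n and k l :: 'p
  define D where "D n k = {X \<in> space (?G n). \<zeta> \<le> \<bar>(1 / real n) * (\<Sum>i\<in>{1..n}. X i $ k)\<bar>}"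
    for n and k :: 'p
  have A_sets: "A n k l \<in> sets (?G n)" and D_sets: "D n k \<in> sets (?G n)" for n k l
    unfolding A_def D_def by measurable
  have A0: "(\<lambda>n. measure (?G n) (A n k l)) \<longlonglongrightarrow> 0" for k l
  proof -
    have "axis l (1::real) $ k = (if k = l then 1 else 0)" by (simp add: axis_def)
    then show ?thesis
      using weak_law_gaussian_sample[of "\<lambda>x. (axis k 1 \<bullet> x) * (axis l 1 \<bullet> x)" "\<eta> / 2"] \<eta>
        std_gaussian_product_moments[of "axis k (1::real)" "axis l 1"]
      by (simp only: inner_axis' A_def) simp
  qed
  have D0: "(\<lambda>n. measure (?G n) (D n k)) \<longlonglongrightarrow> 0" for k
    using weak_law_gaussian_sample[of "\<lambda>x. axis k 1 \<bullet> x" \<zeta>] \<zeta>(1)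
      std_gaussian_moments[of "axis k (1::real)"]
    by (simp add: inner_axis' D_def)
  have sub: "{X \<in> space (?G n). \<epsilon> \<le> norm (sample_cov n X - mat 1)} \<subseteq> (\<Union>k. \<Union>l. A n k l) \<union> (\<Union>k. D n k)"
    if n: "n \<ge> 1" for n
  proof (rule subsetI, rule ccontr)
    fix X assume "X \<in> {X \<in> space (?G n). \<epsilon> \<le> norm (sample_cov n X - mat 1)}"
      and "X \<notin> (\<Union>k. \<Union>l. A n k l) \<union> (\<Union>k. D n k)"
    then have X: "X \<in> space (?G n)" "\<epsilon> \<le> norm (sample_cov n X - mat 1)"
      and nA: "\<And>k l. X \<notin> A n k l" and nD: "\<And>k. X \<notin> D n k" by simp_all
    have m: "\<bar>sample_mean n X $ k\<bar> < \<zeta>" for k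
      using nD[of k] X by (simp add: D_def sample_mean_def sum_component)
    have "\<bar>(sample_cov n X - mat 1) $ k $ l\<bar> < \<eta>" for k l
    proof -
      have "\<bar>sample_mean n X $ k * sample_mean n X $ l\<bar> \<le> \<eta> / 2"
        unfolding abs_mult \<zeta>(2)[symmetric] using m[of k] m[of l] by (intro mult_mono) auto
      moreover have "\<bar>(1 / real n) * (\<Sum>i\<in>{1..n}. X i $ k * X i $ l) - (if k = l then 1 else 0)\<bar> < \<eta> / 2"
        using nA[of k l] X by (simp add: A_def not_le)
      ultimately show ?thesis
        unfolding vector_minus_component sample_cov_component[OF n] mat_def vec_lambda_beta by linarith
    qed
    then have "(\<Sum>k\<in>UNIV. \<Sum>l\<in>UNIV. \<bar>(sample_cov n X - mat 1) $ k $ l\<bar>) < (\<Sum>k\<in>(UNIV::'p set). \<Sum>l\<in>(UNIV::'p set). \<eta>)"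
      by (intro sum_strict_mono) auto
    also have "\<dots> = \<epsilon>" by (simp add: \<eta>_def)
    finally have "(\<Sum>k\<in>UNIV. \<Sum>l\<in>UNIV. \<bar>(sample_cov n X - mat 1) $ k $ l\<bar>) < \<epsilon>" .
    moreover have "norm (sample_cov n X - mat 1) \<le> (\<Sum>k\<in>UNIV. norm ((sample_cov n X - mat 1) $ k))"
      unfolding norm_vec_def[of "sample_cov n X - mat 1"] by (rule L2_set_le_sum) simp
    moreover have "\<dots> \<le> (\<Sum>k\<in>UNIV. \<Sum>l\<in>UNIV. \<bar>(sample_cov n X - mat 1) $ k $ l\<bar>)"
      by (intro sum_mono norm_le_l1_cart)
    ultimately show False using X(2) by linarith
  qed
  have le: "measure (?G n) {X \<in> space (?G n). \<epsilon> \<le> norm (sample_cov n X - mat 1)}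
     \<le> (\<Sum>k\<in>UNIV. \<Sum>l\<in>UNIV. measure (?G n) (A n k l)) + (\<Sum>k\<in>UNIV. measure (?G n) (D n k))"
    if n: "n \<ge> 1" for n
  proof -
    interpret prob_space "?G n" by (rule prob_space_gaussian_sample)
    have "measure (?G n) {X \<in> space (?G n). \<epsilon> \<le> norm (sample_cov n X - mat 1)}
      \<le> measure (?G n) ((\<Union>k. \<Union>l. A n k l) \<union> (\<Union>k. D n k))"
      using sub[OF n] A_sets D_sets by (intro finite_measure_mono) auto
    also have "\<dots> \<le> measure (?G n) (\<Union>k. \<Union>l. A n k l) + measure (?G n) (\<Union>k. D n k)"
      using A_sets D_sets by (intro measure_Un_le) auto
    also have "measure (?G n) (\<Union>k. \<Union>l. A n k l) \<le> (\<Sum>k\<in>UNIV. measure (?G n) (\<Union>l. A n k l))"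
      using A_sets by (intro measure_UNION_le) auto
    also have "\<dots> \<le> (\<Sum>k\<in>UNIV. \<Sum>l\<in>UNIV. measure (?G n) (A n k l))"
      using A_sets by (intro sum_mono measure_UNION_le) auto
    also have "measure (?G n) (\<Union>k. D n k) \<le> (\<Sum>k\<in>UNIV. measure (?G n) (D n k))"
      using D_sets by (intro measure_UNION_le) auto
    finally show ?thesis by simp
  qed
  show ?thesis
  proof (rule tendsto_sandwich[OF _ _ tendsto_const])
    show "eventually (\<lambda>n. measure (?G n) {X \<in> space (?G n). \<epsilon> \<le> norm (sample_cov n X - mat 1)}
     \<le> (\<Sum>k\<in>UNIV. \<Sum>l\<in>UNIV. measure (?G n) (A n k l)) + (\<Sum>k\<in>UNIV. measure (?G n) (D n k))) sequentially"
      by (rule eventually_sequentiallyI[of 1]) (rule le)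
    show "(\<lambda>n. (\<Sum>k\<in>UNIV. \<Sum>l\<in>UNIV. measure (?G n) (A n k l)) + (\<Sum>k\<in>UNIV. measure (?G n) (D n k))) \<longlonglongrightarrow> 0"
      by (intro tendsto_add_zero tendsto_null_sum A0 D0)
  qed simp
qed

section \<open>The exact law of the self-normalized score\<close>

lemma measurable_PiM_component2:
  "a \<in> S \<Longrightarrow> b \<in> T \<Longrightarrow> (\<lambda>y. y a b) \<in> measurable (PiM S (\<lambda>_. PiM T (\<lambda>_. M))) M"
  by (rule measurable_compose[of "\<lambda>y. y a" _ "PiM T (\<lambda>_. M)" "\<lambda>x. x b"])
    (auto intro: measurable_component_singleton)

text \<open>Regroups an independent array: a family indexed by \<open>K\<close> is a family of rows indexed by \<open>S\<close>,
  each indexed by \<open>T\<close>. The functions \<open>s\<close> and \<open>t\<close> give row and column of an index and \<open>g\<close>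
  inverts them, so that the rows may be taken along either factor of a product \<open>K\<close>.\<close>

lemma PiM_uncurry:
  assumes M: "prob_space M" and fin: "finite S" "finite T"
    and o: "\<And>k. k \<in> K \<Longrightarrow> s k \<in> S" "\<And>k. k \<in> K \<Longrightarrow> t k \<in> T" "\<And>k. k \<in> K \<Longrightarrow> g (s k) (t k) = k"
    and g: "\<And>a b. a \<in> S \<Longrightarrow> b \<in> T \<Longrightarrow> g a b \<in> K \<and> s (g a b) = a \<and> t (g a b) = b"
  shows "distr (PiM S (\<lambda>_. PiM T (\<lambda>_. M))) (PiM K (\<lambda>_. M)) (\<lambda>y. \<lambda>k\<in>K. y (s k) (t k)) = PiM K (\<lambda>_. M)"
proof -
  interpret M: prob_space M by fact
  have pT: "prob_space (PiM T (\<lambda>_. M))" by (intro prob_space_PiM M)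
  interpret P: product_sigma_finite "\<lambda>_. M" by (intro product_sigma_finite_prob_spaces M)
  interpret PT: product_sigma_finite "\<lambda>_. PiM T (\<lambda>_. M)" by (intro product_sigma_finite_prob_spaces pT)
  have bij: "bij_betw (\<lambda>(a, b). g a b) (S \<times> T) K"
    by (rule bij_betw_byWitness[where f' = "\<lambda>k. (s k, t k)"]) (use o g in auto)
  then have K: "finite K" using fin bij_betw_finite by blast
  have meas: "(\<lambda>y. \<lambda>k\<in>K. y (s k) (t k)) \<in> measurable (PiM S (\<lambda>_. PiM T (\<lambda>_. M))) (PiM K (\<lambda>_. M))"
    using o by (intro measurable_restrict measurable_PiM_component2)
  show ?thesis
  proof (rule P.PiM_eqI[OF K])
    fix A assume A: "\<And>i. i \<in> K \<Longrightarrow> A i \<in> sets M"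
    have AM: "A k \<subseteq> space M" if "k \<in> K" for k using A[OF that] by (rule sets.sets_into_space)
    have pre: "(\<lambda>y. \<lambda>k\<in>K. y (s k) (t k)) -` PiE K A \<inter> space (PiM S (\<lambda>_. PiM T (\<lambda>_. M)))
      = PiE S (\<lambda>a. PiE T (\<lambda>b. A (g a b)))" (is "?L = ?R")
    proof (intro set_eqI iffI)
      fix y assume y: "y \<in> ?L"
      then have "y (s k) (t k) \<in> A k" if "k \<in> K" for k using that by (auto simp: PiE_iff)
      then have "y a b \<in> A (g a b)" if "a \<in> S" "b \<in> T" for a b
        using g[OF that] by metis
      then show "y \<in> ?R" using y by (auto simp: space_PiM PiE_iff)
    next
      fix y assume y: "y \<in> ?R"
      then have "y (s k) (t k) \<in> A k" if "k \<in> K" for k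
        using o[OF that] by (fastforce simp: PiE_iff)
      then show "y \<in> ?L" using y AM g by (fastforce simp: space_PiM PiE_iff)
    qed
    have "emeasure (distr (PiM S (\<lambda>_. PiM T (\<lambda>_. M))) (PiM K (\<lambda>_. M)) (\<lambda>y. \<lambda>k\<in>K. y (s k) (t k))) (PiE K A)
       = emeasure (PiM S (\<lambda>_. PiM T (\<lambda>_. M))) (PiE S (\<lambda>a. PiE T (\<lambda>b. A (g a b))))"
      using A K meas by (subst emeasure_distr) (auto simp: pre intro!: sets_PiM_I_finite)
    also have "\<dots> = (\<Prod>a\<in>S. \<Prod>b\<in>T. emeasure M (A (g a b)))"
      using fin A g by (simp add: PT.emeasure_PiM P.emeasure_PiM sets_PiM_I_finite)
    also have "\<dots> = (\<Prod>k\<in>K. emeasure M (A k))"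
      using prod.reindex_bij_betw[OF bij, of "\<lambda>k. emeasure M (A k)"]
      by (simp add: prod.cartesian_product case_prod_unfold)
    finally show "emeasure (distr (PiM S (\<lambda>_. PiM T (\<lambda>_. M))) (PiM K (\<lambda>_. M)) (\<lambda>y. \<lambda>k\<in>K. y (s k) (t k))) (PiE K A)
      = (\<Prod>k\<in>K. emeasure M (A k))" .
  qed simp
qed

text \<open>Convolution of normal laws. Terms with a zero coefficient are
  removed first, as their law has no density.\<close>

lemma distr_iid_normal_unit_combination:
  assumes I: "finite I" and c: "(\<Sum>i\<in>I. (c i)\<^sup>2) = 1"
  shows "distr (iid_normal I) borel (\<lambda>x. \<Sum>i\<in>I. c i * x i) = density lborel std_normal_density"
proof -
  let ?M = "iid_normal I"
  interpret prob_space ?M by (rule prob_space_iid_normal)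
  let ?J = "{i\<in>I. c i \<noteq> 0}"
  have ne: "?J \<noteq> {}"
  proof
    assume "?J = {}"
    then have "(\<Sum>i\<in>I. (c i)\<^sup>2) = 0" by (intro sum.neutral) auto
    then show False using c by simp
  qed
  have ind: "indep_vars (\<lambda>_. density lborel std_normal_density) (\<lambda>i x. x i) I"
    using ne by (intro indep_vars_PiM_coordinates prob_space_std_normal) auto
  have "indep_vars (\<lambda>_. borel) (\<lambda>i x. c i * x i) I"
    by (rule indep_vars_compose2[OF ind, of "\<lambda>i x. c i * x"]) simp
  then have indJ: "indep_vars (\<lambda>_. borel) (\<lambda>i x. c i * x i) ?J"
    by (rule indep_vars_subset) auto
  have dist: "distributed ?M lborel (\<lambda>x. c i * x i) (normal_density 0 \<bar>c i\<bar>)" if i: "i \<in> ?J" for i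
  proof -
    have "distr ?M lborel (\<lambda>x. x i) = distr ?M (density lborel std_normal_density) (\<lambda>x. x i)"
      by (rule distr_cong) auto
    also have "\<dots> = density lborel std_normal_density"
      using i by (intro distr_PiM_component prob_space_std_normal) auto
    finally have "distributed ?M lborel (\<lambda>x. x i) (normal_density 0 1)"
      using i by (auto simp: distributed_def)
    from normal_density_affine[OF this, of "c i" 0] i show ?thesis by simp
  qed
  have "distributed ?M lborel (\<lambda>x. \<Sum>i\<in>?J. c i * x i) (normal_density (\<Sum>i\<in>?J. 0) (sqrt (\<Sum>i\<in>?J. \<bar>c i\<bar>\<^sup>2)))"
    using I ne by (intro sum_indep_normal indJ dist) auto
  moreover have "(\<Sum>i\<in>?J. \<bar>c i\<bar>\<^sup>2) = (\<Sum>i\<in>I. (c i)\<^sup>2)"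
    using I by (intro sum.mono_neutral_cong_left) auto
  moreover have "(\<Sum>i\<in>?J. c i * x i) = (\<Sum>i\<in>I. c i * x i)" for x
    using I by (intro sum.mono_neutral_left) auto
  ultimately have "distributed ?M lborel (\<lambda>x. \<Sum>i\<in>I. c i * x i) std_normal_density"
    using c by simp
  then have "distr ?M lborel (\<lambda>x. \<Sum>i\<in>I. c i * x i) = density lborel std_normal_density"
    by (simp add: distributed_def)
  moreover have "distr ?M lborel (\<lambda>x. \<Sum>i\<in>I. c i * x i) = distr ?M borel (\<lambda>x. \<Sum>i\<in>I. c i * x i)"
    by (rule distr_cong) auto
  ultimately show ?thesis by simp
qed

text \<open>The centred values of \<open>a\<close>, scaled to a vector of unit norm. If all values agree, a coordinate
  vector stands in, so that the norm is \<open>1\<close> in every case.\<close>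

definition contrast :: "nat \<Rightarrow> (nat \<Rightarrow> real) \<Rightarrow> nat \<Rightarrow> real"
  where "contrast n a i =
    (let m = (\<Sum>k\<in>{1..n}. a k) / real n; q = (\<Sum>k\<in>{1..n}. (a k - m)\<^sup>2)
     in if q = 0 then (if i = 1 then 1 else 0) else (a i - m) / sqrt q)"

lemma contrast_unit:
  assumes "n \<ge> 1"
  shows "(\<Sum>i\<in>{1..n}. (contrast n a i)\<^sup>2) = 1"
proof -
  define m where "m = (\<Sum>k\<in>{1..n}. a k) / real n"
  define q where "q = (\<Sum>k\<in>{1..n}. (a k - m)\<^sup>2)"
  have q0: "q \<ge> 0" unfolding q_def by (intro sum_nonneg) auto
  have w: "contrast n a i = (if q = 0 then (if i = 1 then 1 else 0) else (a i - m) / sqrt q)" for i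
    by (simp add: contrast_def Let_def m_def q_def)
  show ?thesis
  proof (cases "q = 0")
    case True
    have "(\<Sum>i\<in>{1..n}. (contrast n a i)\<^sup>2) = (\<Sum>i\<in>{1..n}. if i = 1 then 1 else 0)"
      using True by (intro sum.cong) (auto simp: w)
    then show ?thesis using assms by simp
  next
    case False
    have "(\<Sum>i\<in>{1..n}. (contrast n a i)\<^sup>2) = (\<Sum>i\<in>{1..n}. (a i - m)\<^sup>2 / q)"
      using False q0 by (intro sum.cong) (auto simp: w power_divide)
    also have "\<dots> = 1" using False by (simp add: q_def flip: sum_divide_distrib)
    finally show ?thesis .
  qed
qed

lemma contrast_cong:
  assumes "\<And>i. i \<in> {1..n} \<Longrightarrow> a i = b i" "i \<in> {1..n}"
  shows "contrast n a i = contrast n b i"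
proof -
  have "(\<Sum>k\<in>{1..n}. a k) = (\<Sum>k\<in>{1..n}. b k)" using assms by (intro sum.cong) auto
  moreover have "(\<Sum>k\<in>{1..n}. (a k - m)\<^sup>2) = (\<Sum>k\<in>{1..n}. (b k - m)\<^sup>2)" for m
    using assms by (intro sum.cong) auto
  ultimately show ?thesis using assms by (simp only: contrast_def)
qed

lemma measurable_contrast:
  assumes "\<And>i. i \<in> {1..n} \<Longrightarrow> (\<lambda>x. a x i) \<in> borel_measurable M" "i \<in> {1..n}"
  shows "(\<lambda>x. contrast n (a x) i) \<in> borel_measurable M"
proof -
  have m: "(\<lambda>x. (\<Sum>k\<in>{1..n}. a x k) / real n) \<in> borel_measurable M"
    using assms by (intro borel_measurable_divide borel_measurable_sum) auto
  have q: "(\<lambda>x. \<Sum>k\<in>{1..n}. (a x k - (\<Sum>k\<in>{1..n}. a x k) / real n)\<^sup>2) \<in> borel_measurable M"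
    using assms m by (intro borel_measurable_sum borel_measurable_power borel_measurable_diff)
  show ?thesis
    unfolding contrast_def Let_def
    using assms m q by (intro measurable_If borel_measurable_divide borel_measurable_diff measurable_const borel_measurable_sqrt)
       (auto intro!: borel_measurable_eq)
qed

definition orth_part :: "'a::real_inner \<Rightarrow> 'a \<Rightarrow> 'a"
  where "orth_part \<theta> y = y - (\<theta> \<bullet> y) *\<^sub>R \<theta>"

lemma linear_orth_part: "linear (orth_part \<theta>)"
  by (rule linearI) (simp_all add: orth_part_def inner_add_right algebra_simps)

text \<open>Up to a scalar factor tending to \<open>1\<close>, this is \<open>sqrt n\<close> times the part of
  \<open>sample_cov n Y *v \<theta>\<close> orthogonal to \<open>\<theta>\<close>. The weights depend only on the coordinates of the
  sample along \<open>\<theta>\<close>, and the weighted vectors only on the other coordinates.\<close>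

definition score :: "nat \<Rightarrow> real ^ 'p \<Rightarrow> 'p sample \<Rightarrow> real ^ ('p::finite)"
  where "score n \<theta> Y = (\<Sum>i\<in>{1..n}. contrast n (\<lambda>i. \<theta> \<bullet> Y i) i *\<^sub>R orth_part \<theta> (Y i))"

lemma measurable_score [measurable]: "score n \<theta> \<in> borel_measurable (sample_space n)"
proof -
  have "(\<lambda>Y. contrast n (\<lambda>i. \<theta> \<bullet> Y i) i) \<in> borel_measurable (sample_space n)" if "i \<in> {1..n}" for i
    using that by (intro measurable_contrast) measurable
  moreover have "(\<lambda>Y. orth_part \<theta> (Y i)) \<in> borel_measurable (sample_space n)" if "i \<in> {1..n}" for i
    using that unfolding orth_part_def by measurable
  ultimately show ?thesis
    unfolding score_def[abs_def] by (intro borel_measurable_sum borel_measurable_scaleR)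
qed

lemma distr_coordinates_std_gaussian:
  fixes B :: "'a::euclidean_space set"
  assumes B: "orthonormal_basis B"
  shows "distr std_gaussian (PiM B (\<lambda>_. borel)) (\<lambda>y. \<lambda>b\<in>B. y \<bullet> b) = iid_normal B"
proof -
  have "distr std_gaussian (PiM B (\<lambda>_. borel)) (\<lambda>y. \<lambda>b\<in>B. y \<bullet> b)
    = distr (iid_normal B) (PiM B (\<lambda>_. borel)) (\<lambda>z. \<lambda>c\<in>B. (\<Sum>b\<in>B. z b *\<^sub>R b) \<bullet> c)"
    unfolding std_gaussian_orthonormal[OF B, symmetric]
    by (subst distr_distr) (auto simp: comp_def)
  also have "\<dots> = distr (iid_normal B) (iid_normal B) (\<lambda>z. z)"
    by (rule distr_cong)
       (auto simp: orthonormal_basis_inner_sum[OF B] space_PiM PiE_iff extensional_def fun_eq_iff intro!: sets_PiM_cong)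
  finally show ?thesis by simp
qed

lemma distr_coordinates_gaussian_sample:
  assumes B: "orthonormal_basis B"
  shows "distr (gaussian_sample n) (PiM ({1..n} \<times> B) (\<lambda>_. borel)) (\<lambda>Y. \<lambda>k\<in>{1..n} \<times> B. Y (fst k) \<bullet> snd k)
    = iid_normal ({1..n} \<times> B)"
proof -
  have "distr (gaussian_sample n) (PiM {1..n} (\<lambda>_. PiM B (\<lambda>_. borel))) (\<lambda>Y. \<lambda>i\<in>{1..n}. \<lambda>b\<in>B. Y i \<bullet> b)
    = PiM {1..n} (\<lambda>_. iid_normal B)"
    using PiM_distr[of "{1..n}" "\<lambda>_. std_gaussian" "\<lambda>_ y. \<lambda>b\<in>B. y \<bullet> b" "\<lambda>_. PiM B (\<lambda>_. borel)"]
    by (simp add: distr_coordinates_std_gaussian[OF B] product_sigma_finite_prob_spaces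
        prob_space_std_gaussian prob_space_iid_normal)
  moreover have "distr (PiM {1..n} (\<lambda>_. iid_normal B)) (iid_normal ({1..n} \<times> B)) (\<lambda>y. \<lambda>k\<in>{1..n} \<times> B. y (fst k) (snd k))
    = iid_normal ({1..n} \<times> B)"
    by (rule PiM_uncurry[where g = Pair]) (auto simp: prob_space_std_normal orthonormal_basis_finite[OF B])
  moreover have "distr (distr (gaussian_sample n) (PiM {1..n} (\<lambda>_. PiM B (\<lambda>_. borel))) (\<lambda>Y. \<lambda>i\<in>{1..n}. \<lambda>b\<in>B. Y i \<bullet> b))
       (iid_normal ({1..n} \<times> B)) (\<lambda>y. \<lambda>k\<in>{1..n} \<times> B. y (fst k) (snd k))
     = distr (gaussian_sample n) (iid_normal ({1..n} \<times> B))
       (\<lambda>Y. \<lambda>k\<in>{1..n} \<times> B. (\<lambda>i\<in>{1..n}. \<lambda>b\<in>B. Y i \<bullet> b) (fst k) (snd k))"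
  proof (subst distr_distr)
    show "(\<lambda>y. \<lambda>k\<in>{1..n} \<times> B. y (fst k) (snd k)) \<in> measurable (PiM {1..n} (\<lambda>_. PiM B (\<lambda>_. borel))) (iid_normal ({1..n} \<times> B))"
      by (intro measurable_restrict) (auto intro!: measurable_PiM_component2[of _ "{1..n}" _ B borel, simplified])
    show "(\<lambda>Y. \<lambda>i\<in>{1..n}. \<lambda>b\<in>B. Y i \<bullet> b) \<in> measurable (gaussian_sample n) (PiM {1..n} (\<lambda>_. PiM B (\<lambda>_. borel)))"
      by measurable
  qed (simp add: comp_def)
  moreover have "\<dots> = distr (gaussian_sample n) (PiM ({1..n} \<times> B) (\<lambda>_. borel)) (\<lambda>Y. \<lambda>k\<in>{1..n} \<times> B. Y (fst k) \<bullet> snd k)"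
    by (rule distr_cong) (auto intro!: sets_PiM_cong simp: fun_eq_iff)
  ultimately show ?thesis by simp
qed

lemma bij_betw_lessThan_card_starting:
  assumes "finite B" "e \<in> B"
  obtains h where "bij_betw h {..<card B} B" "h 0 = e"
proof -
  obtain h where h: "bij_betw h {..<card B} B"
    using finite_same_card_bij[of "{..<card B}" B] assms by auto
  then have "e \<in> h ` {..<card B}" using assms(2) by (simp add: bij_betw_def)
  then obtain j where j: "j < card B" "h j = e" by blast
  have "bij_betw (Transposition.transpose 0 j) {..<card B} {..<card B}"
    using bij_betw_transpose_iff[of 0 "{..<card B}" j] j by simp
  then have "bij_betw (h \<circ> Transposition.transpose 0 j) {..<card B} B"
    using h by (rule bij_betw_trans)
  then show thesis using that[of "h \<circ> Transposition.transpose 0 j"] j by simp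
qed

text \<open>The chi-square law is defined by a shift of the coordinate with index \<open>0\<close> alone. The
  basis is enumerated so that the one vector \<open>e\<close> along which \<open>m\<close> has a component comes first.\<close>

lemma noncentral_chi_square_eq_distr:
  fixes B :: "'a::euclidean_space set" and m :: 'a
  assumes fin: "finite B" and card: "card B = k" and e: "e \<in> B"
    and m: "m \<bullet> e = sqrt \<delta>" "\<And>b. b \<in> B \<Longrightarrow> b \<noteq> e \<Longrightarrow> m \<bullet> b = 0"
  shows "distr (iid_normal B) borel (\<lambda>x. \<Sum>b\<in>B. (x b + m \<bullet> b)\<^sup>2) = noncentral_chi_square k \<delta>"
proof -
  let ?N = "\<lambda>\<mu>. density lborel (normal_density \<mu> 1) :: real measure"
  note pN = prob_space_normal
  have k: "k > 0" using fin card e by (metis card_gt_0_iff empty_iff)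
  obtain h where h: "bij_betw h {..<k} B" "h 0 = e"
    using bij_betw_lessThan_card_starting[OF fin e] card by metis
  have shift: "distr (?N 0) borel (\<lambda>x. x + \<mu>) = ?N \<mu>" for \<mu>
  proof -
    interpret prob_space "?N 0" by (rule pN)
    have "distributed (?N 0) lborel (\<lambda>x. x) (normal_density 0 1)"
      by (auto simp: distributed_def distr_id2 sets_lborel)
    from normal_density_affine[OF this, of 1 \<mu>]
    have "distributed (?N 0) lborel (\<lambda>x. \<mu> + x) (normal_density \<mu> 1)" by simp
    then have "distr (?N 0) lborel (\<lambda>x. \<mu> + x) = ?N \<mu>" by (simp add: distributed_def)
    moreover have "distr (?N 0) lborel (\<lambda>x. \<mu> + x) = distr (?N 0) borel (\<lambda>x. x + \<mu>)"
      by (rule distr_cong) auto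
    ultimately show ?thesis by simp
  qed
  have sh: "distr (iid_normal B) (PiM B (\<lambda>_. borel)) (\<lambda>x. \<lambda>b\<in>B. x b + m \<bullet> b) = PiM B (\<lambda>b. ?N (m \<bullet> b))"
    using PiM_distr[of B "\<lambda>_. ?N 0" "\<lambda>b x. x + m \<bullet> b" "\<lambda>_. borel"] fin pN
    by (simp add: shift product_sigma_finite_prob_spaces)
  have "noncentral_chi_square k \<delta> = distr (PiM {..<k} (\<lambda>i. ?N (m \<bullet> h i))) borel (\<lambda>z. \<Sum>i<k. (z i)\<^sup>2)"
  proof -
    have "m \<bullet> h i = (if i = 0 then sqrt \<delta> else 0)" if "i < k" for i
    proof (cases "i = 0")
      case False
      have "h i \<in> B" using that h(1) by (auto simp: bij_betw_def)
      moreover have "h i \<noteq> e"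
        using inj_onD[OF bij_betw_imp_inj_on[OF h(1)], of i 0] that k h(2) False by auto
      ultimately show ?thesis using m(2) False by simp
    qed (use m h in simp)
    then have "PiM {..<k} (\<lambda>i. ?N (m \<bullet> h i)) = PiM {..<k} (\<lambda>i. ?N (if i = 0 then sqrt \<delta> else 0))"
      by (intro PiM_cong) auto
    then show ?thesis by (simp add: noncentral_chi_square_def)
  qed
  also have "PiM {..<k} (\<lambda>i. ?N (m \<bullet> h i))
    = distr (PiM B (\<lambda>b. ?N (m \<bullet> b))) (PiM {..<k} (\<lambda>i. ?N (m \<bullet> h i))) (\<lambda>w. \<lambda>i\<in>{..<k}. w (h i))"
    using h(1) by (intro distr_PiM_reindex[symmetric] pN) (auto simp: bij_betw_def)
  also have "distr \<dots> borel (\<lambda>z. \<Sum>i<k. (z i)\<^sup>2) = distr (PiM B (\<lambda>b. ?N (m \<bullet> b))) borel (\<lambda>w. \<Sum>b\<in>B. (w b)\<^sup>2)"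
  proof (subst distr_distr)
    show "(\<lambda>w. \<lambda>i\<in>{..<k}. w (h i)) \<in> measurable (PiM B (\<lambda>b. ?N (m \<bullet> b))) (PiM {..<k} (\<lambda>i. ?N (m \<bullet> h i)))"
    proof (rule measurable_restrict)
      fix i assume "i \<in> {..<k}"
      then have "h i \<in> B" using h(1) by (auto simp: bij_betw_def)
      then show "(\<lambda>w. w (h i)) \<in> measurable (PiM B (\<lambda>b. ?N (m \<bullet> b))) (?N (m \<bullet> h i))"
        using measurable_component_singleton[of "h i" B "\<lambda>b. ?N (m \<bullet> b)"] by simp
    qed
    show "(\<lambda>z. \<Sum>i<k. (z i)\<^sup>2) \<in> borel_measurable (PiM {..<k} (\<lambda>i. ?N (m \<bullet> h i)))" by measurable
    have "(\<Sum>i<k. (w (h i))\<^sup>2) = (\<Sum>b\<in>B. (w b)\<^sup>2)" for w :: "'a \<Rightarrow> real"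
      using sum.reindex_bij_betw[OF h(1), of "\<lambda>b. (w b)\<^sup>2"] .
    then show "distr (PiM B (\<lambda>b. ?N (m \<bullet> b))) borel ((\<lambda>z. \<Sum>i<k. (z i)\<^sup>2) \<circ> (\<lambda>w. \<lambda>i\<in>{..<k}. w (h i)))
      = distr (PiM B (\<lambda>b. ?N (m \<bullet> b))) borel (\<lambda>w. \<Sum>b\<in>B. (w b)\<^sup>2)"
      by (simp add: comp_def)
  qed
  also have "\<dots> = distr (iid_normal B) borel (\<lambda>x. \<Sum>b\<in>B. (x b + m \<bullet> b)\<^sup>2)"
    unfolding sh[symmetric] by (subst distr_distr) (auto simp: comp_def cong: sum.cong)
  finally show ?thesis by simp
qed

text \<open>For a fixed unit vector \<open>c\<close> of weights, combining the entries of each column gives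
  independent standard normal variables again, one for every \<open>b \<in> B\<close>.\<close>

lemma distr_combination_noncentral:
  fixes B :: "'a::euclidean_space set" and m :: 'a
  assumes fin: "finite B" "finite I" and card: "card B = k" and e: "e \<in> B"
    and m: "m \<bullet> e = sqrt \<delta>" "\<And>b. b \<in> B \<Longrightarrow> b \<noteq> e \<Longrightarrow> m \<bullet> b = 0"
    and c: "(\<Sum>i\<in>I. (c i)\<^sup>2) = 1"
  shows "distr (iid_normal (I \<times> B)) borel (\<lambda>z. \<Sum>b\<in>B. ((\<Sum>i\<in>I. c i * z (i, b)) + m \<bullet> b)\<^sup>2) = noncentral_chi_square k \<delta>"
proof -
  have eq: "iid_normal (I \<times> B) = distr (PiM B (\<lambda>_. iid_normal I)) (iid_normal (I \<times> B)) (\<lambda>y. \<lambda>k\<in>I \<times> B. y (snd k) (fst k))"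
    by (rule PiM_uncurry[where g = "\<lambda>b i. (i, b)", symmetric]) (auto simp: prob_space_std_normal fin)
  have m1: "(\<lambda>y. \<lambda>k\<in>I \<times> B. y (snd k) (fst k)) \<in> measurable (PiM B (\<lambda>_. iid_normal I)) (iid_normal (I \<times> B))"
    by (intro measurable_restrict measurable_PiM_component2) auto
  have m2: "(\<lambda>z. \<Sum>b\<in>B. ((\<Sum>i\<in>I. c i * z (i, b)) + m \<bullet> b)\<^sup>2) \<in> borel_measurable (iid_normal (I \<times> B))"
    by measurable
  have "distr (iid_normal (I \<times> B)) borel (\<lambda>z. \<Sum>b\<in>B. ((\<Sum>i\<in>I. c i * z (i, b)) + m \<bullet> b)\<^sup>2)
    = distr (PiM B (\<lambda>_. iid_normal I)) borel (\<lambda>y. \<Sum>b\<in>B. ((\<Sum>i\<in>I. c i * y b i) + m \<bullet> b)\<^sup>2)"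
    by (subst eq, subst distr_distr[OF m2 m1]) (simp add: comp_def cong: sum.cong)
  also have "\<dots> = distr (distr (PiM B (\<lambda>_. iid_normal I)) (PiM B (\<lambda>_. borel)) (\<lambda>y. \<lambda>b\<in>B. \<Sum>i\<in>I. c i * y b i)) borel
     (\<lambda>x. \<Sum>b\<in>B. (x b + m \<bullet> b)\<^sup>2)"
  proof (subst distr_distr)
    show "(\<lambda>y. \<lambda>b\<in>B. \<Sum>i\<in>I. c i * y b i) \<in> measurable (PiM B (\<lambda>_. iid_normal I)) (PiM B (\<lambda>_. borel))"
    proof (intro measurable_restrict borel_measurable_sum borel_measurable_times measurable_const)
      fix b i assume "b \<in> B" "i \<in> I"
      from measurable_PiM_component2[OF this, of "density lborel std_normal_density"]
      show "(\<lambda>y. y b i) \<in> borel_measurable (PiM B (\<lambda>_. iid_normal I))" by simp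
    qed simp_all
  qed (auto simp: comp_def cong: sum.cong)
  also have "distr (PiM B (\<lambda>_. iid_normal I)) (PiM B (\<lambda>_. borel)) (\<lambda>y. \<lambda>b\<in>B. \<Sum>i\<in>I. c i * y b i) = iid_normal B"
    using PiM_distr[of B "\<lambda>_. iid_normal I" "\<lambda>_ x. \<Sum>i\<in>I. c i * x i" "\<lambda>_. borel"] fin
    by (simp add: distr_iid_normal_unit_combination[OF fin(2) c] product_sigma_finite_prob_spaces
        prob_space_iid_normal prob_space_std_normal)
  also have "distr (iid_normal B) borel (\<lambda>x. \<Sum>b\<in>B. (x b + m \<bullet> b)\<^sup>2) = noncentral_chi_square k \<delta>"
    by (rule noncentral_chi_square_eq_distr[OF fin(1) card e m])
  finally show ?thesis .
qed

text \<open>Given the coordinates along \<open>\<theta>\<close>, the weights of the score are fixed and have unit norm,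
  while the orthogonal coordinates are still independent standard normal. The conditional law is
  therefore noncentral chi-square with parameters not depending on the condition, and so is the
  unconditional one. Conditioning amounts to Fubini's theorem for the split of the coordinates
  into \<open>I \<times> {\<theta>}\<close> and \<open>I \<times> B'\<close>.\<close>

lemma distr_score:
  fixes \<theta> :: "real ^ 'p"
  assumes p: "2 \<le> CARD('p)" and \<theta>: "norm \<theta> = 1" and m: "\<theta> \<bullet> m = 0" and n: "n \<ge> 1"
  shows "distr (gaussian_sample n) borel (\<lambda>Y. (norm (score n \<theta> Y + m))\<^sup>2)
    = noncentral_chi_square (CARD('p) - 1) ((norm m)\<^sup>2)"
proof -
  obtain e where e: "norm e = 1" "\<theta> \<bullet> e = 0" "m = norm m *\<^sub>R e"
  proof (cases "m = 0")
    case True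
    obtain e where "norm e = 1" "\<theta> \<bullet> e = 0"
      using exists_orthogonal_unit_vector[of \<theta>] p \<theta> by auto
    then show ?thesis using that True by simp
  next
    case False
    then show ?thesis using that[of "m /\<^sub>R norm m"] m by simp
  qed
  have \<theta>\<theta>: "\<theta> \<bullet> \<theta> = 1" and ee: "e \<bullet> e = 1" using \<theta> e by (simp_all add: norm_eq_1)
  obtain B where B: "orthonormal_basis B" "\<theta> \<in> B" "e \<in> B"
    using orthonormal_basis_extend[of "{\<theta>, e}"] \<theta> e by (auto simp: pairwise_insert orthogonal_def inner_commute)
  define I where "I = {1..n}"
  define B' where "B' = B - {\<theta>}"
  have fin: "finite B" "finite B'" "finite I"
    using orthonormal_basis_finite[OF B(1)] by (auto simp: B'_def I_def)
  have card: "card B' = CARD('p) - 1"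
    using B fin by (simp add: B'_def orthonormal_basis_def)
  have eB: "e \<in> B'" using B(3) e(2) \<theta>\<theta> by (auto simp: B'_def)
  have me: "m \<bullet> e = sqrt ((norm m)\<^sup>2)" by (subst e(3)) (simp add: ee)
  have mb: "m \<bullet> b = 0" if "b \<in> B'" "b \<noteq> e" for b
    using orthonormal_basis_inner[OF B(1,3), of b] that by (subst e(3)) (auto simp: B'_def)
  define F where "F z = (\<Sum>b\<in>B'. ((\<Sum>i\<in>I. contrast n (\<lambda>i. z (i, \<theta>)) i * z (i, b)) + m \<bullet> b)\<^sup>2)"
    for z :: "nat \<times> (real ^ 'p) \<Rightarrow> real"
  have comp: "(\<lambda>z. z (i, b)) \<in> borel_measurable (PiM (I \<times> B) (\<lambda>_. borel))" if "i \<in> I" "b \<in> B" for i b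
    using that by (intro measurable_component_singleton) auto
  have Fm: "F \<in> borel_measurable (PiM (I \<times> B) (\<lambda>_. borel))"
    unfolding F_def[abs_def] I_def
    by (intro borel_measurable_sum borel_measurable_power borel_measurable_add borel_measurable_times
        measurable_contrast comp[unfolded I_def] measurable_const) (use B in \<open>auto simp: B'_def\<close>)
  then have Fm': "F \<in> borel_measurable (iid_normal (I \<times> B))"
    by (simp cong: measurable_cong_sets sets_PiM_cong)
  have norm_F: "(norm (score n \<theta> Y + m))\<^sup>2 = F (\<lambda>k\<in>I \<times> B. Y (fst k) \<bullet> snd k)" for Y
  proof -
    have c: "contrast n (\<lambda>i. (\<lambda>k\<in>I \<times> B. Y (fst k) \<bullet> snd k) (i, \<theta>)) i = contrast n (\<lambda>i. \<theta> \<bullet> Y i) i" if "i \<in> I" for i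
      using that B by (intro contrast_cong) (auto simp: I_def inner_commute)
    have "(norm (score n \<theta> Y + m))\<^sup>2 = (\<Sum>b\<in>B. ((score n \<theta> Y + m) \<bullet> b)\<^sup>2)"
      by (rule orthonormal_basis_norm[OF B(1)])
    also have "\<dots> = ((score n \<theta> Y + m) \<bullet> \<theta>)\<^sup>2 + (\<Sum>b\<in>B'. ((score n \<theta> Y + m) \<bullet> b)\<^sup>2)"
      unfolding B'_def using fin B by (intro sum.remove)
    also have "(score n \<theta> Y + m) \<bullet> \<theta> = 0"
      using m by (simp add: score_def orth_part_def inner_add_left inner_sum_left inner_diff_left \<theta>\<theta> inner_commute[of m] inner_commute[of \<theta> "Y _"])
    also have "(\<Sum>b\<in>B'. ((score n \<theta> Y + m) \<bullet> b)\<^sup>2) = F (\<lambda>k\<in>I \<times> B. Y (fst k) \<bullet> snd k)"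
      unfolding F_def
    proof (intro sum.cong refl)
      fix b assume b: "b \<in> B'"
      then have "\<theta> \<bullet> b = 0" "b \<in> B" using orthonormal_basis_inner[OF B(1,2), of b] by (auto simp: B'_def)
      then have "score n \<theta> Y \<bullet> b = (\<Sum>i\<in>I. contrast n (\<lambda>i. \<theta> \<bullet> Y i) i * (Y i \<bullet> b))"
        by (simp add: score_def orth_part_def inner_sum_left inner_diff_left I_def)
      also have "\<dots> = (\<Sum>i\<in>I. contrast n (\<lambda>i. (\<lambda>k\<in>I \<times> B. Y (fst k) \<bullet> snd k) (i, \<theta>)) i * (\<lambda>k\<in>I \<times> B. Y (fst k) \<bullet> snd k) (i, b))"
        using \<open>b \<in> B\<close> c by (intro sum.cong) auto
      finally show "((score n \<theta> Y + m) \<bullet> b)\<^sup>2 = ((\<Sum>i\<in>I. contrast n (\<lambda>i. (\<lambda>k\<in>I \<times> B. Y (fst k) \<bullet> snd k) (i, \<theta>)) i *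
          (\<lambda>k\<in>I \<times> B. Y (fst k) \<bullet> snd k) (i, b)) + m \<bullet> b)\<^sup>2"
        by (simp only: inner_add_left)
    qed
    finally show ?thesis by simp
  qed
  have cm: "(\<lambda>Y. \<lambda>k\<in>I \<times> B. Y (fst k) \<bullet> snd k) \<in> measurable (gaussian_sample n) (PiM (I \<times> B) (\<lambda>_. borel))"
    unfolding I_def
    by (intro measurable_restrict borel_measurable_inner measurable_const)
      (auto intro!: measurable_component_singleton[of _ "{1..n}" "\<lambda>_. std_gaussian", simplified])
  have "distr (gaussian_sample n) borel (\<lambda>Y. (norm (score n \<theta> Y + m))\<^sup>2)
     = distr (distr (gaussian_sample n) (PiM (I \<times> B) (\<lambda>_. borel)) (\<lambda>Y. \<lambda>k\<in>I \<times> B. Y (fst k) \<bullet> snd k)) borel F"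
    unfolding norm_F by (subst distr_distr[OF Fm cm]) (simp add: comp_def)
  also have "\<dots> = distr (iid_normal (I \<times> B)) borel F"
    unfolding I_def distr_coordinates_gaussian_sample[OF B(1)] ..
  also have "\<dots> = noncentral_chi_square (CARD('p) - 1) ((norm m)\<^sup>2)" (is "_ = ?\<nu>")
  proof (rule measure_eqI)
    fix A assume "A \<in> sets (distr (iid_normal (I \<times> B)) borel F)"
    then have A: "A \<in> sets borel" by simp
    let ?J = "I \<times> {\<theta>}" and ?K = "I \<times> B'"
    interpret N: product_sigma_finite "\<lambda>_::nat \<times> (real ^ 'p). density lborel std_normal_density"
      by (intro product_sigma_finite_prob_spaces prob_space_std_normal)
    interpret J: prob_space "iid_normal ?J" by (rule prob_space_iid_normal)
    interpret K: prob_space "iid_normal ?K" by (rule prob_space_iid_normal)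
    have JK: "?J \<inter> ?K = {}" "?J \<union> ?K = I \<times> B" using B by (auto simp: B'_def)
    have merge: "distr (iid_normal ?J \<Otimes>\<^sub>M iid_normal ?K) (iid_normal (I \<times> B)) (merge ?J ?K) = iid_normal (I \<times> B)"
      using N.distr_merge[OF JK(1)] fin by (simp add: JK(2))
    have mm: "merge ?J ?K \<in> measurable (iid_normal ?J \<Otimes>\<^sub>M iid_normal ?K) (iid_normal (I \<times> B))"
      using measurable_merge[of ?J ?K "\<lambda>_. density lborel std_normal_density"] by (simp add: JK(2))
    have inner: "emeasure (iid_normal ?K) {w \<in> space (iid_normal ?K). F (merge ?J ?K (a, w)) \<in> A} = emeasure ?\<nu> A"
      for a
    proof -
      define c where "c = contrast n (\<lambda>i. a (i, \<theta>))"
      have eq: "F (merge ?J ?K (a, w)) = (\<Sum>b\<in>B'. ((\<Sum>i\<in>I. c i * w (i, b)) + m \<bullet> b)\<^sup>2)" for w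
        unfolding F_def
      proof (intro sum.cong refl arg_cong[where f = "\<lambda>x. (x + _)\<^sup>2"])
        fix b i assume "b \<in> B'" "i \<in> I"
        then show "contrast n (\<lambda>i. merge ?J ?K (a, w) (i, \<theta>)) i * merge ?J ?K (a, w) (i, b) = c i * w (i, b)"
          unfolding c_def
          by (intro arg_cong2[where f = "(*)"] contrast_cong) (auto simp: merge_def I_def B'_def)
      qed
      have meas: "(\<lambda>w. \<Sum>b\<in>B'. ((\<Sum>i\<in>I. c i * w (i, b)) + m \<bullet> b)\<^sup>2) \<in> borel_measurable (iid_normal ?K)"
        by measurable
      have "emeasure ?\<nu> A = emeasure (distr (iid_normal ?K) borel (\<lambda>w. \<Sum>b\<in>B'. ((\<Sum>i\<in>I. c i * w (i, b)) + m \<bullet> b)\<^sup>2)) A"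
        using contrast_unit[OF n, of "\<lambda>i. a (i, \<theta>)"]
        by (subst distr_combination_noncentral[OF fin(2,3) card eB me mb]) (auto simp: c_def I_def)
      also have "\<dots> = emeasure (iid_normal ?K) {w \<in> space (iid_normal ?K). F (merge ?J ?K (a, w)) \<in> A}"
        unfolding eq by (subst emeasure_distr[OF meas A]) (auto intro!: arg_cong[where f = "emeasure _"])
      finally show ?thesis by simp
    qed
    have FM: "(\<lambda>x. F (merge ?J ?K x)) \<in> borel_measurable (iid_normal ?J \<Otimes>\<^sub>M iid_normal ?K)"
      using mm Fm' by (rule measurable_compose)
    have "emeasure (distr (iid_normal (I \<times> B)) borel F) A
      = emeasure (distr (iid_normal ?J \<Otimes>\<^sub>M iid_normal ?K) borel (\<lambda>x. F (merge ?J ?K x))) A"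
      by (subst merge[symmetric], subst distr_distr[OF Fm' mm]) (simp add: comp_def)
    also have "\<dots> = emeasure (iid_normal ?J \<Otimes>\<^sub>M iid_normal ?K)
        ((\<lambda>x. F (merge ?J ?K x)) -` A \<inter> space (iid_normal ?J \<Otimes>\<^sub>M iid_normal ?K))"
      by (rule emeasure_distr[OF FM A])
    also have "\<dots> = (\<integral>\<^sup>+a. emeasure (iid_normal ?K)
        (Pair a -` ((\<lambda>x. F (merge ?J ?K x)) -` A \<inter> space (iid_normal ?J \<Otimes>\<^sub>M iid_normal ?K))) \<partial>iid_normal ?J)"
      by (rule K.emeasure_pair_measure_alt) (rule measurable_sets[OF FM A])
    also have "\<dots> = (\<integral>\<^sup>+a. emeasure ?\<nu> A \<partial>iid_normal ?J)"
    proof (rule nn_integral_cong)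
      fix a assume a: "a \<in> space (iid_normal ?J)"
      have "Pair a -` ((\<lambda>x. F (merge ?J ?K x)) -` A \<inter> space (iid_normal ?J \<Otimes>\<^sub>M iid_normal ?K))
        = {w \<in> space (iid_normal ?K). F (merge ?J ?K (a, w)) \<in> A}"
        using a by (auto simp: space_pair_measure)
      then show "emeasure (iid_normal ?K)
        (Pair a -` ((\<lambda>x. F (merge ?J ?K x)) -` A \<inter> space (iid_normal ?J \<Otimes>\<^sub>M iid_normal ?K))) = emeasure ?\<nu> A"
        using inner[of a] by simp
    qed
    also have "\<dots> = emeasure ?\<nu> A" by (simp add: J.emeasure_space_1)
    finally show "emeasure (distr (iid_normal (I \<times> B)) borel F) A = emeasure ?\<nu> A" .
  qed (simp add: noncentral_chi_square_def)
  finally show ?thesis .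
qed

section \<open>Noncentral chi-square distribution functions\<close>

lemma sets_noncentral_chi_square [simp, measurable_cong]: "sets (noncentral_chi_square k \<delta>) = sets borel"
  by (simp add: noncentral_chi_square_def)

lemma real_distribution_noncentral_chi_square: "real_distribution (noncentral_chi_square k \<delta>)"
proof -
  interpret prob_space "PiM {..<k} (\<lambda>i. density lborel (normal_density (if i = 0 then sqrt \<delta> else 0) 1))"
    by (intro prob_space_PiM prob_space_normal)
  show ?thesis unfolding noncentral_chi_square_def by (rule real_distribution_distr) measurable
qed

text \<open>The coordinate that carries the shift is integrated first, which reduces questions
  about the noncentrality to one dimension.\<close>

lemma emeasure_noncentral_chi_square:
  assumes k: "k \<ge> 1" and A: "A \<in> sets borel"
  shows "emeasure (noncentral_chi_square k \<delta>) A
    = (\<integral>\<^sup>+w. (\<integral>\<^sup>+y. indicator A (y\<^sup>2 + (\<Sum>i\<in>{1..<k}. (w i)\<^sup>2)) \<partial>density lborel (normal_density (sqrt \<delta>) 1)) \<partial>iid_normal {1..<k})"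
proof -
  let ?M = "\<lambda>i::nat. density lborel (normal_density (if i = 0 then sqrt \<delta> else 0) 1) :: real measure"
  interpret product_sigma_finite ?M by (intro product_sigma_finite_prob_spaces prob_space_normal)
  have ins: "{..<k} = insert 0 {1..<k}" using k by auto
  have f: "(\<lambda>z. \<Sum>i<k. (z i)\<^sup>2) \<in> borel_measurable (PiM {..<k} ?M)" by measurable
  note [measurable] = A f
  have "emeasure (noncentral_chi_square k \<delta>) A = (\<integral>\<^sup>+z. indicator A (\<Sum>i<k. (z i)\<^sup>2) \<partial>PiM {..<k} ?M)"
    unfolding noncentral_chi_square_def
    by (subst nn_integral_indicator[symmetric], simp add: A, subst nn_integral_distr[OF f]) simp_all
  also have "\<dots> = (\<integral>\<^sup>+w. (\<integral>\<^sup>+y. indicator A (\<Sum>i<k. ((w(0 := y)) i)\<^sup>2) \<partial>?M 0) \<partial>PiM {1..<k} ?M)"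
  proof -
    have "(\<lambda>z. indicator A (\<Sum>i<k. (z i)\<^sup>2) :: ennreal) \<in> borel_measurable (PiM (insert 0 {1..<k}) ?M)"
      unfolding ins[symmetric] by measurable
    from product_nn_integral_insert[OF _ _ this] show ?thesis by (simp only: ins) simp
  qed
  finally have em: "emeasure (noncentral_chi_square k \<delta>) A
    = (\<integral>\<^sup>+w. (\<integral>\<^sup>+y. indicator A (\<Sum>i<k. ((w(0 := y)) i)\<^sup>2) \<partial>?M 0) \<partial>PiM {1..<k} ?M)" .
  have P: "PiM {1..<k} ?M = iid_normal {1..<k}" by (intro PiM_cong) auto
  have sq: "(\<Sum>i<k. ((w(0 := y)) i)\<^sup>2) = y\<^sup>2 + (\<Sum>i\<in>{1..<k}. (w i)\<^sup>2)" for w :: "nat \<Rightarrow> real" and y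
    unfolding ins by (subst sum.insert) auto
  show ?thesis using em unfolding P sq by simp
qed

text \<open>Given the other coordinates, the first one has to solve a quadratic equation.\<close>

lemma noncentral_chi_square_no_atoms:
  assumes k: "k \<ge> 1"
  shows "measure (noncentral_chi_square k \<delta>) {q} = 0"
proof -
  let ?N = "density lborel (normal_density (sqrt \<delta>) 1) :: real measure"
  have "(\<integral>\<^sup>+y. indicator {q} (y\<^sup>2 + r) \<partial>?N) = 0" for r :: real
  proof -
    have "{y. y\<^sup>2 + r = q} \<subseteq> {sqrt (q - r), - sqrt (q - r)}"
    proof
      fix y assume "y \<in> {y. y\<^sup>2 + r = q}"
      then have "sqrt (q - r) = \<bar>y\<bar>" by (metis add_diff_cancel_right' mem_Collect_eq real_sqrt_abs)
      then show "y \<in> {sqrt (q - r), - sqrt (q - r)}" by auto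
    qed
    then have "finite {y. y\<^sup>2 + r = q}" by (rule finite_subset) simp
    then have "{y. y\<^sup>2 + r = q} \<in> null_sets lborel" by (rule finite_imp_null_set_lborel)
    then have "{y. y\<^sup>2 + r = q} \<in> null_sets ?N"
      using absolutely_continuousI_density[of "normal_density (sqrt \<delta>) 1" lborel]
      by (auto simp: absolutely_continuous_def)
    then have "emeasure ?N {y. y\<^sup>2 + r = q} = 0" "{y. y\<^sup>2 + r = q} \<in> sets ?N" by auto
    moreover have "indicator {q} (y\<^sup>2 + r) = (indicator {y. y\<^sup>2 + r = q} y :: ennreal)" for y
      by (auto simp: indicator_def)
    ultimately show ?thesis by simp
  qed
  then have "emeasure (noncentral_chi_square k \<delta>) {q} = 0"
    by (subst emeasure_noncentral_chi_square[OF k]) simp_all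
  then show ?thesis by (simp add: measure_def)
qed

lemma isCont_cdf_noncentral_chi_square:
  assumes "k \<ge> 1"
  shows "isCont (cdf (noncentral_chi_square k \<delta>)) q"
proof -
  interpret real_distribution "noncentral_chi_square k \<delta>" by (rule real_distribution_noncentral_chi_square)
  show ?thesis by (simp add: isCont_cdf noncentral_chi_square_no_atoms[OF assms])
qed

text \<open>As a function of the mean \<open>t\<close>, the mass of \<open>{-a..a}\<close> has the derivative
  \<open>\<phi> (- a - t) - \<phi> (a - t)\<close> with the standard normal density \<open>\<phi>\<close>; this is negative for
  \<open>t > 0\<close> because \<open>- a - t\<close> is farther from \<open>0\<close> than \<open>a - t\<close>.\<close>

lemma emeasure_normal_Icc_less:
  assumes \<mu>: "\<mu> > 0" and a: "a > 0"
  shows "emeasure (density lborel (normal_density \<mu> 1)) {-a..a} < emeasure (density lborel std_normal_density) {-a..a}"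
proof -
  \<comment> \<open>The open interval from \<open>c\<close> to \<open>d\<close> contains all points \<open>a - t\<close> and \<open>- a - t\<close> with \<open>0 \<le> t \<le> \<mu>\<close>.\<close>
  define c where "c = - a - \<mu> - 1"
  define d where "d = a + 1"
  define \<Phi> where "\<Phi> x = integral {c..x} std_normal_density" for x
  have cont: "continuous_on {c..d} std_normal_density"
    unfolding normal_density_def by (intro continuous_intros) simp_all
  have D: "(\<Phi> has_real_derivative std_normal_density x) (at x)" if "c < x" "x < d" for x
    using integral_has_real_derivative[OF cont, of x] that
    unfolding \<Phi>_def by (simp add: at_within_Icc_at)
  have em: "emeasure (density lborel (normal_density t 1)) {-a..a} = ennreal (\<Phi> (a - t) - \<Phi> (- a - t))"
    if t: "0 \<le> t" "t \<le> \<mu>" for t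
  proof -
    have "emeasure (density lborel (normal_density t 1)) {-a..a} = (\<integral>\<^sup>+x. ennreal (normal_density t 1 x) * indicator {-a..a} x \<partial>lborel)"
      by (intro emeasure_density) auto
    also have "\<dots> = ennreal (\<Phi> (a - t) - \<Phi> (- a - t))"
    proof (rule nn_integral_FTC_Icc[where F = "\<lambda>x. \<Phi> (x - t)" and f = "normal_density t 1"])
      fix x assume "x \<in> {-a..a}"
      then have x: "-a \<le> x" "x \<le> a" by auto
      have "((\<lambda>x. \<Phi> (x - t)) has_real_derivative std_normal_density (x - t) * 1) (at x)"
        by (rule DERIV_chain2[where f = \<Phi>, OF D]) (use x t a in \<open>auto simp: c_def d_def intro!: derivative_eq_intros\<close>)
      then show "DERIV (\<lambda>x. \<Phi> (x - t)) x :> normal_density t 1 x"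
        by (simp add: normal_density_def)
    qed (use a in auto)
    finally show ?thesis .
  qed
  have "\<Phi> (a - \<mu>) - \<Phi> (- a - \<mu>) < \<Phi> (a - 0) - \<Phi> (- a - 0)"
  proof (rule DERIV_neg_imp_decreasing_open[OF \<mu>])
    fix t assume t: "0 < t" "t < \<mu>"
    have "((\<lambda>t. \<Phi> (a - t) - \<Phi> (- a - t)) has_real_derivative (std_normal_density (a - t) * (- 1) - std_normal_density (- a - t) * (- 1))) (at t)"
      by (intro DERIV_diff DERIV_chain2[where f = \<Phi>, OF D]) (use t a in \<open>auto simp: c_def d_def intro!: derivative_eq_intros\<close>)
    moreover have "std_normal_density (- a - t) < std_normal_density (a - t)"
    proof -
      have "(a - t)\<^sup>2 < (- a - t)\<^sup>2" using a t by (simp add: power2_eq_square algebra_simps)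
      then show ?thesis unfolding std_normal_density_def
        by (intro mult_strict_left_mono) simp_all
    qed
    ultimately show "\<exists>y. ((\<lambda>t. \<Phi> (a - t) - \<Phi> (- a - t)) has_real_derivative y) (at t) \<and> y < 0"
      by (intro exI conjI) (assumption, simp)
  next
    have c\<Phi>: "continuous_on {c<..<d} \<Phi>"
      using D by (intro continuous_at_imp_continuous_on ballI) (auto intro: DERIV_isCont)
    have "continuous_on {0..\<mu>} (\<lambda>t. \<Phi> (a - t))"
      by (rule continuous_on_compose2[OF c\<Phi>]) (use a in \<open>auto simp: c_def d_def intro!: continuous_intros\<close>)
    moreover have "continuous_on {0..\<mu>} (\<lambda>t. \<Phi> (- a - t))"
      by (rule continuous_on_compose2[OF c\<Phi>]) (use a in \<open>auto simp: c_def d_def intro!: continuous_intros\<close>)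
    ultimately show "continuous_on {0..\<mu>} (\<lambda>t. \<Phi> (a - t) - \<Phi> (- a - t))"
      by (rule continuous_on_diff)
  qed
  moreover have "0 \<le> \<Phi> (a - \<mu>) - \<Phi> (- a - \<mu>)"
  proof (rule ccontr)
    assume neg: "\<not> ?thesis"
    have "- a - \<mu> \<le> a - \<mu>" using a by simp
    then have "\<Phi> (- a - \<mu>) \<le> \<Phi> (a - \<mu>)"
    proof (rule DERIV_nonneg_imp_nondecreasing)
      fix x assume "- a - \<mu> \<le> x" "x \<le> a - \<mu>"
      then show "\<exists>y. (\<Phi> has_real_derivative y) (at x) \<and> 0 \<le> y"
        using \<mu> by (intro exI[of _ "std_normal_density x"] conjI D) (auto simp: c_def d_def)
    qed
    then show False using neg by simp
  qed
  ultimately show ?thesis using em[of \<mu>] em[of 0] \<mu> by (simp add: ennreal_less_iff)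
qed

text \<open>The inequality is strict for every value \<open>w\<close> of the unshifted coordinates with
  \<open>\<Sum>i\<in>{1..<k}. (w i)\<^sup>2 < q\<close>. The others contribute nothing, so a positive central probability means that
  such \<open>w\<close> have positive mass.\<close>

lemma cdf_noncentral_chi_square_less:
  assumes k: "k \<ge> 1" and \<delta>: "\<delta> > 0" and q: "cdf (noncentral_chi_square k 0) q > 0"
  shows "cdf (noncentral_chi_square k \<delta>) q < cdf (noncentral_chi_square k 0) q"
proof -
  let ?N = "\<lambda>\<mu>. density lborel (normal_density \<mu> 1) :: real measure"
  let ?R = "\<lambda>w::nat \<Rightarrow> real. \<Sum>i\<in>{1..<k}. (w i)\<^sup>2"
  let ?W = "iid_normal {1..<k}"
  define u where "u \<mu> w = (\<integral>\<^sup>+y. indicator {..q} (y\<^sup>2 + ?R w) \<partial>?N \<mu>)" for \<mu> w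
  have em: "emeasure (noncentral_chi_square k d) {..q} = (\<integral>\<^sup>+w. u (sqrt d) w \<partial>?W)" for d
    unfolding u_def by (rule emeasure_noncentral_chi_square[OF k]) simp
  have um [measurable]: "u \<mu> \<in> borel_measurable ?W" for \<mu>
  proof -
    interpret prob_space "?N \<mu>" by (rule prob_space_normal)
    have [measurable]: "?R \<in> borel_measurable ?W" by measurable
    show ?thesis unfolding u_def[abs_def] by measurable
  qed
  have ueq: "u \<mu> w = emeasure (?N \<mu>) {y. y\<^sup>2 \<le> q - ?R w}" for \<mu> w
  proof -
    have "indicator {..q} (y\<^sup>2 + ?R w) = (indicator {y. y\<^sup>2 \<le> q - ?R w} y :: ennreal)" for y
      by (auto simp: indicator_def)
    then show ?thesis unfolding u_def by (simp add: nn_integral_indicator)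
  qed
  have lt: "u (sqrt \<delta>) w < u 0 w" if "0 < q - ?R w" for w
  proof -
    have "{y. y\<^sup>2 \<le> q - ?R w} = {- sqrt (q - ?R w) .. sqrt (q - ?R w)}"
      using that by (auto simp: real_sqrt_ge_abs1 sqrt_ge_absD abs_le_iff dest: real_le_rsqrt)
       (metis abs_le_iff real_sqrt_abs real_sqrt_le_iff minus_le_iff)+
    then show ?thesis unfolding ueq using emeasure_normal_Icc_less[of "sqrt \<delta>" "sqrt (q - ?R w)"] \<delta> that by simp
  qed
  have zero: "u \<mu> w = 0" if "q - ?R w \<le> 0" for \<mu> w
  proof -
    have "{y. y\<^sup>2 \<le> q - ?R w} \<subseteq> {0}"
    proof
      fix y assume "y \<in> {y. y\<^sup>2 \<le> q - ?R w}"
      then have "y\<^sup>2 \<le> 0" using that by (simp only: mem_Collect_eq)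
      then show "y \<in> {0}" by simp
    qed
    then have "{y. y\<^sup>2 \<le> q - ?R w} \<in> null_sets lborel"
      by (intro finite_imp_null_set_lborel) (rule finite_subset, auto)
    then have "{y. y\<^sup>2 \<le> q - ?R w} \<in> null_sets (?N \<mu>)"
      using absolutely_continuousI_density[of "normal_density \<mu> 1" lborel]
      by (auto simp: absolutely_continuous_def)
    then show ?thesis unfolding ueq by auto
  qed
  interpret nc0: real_distribution "noncentral_chi_square k 0" by (rule real_distribution_noncentral_chi_square)
  interpret nc: real_distribution "noncentral_chi_square k \<delta>" by (rule real_distribution_noncentral_chi_square)
  have "(\<integral>\<^sup>+w. u (sqrt \<delta>) w \<partial>?W) < (\<integral>\<^sup>+w. u 0 w \<partial>?W)"
  proof (rule nn_integral_less)
    show "(\<integral>\<^sup>+w. u (sqrt \<delta>) w \<partial>?W) \<noteq> \<infinity>" unfolding em[symmetric] by simp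
    show "AE w in ?W. u (sqrt \<delta>) w \<le> u 0 w"
      using lt zero by (intro AE_I2) (metis less_imp_le not_le order_refl)
    show "\<not> (AE w in ?W. u 0 w \<le> u (sqrt \<delta>) w)"
    proof
      assume "AE w in ?W. u 0 w \<le> u (sqrt \<delta>) w"
      then have "AE w in ?W. u 0 w = 0"
        by eventually_elim (metis lt zero not_le)
      then have "(\<integral>\<^sup>+w. u 0 w \<partial>?W) = 0" by (subst nn_integral_0_iff_AE[OF um])
      then have "emeasure (noncentral_chi_square k 0) {..q} = 0" using em[of 0] by simp
      then show False using q by (simp add: cdf_def measure_def)
    qed
  qed (rule um)+
  then have "emeasure (noncentral_chi_square k \<delta>) {..q} < emeasure (noncentral_chi_square k 0) {..q}"
    using em[of \<delta>] em[of 0] by simp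
  then show ?thesis
    unfolding cdf_def nc.emeasure_eq_measure nc0.emeasure_eq_measure by (simp add: ennreal_less_iff)
qed

text \<open>By continuity, the infimum in the quantile is attained, and it cannot be attained with a
  value above \<open>u\<close>.\<close>

lemma cdf_chi_square_quantile:
  assumes k: "k \<ge> 1" and u: "0 < u" "u < 1"
  shows "cdf (noncentral_chi_square k 0) (chi_square_quantile k u) = u"
proof -
  let ?F = "cdf (noncentral_chi_square k 0)"
  interpret real_distribution "noncentral_chi_square k 0" by (rule real_distribution_noncentral_chi_square)
  define S where "S = {q. u \<le> ?F q}"
  have "closed S"
    unfolding S_def using continuous_closed_vimage[of "{u..}" ?F] isCont_cdf_noncentral_chi_square[OF k]
    by (simp add: vimage_def)
  have "eventually (\<lambda>x. u < ?F x) at_top" using cdf_lim_at_top_prob u(2) by (rule order_tendstoD)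
  then obtain b where "u < ?F b" by (metis eventually_at_top_linorder order_refl)
  then have ne: "S \<noteq> {}" by (auto simp: S_def intro: less_imp_le)
  have "eventually (\<lambda>x. ?F x < u) at_bot" using cdf_lim_at_bot u(1) by (rule order_tendstoD)
  then obtain a where a: "?F a < u" by (metis eventually_at_bot_linorder order_refl)
  have below: "a \<le> x" if "x \<in> S" for x
  proof (rule ccontr)
    assume "\<not> a \<le> x"
    then have "?F x \<le> ?F a" by (intro cdf_nondecreasing) simp
    then show False using that a by (simp add: S_def)
  qed
  then have bdd: "bdd_below S" by (rule bdd_belowI)
  have "Inf S \<in> S" using ne bdd \<open>closed S\<close> by (rule closed_contains_Inf)
  then have ge: "u \<le> ?F (Inf S)" by (simp add: S_def)
  have "?F (Inf S) \<le> u"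
  proof (rule ccontr)
    assume "\<not> ?F (Inf S) \<le> u"
    then have "eventually (\<lambda>x. u < ?F x) (at_left (Inf S))"
      using isCont_cdf_noncentral_chi_square[OF k, of "Inf S" 0]
      by (intro order_tendstoD(1)[of ?F "?F (Inf S)"]) (auto simp: isCont_def filterlim_at_split)
    then obtain b where b: "b < Inf S" "\<And>y. b < y \<Longrightarrow> y < Inf S \<Longrightarrow> u < ?F y"
      by (auto simp: eventually_at_left_field)
    obtain y where y: "b < y" "y < Inf S" using dense[OF b(1)] by auto
    have "y \<in> S" using b(2)[OF y] by (simp add: S_def)
    then have "Inf S \<le> y" using bdd by (rule cInf_lower)
    then show False using y by simp
  qed
  then show ?thesis using ge by (simp add: chi_square_quantile_def S_def)
qed

section \<open>Almost sure absence of eigenvectors orthogonal to a direction\<close>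

text \<open>Rows of a matrix are indexed by \<open>'p\<close>, powers by natural numbers; any bijection will do.\<close>

definition coordinate_index :: "'p::finite \<Rightarrow> nat"
  where "coordinate_index = (SOME f. bij_betw f UNIV {..<CARD('p)})"

lemma bij_coordinate_index: "bij_betw (coordinate_index :: 'p::finite \<Rightarrow> nat) UNIV {..<CARD('p)}"
proof -
  have "\<exists>f :: 'p \<Rightarrow> nat. bij_betw f UNIV {..<CARD('p)}" by (rule finite_same_card_bij) simp_all
  then show ?thesis unfolding coordinate_index_def by (rule someI_ex)
qed

text \<open>The determinant with the rows \<open>\<theta>, S \<theta>, \<dots>, S\<^sup>p\<^sup>-\<^sup>1 \<theta>\<close>, where \<open>p = CARD('p)\<close>.\<close>

definition krylov_det :: "real ^ 'p ^ 'p \<Rightarrow> real ^ 'p \<Rightarrow> real"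
  where "krylov_det S \<theta> = det (\<chi> i. (((*v) S) ^^ coordinate_index i) \<theta>)"

lemma krylov_det_nonzero_iff:
  fixes S :: "real ^ 'p ^ 'p"
  shows "krylov_det S \<theta> \<noteq> 0 \<longleftrightarrow> (\<forall>u. (\<forall>k<CARD('p). u \<bullet> (((*v) S) ^^ k) \<theta> = 0) \<longrightarrow> u = 0)"
proof -
  let ?K = "(\<chi> i. (((*v) S) ^^ coordinate_index i) \<theta>) :: real ^ 'p ^ 'p"
  have "?K *v u = 0 \<longleftrightarrow> (\<forall>k<CARD('p). u \<bullet> (((*v) S) ^^ k) \<theta> = 0)" for u
  proof -
    have "?K *v u = 0 \<longleftrightarrow> (\<forall>i::'p. u \<bullet> (((*v) S) ^^ coordinate_index i) \<theta> = 0)"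
      by (simp add: vec_eq_iff matrix_vector_mult_def inner_vec_def mult.commute)
    also have "\<dots> \<longleftrightarrow> (\<forall>k\<in>range (coordinate_index :: 'p \<Rightarrow> nat). u \<bullet> (((*v) S) ^^ k) \<theta> = 0)" by auto
    also have "range (coordinate_index :: 'p \<Rightarrow> nat) = {..<CARD('p)}"
      using bij_coordinate_index[where 'p = 'p] by (simp add: bij_betw_def)
    finally show ?thesis by auto
  qed
  moreover have "krylov_det S \<theta> \<noteq> 0 \<longleftrightarrow> (\<forall>u. ?K *v u = 0 \<longrightarrow> u = 0)"
    unfolding krylov_det_def
    using invertible_det_nz[of ?K] invertible_left_inverse[of ?K] matrix_left_invertible_ker[of ?K] by blast
  ultimately show ?thesis by simp
qed

text \<open>An eigenvector orthogonal to \<open>\<theta>\<close> is orthogonal to every \<open>S\<^sup>k \<theta>\<close>, by symmetry.\<close>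

lemma no_orthogonal_eigenvector_if_krylov_det:
  fixes S :: "real ^ 'p ^ 'p"
  assumes sym: "transpose S = S" and K: "krylov_det S \<theta> \<noteq> 0"
  shows "no_orthogonal_eigenvector S \<theta>"
  unfolding no_orthogonal_eigenvector_def
proof (intro allI impI)
  fix u l assume u: "S *v u = l *\<^sub>R u" "\<theta> \<bullet> u = 0"
  have "u \<bullet> (((*v) S) ^^ k) \<theta> = l ^ k * (u \<bullet> \<theta>)" for k
  proof (induction k)
    case (Suc k)
    have "u \<bullet> (S *v (((*v) S) ^^ k) \<theta>) = (S *v u) \<bullet> (((*v) S) ^^ k) \<theta>"
      using symmetric_matrix_inner[OF sym] by simp
    then show ?case using Suc u by simp
  qed simp
  then show "u = 0" using K u(2) by (auto simp: krylov_det_nonzero_iff inner_commute)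
qed

lemma transpose_sample_cov: "transpose (sample_cov n X) = sample_cov n X"
  by (simp add: vec_eq_iff transpose_def sample_cov_def outer_def sum_component mult.commute)

lemma sum_upto_double: "(\<Sum>i\<in>{1..2 * m}. g i) = (\<Sum>k<m. g (2 * k + 1) + g (2 * k + 2))"
  for g :: "nat \<Rightarrow> 'a::comm_monoid_add"
  by (induction m) (simp_all add: algebra_simps)

lemma sample_cov_mult_vec:
  "sample_cov n X *v x = (1 / real n) *\<^sub>R (\<Sum>i\<in>{1..n}. ((X i - sample_mean n X) \<bullet> x) *\<^sub>R (X i - sample_mean n X))"
  unfolding sample_cov_def scaleR_matrix_vector_assoc[symmetric] sum_matrix_vector_mult outer_mult_vec ..

text \<open>Let \<open>b 0 = \<theta>, b 1, \<dots>\<close> be an orthonormal basis. The sample made of the vectors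
  \<open>b k + b (k + 1)\<close>, their negatives and zeros has mean zero, and its covariance matrix is
  tridiagonal in this basis with nonzero entries beside the diagonal. Hence \<open>S\<^sup>k \<theta>\<close> is a nonzero
  multiple of \<open>b k\<close> plus a combination of earlier basis vectors, and these vectors span.\<close>

lemma exists_cyclic_sample:
  fixes \<theta> :: "real ^ 'p"
  assumes \<theta>: "norm \<theta> = 1" and n: "n \<ge> 2 * CARD('p)"
  obtains D where "krylov_det (sample_cov n D) \<theta> \<noteq> 0"
proof -
  obtain B where B: "orthonormal_basis B" "\<theta> \<in> B"
    using orthonormal_basis_extend[of "{\<theta>}"] \<theta> by auto
  let ?p = "CARD('p)"
  have "card B = ?p" using B(1) by (simp add: orthonormal_basis_def)
  then obtain b where b: "bij_betw b {..<?p} B" "b 0 = \<theta>"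
    using bij_betw_lessThan_card_starting[OF orthonormal_basis_finite[OF B(1)] B(2)] by metis
  have bB: "b k \<in> B" if "k < ?p" for k using b that by (auto simp: bij_betw_def)
  have bb: "b j \<bullet> b k = (if j = k then 1 else 0)" if "j < ?p" "k < ?p" for j k
    using orthonormal_basis_inner[OF B(1) bB bB, of j k] that b(1)
    by (auto simp: bij_betw_def inj_on_def)
  define m where "m = ?p - 1"
  define f where "f k = b k + b (Suc k)" for k
  \<comment> \<open>The indices \<open>2 * k + 1\<close> and \<open>2 * k + 2\<close> carry \<open>f k\<close> and \<open>- f k\<close>.\<close>
  define D :: "nat \<Rightarrow> real ^ 'p" where
    "D i = (if i \<in> {1..2 * m} then (if odd i then f (i div 2) else - f (i div 2 - 1)) else 0)" for i
  define S where "S = sample_cov n D"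
  define \<gamma> where "\<gamma> = 2 / real n"
  have p1: "?p \<ge> 1" by (simp add: Suc_leI)
  have "n > 0" using n p1 by linarith
  then have \<gamma>: "\<gamma> \<noteq> 0" by (simp add: \<gamma>_def)
  have nm: "{1..2 * m} \<subseteq> {1..n}" using n by (auto simp: m_def)
  have sumD: "(\<Sum>i\<in>{1..n}. g (D i)) = (\<Sum>k<m. g (f k) + g (- f k))"
    if "g 0 = 0" for g :: "real ^ 'p \<Rightarrow> real ^ 'p"
  proof -
    have "(\<Sum>i\<in>{1..n}. g (D i)) = (\<Sum>i\<in>{1..2 * m}. g (D i))"
      using nm that by (intro sum.mono_neutral_right) (auto simp: D_def)
    also have "\<dots> = (\<Sum>k<m. g (D (2 * k + 1)) + g (D (2 * k + 2)))" by (rule sum_upto_double)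
    also have "\<dots> = (\<Sum>k<m. g (f k) + g (- f k))"
      by (intro sum.cong) (auto simp: D_def)
    finally show ?thesis .
  qed
  have mean: "sample_mean n D = 0" using sumD[of "\<lambda>x. x"] by (simp add: sample_mean_def)
  have S: "S *v x = \<gamma> *\<^sub>R (\<Sum>k<m. (f k \<bullet> x) *\<^sub>R f k)" for x
  proof -
    have "S *v x = (1 / real n) *\<^sub>R (\<Sum>i\<in>{1..n}. (D i \<bullet> x) *\<^sub>R D i)"
      by (simp add: S_def sample_cov_mult_vec mean)
    also have "\<dots> = (1 / real n) *\<^sub>R (\<Sum>k<m. 2 *\<^sub>R ((f k \<bullet> x) *\<^sub>R f k))"
      by (subst sumD[of "\<lambda>y. (y \<bullet> x) *\<^sub>R y"])
        (simp_all only: inner_minus_left scaleR_minus_left scaleR_minus_right minus_minus scaleR_2 inner_zero_left scaleR_zero_left)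
    also have "\<dots> = (1 / real n) *\<^sub>R (2 *\<^sub>R (\<Sum>k<m. (f k \<bullet> x) *\<^sub>R f k))"
      by (simp only: scaleR_sum_right)
    finally show ?thesis by (simp add: \<gamma>_def)
  qed
  define V where "V k = span (b ` {..<k})" for k
  have bV: "b j \<in> V k" if "j < k" for j k using that unfolding V_def by (intro span_base) auto
  have Sb: "S *v b j - (if Suc j < ?p then \<gamma> *\<^sub>R b (Suc j) else 0) \<in> V (Suc j)" if j: "j < ?p" for j
  proof -
    have "(f k \<bullet> b j) *\<^sub>R f k = (if k = j then f k else 0) + (if Suc k = j then f k else 0)" if "k < m" for k
      using that j bb[of k j] bb[of "Suc k" j] by (auto simp: f_def inner_add_left m_def)
    then have "(\<Sum>k<m. (f k \<bullet> b j) *\<^sub>R f k)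
      = (\<Sum>k<m. (if k = j then f k else 0) + (if Suc k = j then f k else 0))"
      by (intro sum.cong refl) simp
    also have "\<dots> = (\<Sum>k<m. if k = j then f k else 0) + (\<Sum>k<m. if Suc k = j then f k else 0)"
      by (rule sum.distrib)
    also have "(\<Sum>k<m. if k = j then f k else 0) = (if Suc j < ?p then f j else 0)"
      by (simp add: m_def) (auto simp: less_diff_conv)
    also have "(\<Sum>k<m. if Suc k = j then f k else 0) = (if j = 0 then 0 else f (j - 1))"
    proof (cases j)
      case (Suc i)
      then show ?thesis using j by (simp add: m_def)
    qed simp
    finally have "S *v b j - (if Suc j < ?p then \<gamma> *\<^sub>R b (Suc j) else 0)
      = \<gamma> *\<^sub>R ((if Suc j < ?p then b j else 0) + (if j = 0 then 0 else b (j - 1) + b j))"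
      unfolding S by (auto simp: f_def scaleR_add_right)
    also have "\<dots> \<in> V (Suc j)"
      using bV[of j "Suc j"] bV[of "j - 1" "Suc j"] unfolding V_def
      by (intro span_scale span_add) (auto intro: span_add span_zero)
    finally show ?thesis .
  qed
  have VV: "V j \<subseteq> V k" if "j \<le> k" for j k using that unfolding V_def by (intro span_mono) auto
  have SV: "S *v x \<in> V (Suc k)" if x: "x \<in> V k" and k: "k < ?p" for x k
    using x unfolding V_def
  proof (induction rule: span_induct_alt)
    case base
    show ?case by (simp add: span_zero)
  next
    case (step c x y)
    then obtain j where j: "j < k" "x = b j" by auto
    have "S *v b j = (S *v b j - (if Suc j < ?p then \<gamma> *\<^sub>R b (Suc j) else 0)) + \<gamma> *\<^sub>R b (Suc j)"
      using j k by simp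
    also have "\<dots> \<in> V (Suc k)"
      using set_mp[OF VV Sb, of j "Suc k"] bV[of "Suc j" "Suc k"] j k unfolding V_def
      by (intro span_add span_scale) auto
    finally have "S *v x \<in> span (b ` {..<Suc k})" using j by (simp add: V_def)
    then show ?case using step
      by (simp add: matrix_vector_right_distrib matrix_vector_mult_scaleR span_add span_scale)
  qed
  have krylov: "(((*v) S) ^^ k) \<theta> - \<gamma> ^ k *\<^sub>R b k \<in> V k" if "k < ?p" for k
    using that
  proof (induction k)
    case 0
    then show ?case by (simp add: b(2) V_def)
  next
    case (Suc k)
    let ?x = "(((*v) S) ^^ k) \<theta>"
    have "S *v ?x - \<gamma> ^ Suc k *\<^sub>R b (Suc k) = S *v (?x - \<gamma> ^ k *\<^sub>R b k) + \<gamma> ^ k *\<^sub>R (S *v b k - \<gamma> *\<^sub>R b (Suc k))"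
      by (simp add: matrix_vector_mult_diff_distrib matrix_vector_mult_scaleR algebra_simps)
    also have "\<dots> \<in> V (Suc k)"
      using SV[OF Suc.IH] Sb[of k] Suc.prems unfolding V_def
      by (intro span_add span_scale) auto
    finally show ?case by simp
  qed
  have "u = 0" if u: "\<forall>k<?p. u \<bullet> (((*v) S) ^^ k) \<theta> = 0" for u
  proof -
    have ub: "u \<bullet> b k = 0" if "k < ?p" for k
      using that
    proof (induction k rule: less_induct)
      case (less k)
      have "orthogonal u ((((*v) S) ^^ k) \<theta> - \<gamma> ^ k *\<^sub>R b k)"
        by (rule orthogonal_to_span[OF krylov[OF less.prems, unfolded V_def]])
          (use less in \<open>auto simp: orthogonal_def\<close>)
      then have "\<gamma> ^ k * (u \<bullet> b k) = 0"
        using u less.prems by (simp add: orthogonal_def inner_diff_right)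
      then show ?case using \<gamma> by simp
    qed
    have "u = (\<Sum>c\<in>B. (u \<bullet> c) *\<^sub>R c)" by (rule orthonormal_basis_expansion[OF B(1), symmetric])
    also have "\<dots> = 0"
    proof (rule sum.neutral, rule ballI)
      fix c assume "c \<in> B"
      then obtain k where "k < ?p" "c = b k" using b(1) by (auto simp: bij_betw_def)
      then show "(u \<bullet> c) *\<^sub>R c = 0" using ub by simp
    qed
    finally show ?thesis .
  qed
  then have "krylov_det (sample_cov n D) \<theta> \<noteq> 0"
    unfolding krylov_det_nonzero_iff S_def by blast
  then show ?thesis by (rule that)
qed

text \<open>Each line in the direction \<open>D\<close> meets the zero set in finitely many points: for
  \<open>t \<noteq> 0\<close>, a zero of \<open>f\<close> at \<open>X + t D\<close> is one at \<open>X / t + D\<close>, and \<open>s \<mapsto> f (s X + D)\<close> is a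
  polynomial with the value \<open>f D \<noteq> 0\<close> at \<open>0\<close>. Integrating the measure of the zero set,
  translated by \<open>t D\<close>, over all \<open>t\<close> gives \<open>0\<close> by Fubini's theorem; since translation leaves
  this measure unchanged, it is \<open>0\<close>.\<close>

lemma AE_homogeneous_polynomial_nonzero:
  fixes f :: "(nat \<Rightarrow> 'a::euclidean_space) \<Rightarrow> real"
  assumes I: "finite I"
    and f [measurable]: "f \<in> borel_measurable (PiM I (\<lambda>_. borel))"
    and dep: "\<And>X. f (restrict X I) = f X"
    and poly: "\<And>X D. real_polynomial_function (\<lambda>s. f (\<lambda>i. s *\<^sub>R X i + D i))"
    and hom: "\<And>X t. t \<noteq> 0 \<Longrightarrow> f (\<lambda>i. t *\<^sub>R X i) = 0 \<Longrightarrow> f X = 0"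
    and D: "f D \<noteq> 0"
  shows "AE X in PiM I (\<lambda>_. lborel). f X \<noteq> 0"
proof -
  let ?L = "PiM I (\<lambda>_. lborel :: 'a measure)"
  interpret P: product_sigma_finite "\<lambda>_. lborel :: 'a measure" by (rule product_sigma_finite_lborel)
  interpret L: sigma_finite_measure ?L by (rule P.sigma_finite[OF I])
  interpret pair_sigma_finite "lborel :: real measure" ?L ..
  have [measurable_cong]: "sets ?L = sets (PiM I (\<lambda>_. borel))" by (intro sets_PiM_cong) auto
  have fL [measurable]: "f \<in> borel_measurable ?L" using f by (simp cong: measurable_cong_sets)
  have line: "finite {t. f (\<lambda>i. X i + t *\<^sub>R D i) = 0}" for X
  proof -
    obtain a N where a: "(\<lambda>s. f (\<lambda>i. s *\<^sub>R X i + D i)) = (\<lambda>s. \<Sum>i\<le>N. a i * s ^ i)"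
      using poly[of X D] by (auto simp: real_polynomial_function_iff_sum)
    have "(\<Sum>i\<le>N. a i * 0 ^ i) \<noteq> 0" using fun_cong[OF a, of 0] D by simp
    then have "\<exists>i\<le>N. a i \<noteq> 0" by (metis (no_types, lifting) atMost_iff mult_zero_left sum.neutral)
    then have "finite {s. (\<Sum>i\<le>N. a i * s ^ i) = 0}" by (simp add: polyfun_finite_roots)
    then have fin: "finite {s. f (\<lambda>i. s *\<^sub>R X i + D i) = 0}" by (simp add: fun_cong[OF a])
    have "{t. f (\<lambda>i. X i + t *\<^sub>R D i) = 0} \<subseteq> insert 0 (inverse ` {s. f (\<lambda>i. s *\<^sub>R X i + D i) = 0})"
    proof
      fix t assume t: "t \<in> {t. f (\<lambda>i. X i + t *\<^sub>R D i) = 0}"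
      show "t \<in> insert 0 (inverse ` {s. f (\<lambda>i. s *\<^sub>R X i + D i) = 0})"
      proof (cases "t = 0")
        case False
        have "(\<lambda>i. t *\<^sub>R (inverse t *\<^sub>R X i + D i)) = (\<lambda>i. X i + t *\<^sub>R D i)"
          using False by (simp add: scaleR_add_right)
        then have "f (\<lambda>i. inverse t *\<^sub>R X i + D i) = 0"
          using t hom[OF False, of "\<lambda>i. inverse t *\<^sub>R X i + D i"] by simp
        then have "inverse t \<in> {s. f (\<lambda>i. s *\<^sub>R X i + D i) = 0}" by simp
        then have "inverse (inverse t) \<in> inverse ` {s. f (\<lambda>i. s *\<^sub>R X i + D i) = 0}" by (rule imageI)
        then show ?thesis by simp
      qed simp
    qed
    then show ?thesis by (rule finite_subset) (use fin in simp)
  qed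
  define Z where "Z = {X \<in> space ?L. f X = 0}"
  have Zs [measurable]: "Z \<in> sets ?L" unfolding Z_def by measurable
  define F where "F t X = (indicator Z (\<lambda>i\<in>I. X i + t *\<^sub>R D i) :: ennreal)" for t X
  have trans: "(\<integral>\<^sup>+X. F t X \<partial>?L) = emeasure ?L Z" for t
  proof -
    have m: "(\<lambda>X. \<lambda>i\<in>I. X i + t *\<^sub>R D i) \<in> measurable ?L (PiM I (\<lambda>_. borel))" by measurable
    have "emeasure ?L Z = (\<integral>\<^sup>+X. indicator Z X \<partial>distr ?L (PiM I (\<lambda>_. borel)) (\<lambda>X. \<lambda>i\<in>I. X i + t *\<^sub>R D i))"
      by (subst distr_PiM_lborel_translate[OF I]) simp
    also have "\<dots> = (\<integral>\<^sup>+X. F t X \<partial>?L)"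
      unfolding F_def using Zs by (intro nn_integral_distr[OF m]) measurable
    finally show ?thesis by simp
  qed
  have Fm: "case_prod F \<in> borel_measurable (lborel \<Otimes>\<^sub>M ?L)"
  proof -
    have "(\<lambda>(t, X). \<lambda>i\<in>I. X i + t *\<^sub>R D i) \<in> measurable (lborel \<Otimes>\<^sub>M ?L) ?L"
      by measurable
    from measurable_compose[OF this, of "indicator Z" borel] show ?thesis
      unfolding F_def by (simp add: case_prod_unfold)
  qed
  have "(\<integral>\<^sup>+t. emeasure ?L Z \<partial>(lborel :: real measure)) = (\<integral>\<^sup>+t. (\<integral>\<^sup>+X. F t X \<partial>?L) \<partial>lborel)"
    by (simp add: trans)
  also have "\<dots> = (\<integral>\<^sup>+X. (\<integral>\<^sup>+t. F t X \<partial>lborel) \<partial>?L)"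
    by (rule Fubini'[OF Fm, symmetric])
  also have "\<dots> = (\<integral>\<^sup>+X. 0 \<partial>?L)"
  proof (rule nn_integral_cong)
    fix X assume "X \<in> space ?L"
    have "F t X = indicator {t. f (\<lambda>i. X i + t *\<^sub>R D i) = 0} t" for t
      using dep[of "\<lambda>i. X i + t *\<^sub>R D i"] by (auto simp: F_def Z_def indicator_def space_PiM)
    moreover have "{t. f (\<lambda>i. X i + t *\<^sub>R D i) = 0} \<in> null_sets lborel"
      by (rule finite_imp_null_set_lborel[OF line])
    ultimately show "(\<integral>\<^sup>+t. F t X \<partial>lborel) = 0" by (simp add: null_sets_def)
  qed
  finally have "emeasure ?L Z * \<infinity> = 0" by simp
  then have "emeasure ?L Z = 0" by (metis ennreal_mult_eq_top_iff ennreal_top_neq_zero infinity_ennreal_def mult_eq_0_iff)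
  then have "Z \<in> null_sets ?L" using Zs by auto
  then show ?thesis by (rule AE_I') (auto simp: Z_def)
qed

lemma matrix_vector_mult_component: "(A *v x) $ i = (\<Sum>j\<in>UNIV. A $ i $ j * x $ j)"
  by (simp add: matrix_vector_mult_def)

lemma measurable_krylov_det [measurable (raw)]:
  fixes S :: "'a \<Rightarrow> real ^ 'p ^ 'p"
  assumes S: "S \<in> borel_measurable M"
  shows "(\<lambda>x. krylov_det (S x) \<theta>) \<in> borel_measurable M"
proof -
  have comp: "(\<lambda>x. S x $ i $ j) \<in> borel_measurable M" for i j
    using S by (intro measurable_compose[OF measurable_compose[OF S measurable_vec_nth] measurable_vec_nth])
  have "(\<lambda>x. (((*v) (S x)) ^^ k) \<theta> $ i) \<in> borel_measurable M" for k i
  proof (induction k arbitrary: i)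
    case (Suc k)
    have "(\<lambda>x. \<Sum>j\<in>UNIV. S x $ i $ j * (((*v) (S x)) ^^ k) \<theta> $ j) \<in> borel_measurable M"
      by (intro borel_measurable_sum borel_measurable_times comp Suc)
    then show ?case by (simp only: funpow.simps o_apply matrix_vector_mult_component)
  qed simp
  then show ?thesis unfolding krylov_det_def det_def by simp
qed

lemma real_polynomial_function_krylov_det:
  fixes S :: "'a::real_normed_vector \<Rightarrow> real ^ 'p ^ 'p"
  assumes S: "\<And>i j. real_polynomial_function (\<lambda>x. S x $ i $ j)"
  shows "real_polynomial_function (\<lambda>x. krylov_det (S x) \<theta>)"
proof -
  have "real_polynomial_function (\<lambda>x. (((*v) (S x)) ^^ k) \<theta> $ i)" for k i
  proof (induction k arbitrary: i)
    case (Suc k)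
    have "real_polynomial_function (\<lambda>x. \<Sum>j\<in>UNIV. S x $ i $ j * (((*v) (S x)) ^^ k) \<theta> $ j)"
      by (intro real_polynomial_function_sum real_polynomial_function.intros(4) S Suc) simp
    then show ?case by (simp only: funpow.simps o_apply matrix_vector_mult_component)
  qed (simp add: real_polynomial_function.intros(2))
  then show ?thesis
    unfolding krylov_det_def det_def vec_lambda_beta
    by (intro real_polynomial_function_sum real_polynomial_function.intros(4) real_polynomial_function_prod
        real_polynomial_function.intros(2)) (simp_all add: finite_permutations)
qed

lemma krylov_det_scale:
  fixes S :: "real ^ 'p ^ 'p"
  assumes c: "c \<noteq> 0" and K: "krylov_det S \<theta> \<noteq> 0"
  shows "krylov_det (c *\<^sub>R S) \<theta> \<noteq> 0"
proof -
  have "(((*v) (c *\<^sub>R S)) ^^ k) \<theta> = c ^ k *\<^sub>R (((*v) S) ^^ k) \<theta>" for k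
    by (induction k) (simp_all add: matrix_vector_mult_scaleR scaleR_matrix_vector_assoc[symmetric] mult.commute)
  then show ?thesis using K c unfolding krylov_det_nonzero_iff by simp
qed

lemma sample_cov_restrict: "sample_cov n (restrict X {1..n}) = sample_cov n X"
proof -
  have "sample_mean n (restrict X {1..n}) = sample_mean n X"
    unfolding sample_mean_def by (intro arg_cong[where f = "\<lambda>x. _ *\<^sub>R x"] sum.cong) auto
  then show ?thesis
    unfolding sample_cov_def by (intro arg_cong[where f = "\<lambda>x. _ *\<^sub>R x"] sum.cong) auto
qed

lemma sample_cov_scale: "sample_cov n (\<lambda>i. t *\<^sub>R X i) = t\<^sup>2 *\<^sub>R sample_cov n X"
proof -
  have "sample_mean n (\<lambda>i. t *\<^sub>R X i) = t *\<^sub>R sample_mean n X"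
    by (simp add: sample_mean_def scaleR_sum_right[symmetric])
  moreover have "outer (t *\<^sub>R x) (t *\<^sub>R y) = t\<^sup>2 *\<^sub>R outer x y" for x y :: "real ^ 'a"
    by (simp add: outer_def vec_eq_iff power2_eq_square)
  ultimately show ?thesis
    by (simp add: sample_cov_def scaleR_diff_right[symmetric] scaleR_sum_right[symmetric])
qed

lemma AE_krylov_det_sample_cov:
  fixes \<theta> :: "real ^ 'p"
  assumes \<theta>: "norm \<theta> = 1" and n: "n \<ge> 2 * CARD('p)"
  shows "AE X in PiM {1..n} (\<lambda>_. lborel). krylov_det (sample_cov n X) \<theta> \<noteq> 0"
proof -
  obtain D where D: "krylov_det (sample_cov n D) \<theta> \<noteq> 0"
    using exists_cyclic_sample[OF assms] .
  have "CARD('p) \<ge> 1" by (simp add: Suc_leI)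
  then have n1: "n \<ge> 1" using n by linarith
  show ?thesis
  proof (rule AE_homogeneous_polynomial_nonzero[where D = D])
    show "(\<lambda>X. krylov_det (sample_cov n X) \<theta>) \<in> borel_measurable (sample_space n)"
      by (intro measurable_krylov_det measurable_sample_cov)
    show "real_polynomial_function (\<lambda>s. krylov_det (sample_cov n (\<lambda>i. s *\<^sub>R X i + D i)) \<theta>)" for X D
    proof (rule real_polynomial_function_krylov_det)
      fix k l
      have lin: "real_polynomial_function (\<lambda>s. (s *\<^sub>R X i + D i) $ j)" for i j
      proof -
        have "real_polynomial_function (\<lambda>s. s * X i $ j + D i $ j)"
          by (intro real_polynomial_function.intros(3) real_polynomial_function.intros(4) real_polynomial_function.intros(2)
              real_polynomial_function.intros(1) bounded_linear_ident)
        then show ?thesis by simp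
      qed
      have mean: "real_polynomial_function (\<lambda>s. sample_mean n (\<lambda>i. s *\<^sub>R X i + D i) $ j)" for j
      proof -
        have "real_polynomial_function (\<lambda>s. (1 / real n) * (\<Sum>i\<in>{1..n}. (s *\<^sub>R X i + D i) $ j))"
          by (intro real_polynomial_function.intros(4) real_polynomial_function.intros(2) real_polynomial_function_sum lin) simp
        then show ?thesis by (simp add: sample_mean_def sum_component)
      qed
      show "real_polynomial_function (\<lambda>s. sample_cov n (\<lambda>i. s *\<^sub>R X i + D i) $ k $ l)"
        unfolding sample_cov_component[OF n1]
        by (intro real_polynomial_function_diff real_polynomial_function.intros(4) real_polynomial_function.intros(2)
            real_polynomial_function_sum lin mean) simp
    qed
    show "krylov_det (sample_cov n X) \<theta> = 0"
      if "t \<noteq> 0" "krylov_det (sample_cov n (\<lambda>i. t *\<^sub>R X i)) \<theta> = 0" for X t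
      using that krylov_det_scale[of "t\<^sup>2" "sample_cov n X" \<theta>] by (auto simp: sample_cov_scale)
    show "krylov_det (sample_cov n (restrict X {1..n})) \<theta> = krylov_det (sample_cov n X) \<theta>" for X
      by (simp only: sample_cov_restrict)
  qed (use D in simp_all)
qed

text \<open>Spiked samples have a density with respect to Lebesgue measure, so null sets
  for the latter are null sets for their law.\<close>

lemma AE_sample_law_no_orthogonal_eigenvector:
  fixes \<theta> \<theta>' :: "real ^ 'p"
  assumes \<theta>: "norm \<theta> = 1" and \<theta>': "norm \<theta>' = 1" and s: "-1 < r n * v" and n: "n \<ge> 2 * CARD('p)"
  shows "AE X in sample_law \<theta>' r v n. no_orthogonal_eigenvector (sample_cov n X) \<theta>"
proof -
  let ?s = "r n * v"
  let ?f = "\<lambda>x. ennreal (exp (- (norm x)\<^sup>2 / 2 + ?s / (1 + ?s) * (\<theta>' \<bullet> x)\<^sup>2 / 2)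
        / (sqrt (1 + ?s) * sqrt ((2 * pi) ^ CARD('p))))"
  have mvn: "multivariate_normal 0 (mat 1 + ?s *\<^sub>R outer \<theta>' \<theta>') = density lborel ?f"
    by (rule multivariate_normal_spiked[OF \<theta>' s])
  have "prob_space (density lborel ?f)"
    unfolding mvn[symmetric] multivariate_normal_spiked_eq_distr[OF \<theta>' s]
    by (intro prob_space.prob_space_distr prob_space_std_gaussian) simp
  then have law: "sample_law \<theta>' r v n = density (PiM {1..n} (\<lambda>_. lborel)) (\<lambda>x. \<Prod>i\<in>{1..n}. ?f (x i))"
    unfolding sample_law_def mvn
    by (intro PiM_density) (simp_all add: product_sigma_finite_lborel product_sigma_finite_prob_spaces)
  have meas: "(\<lambda>x. \<Prod>i\<in>{1..n}. ?f (x i)) \<in> borel_measurable (PiM {1..n} (\<lambda>_. lborel))"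
    by measurable
  show ?thesis
    unfolding law AE_density[OF meas]
    using AE_krylov_det_sample_cov[OF \<theta> n]
    by eventually_elim (intro impI no_orthogonal_eigenvector_if_krylov_det[OF transpose_sample_cov])
qed

section \<open>The test statistic as a quadratic form\<close>

lemma measurable_gs_orthonormalized:
  fixes \<theta> :: "real ^ 'p"
  assumes h: "\<And>j. j \<in> {2..m} \<Longrightarrow> (\<lambda>x. h x j) \<in> borel_measurable M" and j: "j \<in> {2..m}"
  shows "(\<lambda>x. gs_orthonormalized \<theta> (h x) j) \<in> borel_measurable M"
  using j
proof (induction j rule: less_induct)
  case (less j)
  have g: "(\<lambda>x. gs_orthonormalized \<theta> (h x) k) \<in> borel_measurable M" if "k \<in> {2..<j}" for k
    using less.IH[of k] less.prems that by auto
  note hj = h[OF less.prems]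
  have w: "(\<lambda>x. h x j - (\<theta> \<bullet> h x j) *\<^sub>R \<theta>
    - (\<Sum>k\<in>{2..<j}. (gs_orthonormalized \<theta> (h x) k \<bullet> h x j) *\<^sub>R gs_orthonormalized \<theta> (h x) k)) \<in> borel_measurable M"
    by (intro borel_measurable_diff borel_measurable_sum borel_measurable_scaleR borel_measurable_inner
        g hj measurable_const) simp_all
  from borel_measurable_scaleR[OF borel_measurable_inverse[OF measurable_compose[OF w borel_measurable_norm]] w]
  show ?case by (subst gs_orthonormalized_eq)
qed

lemma borel_measurable_matrix_vector_mult:
  fixes A :: "'a \<Rightarrow> real ^ 'm ^ 'k"
  assumes "A \<in> borel_measurable M" "x \<in> borel_measurable M"
  shows "(\<lambda>z. A z *v x z) \<in> borel_measurable M"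
proof -
  have "(\<lambda>z. A z *v x z) = (\<lambda>z. \<Sum>i\<in>UNIV. (\<Sum>j\<in>UNIV. A z $ i $ j * x z $ j) *\<^sub>R axis i 1)"
    by (auto simp: fun_eq_iff vec_eq_iff matrix_vector_mult_component sum_component axis_def if_distrib cong: if_cong)
  moreover have "(\<lambda>z. \<Sum>i\<in>UNIV. (\<Sum>j\<in>UNIV. A z $ i $ j * x z $ j) *\<^sub>R axis i (1::real)) \<in> borel_measurable M"
    using assms by measurable
  ultimately show ?thesis by simp
qed

lemma sample_eigenvectorsD:
  fixes eigvec :: "nat \<Rightarrow> ('p::finite) sample \<Rightarrow> nat \<Rightarrow> real ^ 'p"
  assumes "sample_eigenvectors eigvec" "n \<ge> 1" "j \<in> {1..CARD('p)}"
  shows "(\<lambda>X. eigvec n X j) \<in> borel_measurable (sample_space n)"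
    and "X \<in> space (sample_space n) \<Longrightarrow> norm (eigvec n X j) = 1"
    and "X \<in> space (sample_space n) \<Longrightarrow>
      sample_cov n X *v eigvec n X j = eigval (sample_cov n X) j *\<^sub>R eigvec n X j"
    and "X \<in> space (sample_space n) \<Longrightarrow>
      eigval (sample_cov n X) j = eigvec n X j \<bullet> (sample_cov n X *v eigvec n X j)"
proof -
  show "(\<lambda>X. eigvec n X j) \<in> borel_measurable (sample_space n)"
    using assms unfolding sample_eigenvectors_def by blast
  assume X: "X \<in> space (sample_space n)"
  show n: "norm (eigvec n X j) = 1"
    and S: "sample_cov n X *v eigvec n X j = eigval (sample_cov n X) j *\<^sub>R eigvec n X j"
    using assms X unfolding sample_eigenvectors_def by blast+
  show "eigval (sample_cov n X) j = eigvec n X j \<bullet> (sample_cov n X *v eigvec n X j)"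
    using n by (simp add: S norm_eq_1)
qed

text \<open>The eigenvalues are measurable because they are Rayleigh quotients of the measurable
  eigenvectors.\<close>

lemma measurable_Q_HPV:
  fixes eigvec :: "nat \<Rightarrow> ('p::finite) sample \<Rightarrow> nat \<Rightarrow> real ^ 'p"
  assumes ev: "sample_eigenvectors eigvec" and n: "n \<ge> 1"
  shows "Q_HPV \<theta> eigvec n \<in> borel_measurable (sample_space n)"
proof -
  note D = sample_eigenvectorsD[OF ev n]
  have l: "(\<lambda>X :: 'p sample. eigval (sample_cov n X) j) \<in> borel_measurable (sample_space n)" if j: "j \<in> {1..CARD('p)}" for j
  proof -
    have "(\<lambda>X. eigvec n X j \<bullet> (sample_cov n X *v eigvec n X j)) \<in> borel_measurable (sample_space n)"
      by (intro borel_measurable_inner borel_measurable_matrix_vector_mult D(1)[OF j] measurable_sample_cov)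
    moreover have "(\<lambda>X :: 'p sample. eigval (sample_cov n X) j) \<in> borel_measurable (sample_space n)
      \<longleftrightarrow> (\<lambda>X. eigvec n X j \<bullet> (sample_cov n X *v eigvec n X j)) \<in> borel_measurable (sample_space n)"
      using D(4)[OF j] by (rule Sigma_Algebra.measurable_cong)
    ultimately show ?thesis by blast
  qed
  have "1 \<in> {1..CARD('p)}" by (simp add: Suc_leI)
  note l1 = l[OF this]
  have g: "(\<lambda>X. gs_orthonormalized \<theta> (eigvec n X) j) \<in> borel_measurable (sample_space n)" if "j \<in> {2..CARD('p)}" for j
    by (rule measurable_gs_orthonormalized[OF _ that]) (rule D(1), auto)
  show ?thesis
    unfolding Q_HPV_def[abs_def]
    by (intro borel_measurable_times borel_measurable_divide borel_measurable_sum borel_measurable_inverse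
        borel_measurable_power borel_measurable_inner borel_measurable_matrix_vector_mult measurable_sample_cov
        measurable_const l1 l g) auto
qed

text \<open>The eigenvalues are distinct, so the eigenvectors are orthonormal, and the first one is not
  orthogonal to \<open>\<theta>\<close>, so \<open>\<theta>\<close> is not in the span of the others. Hence the Gram--Schmidt
  vectors \<open>g j\<close> are orthonormal. As they are orthogonal to \<open>\<theta>\<close>, they do not see the difference
  between \<open>S \<theta>\<close> and its part orthogonal to \<open>\<theta>\<close>.\<close>

lemma Q_HPV_eq:
  fixes eigvec :: "nat \<Rightarrow> ('p::finite) sample \<Rightarrow> nat \<Rightarrow> real ^ 'p"
  assumes ev: "sample_eigenvectors eigvec" and n: "n \<ge> 1" and X: "X \<in> space (sample_space n)"
    and \<theta>: "norm \<theta> = 1" and cyc: "no_orthogonal_eigenvector (sample_cov n X) \<theta>"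
  defines "u \<equiv> sqrt (real n) *\<^sub>R orth_part \<theta> (sample_cov n X *v \<theta>)"
    and "g \<equiv> gs_orthonormalized \<theta> (eigvec n X)" and "l \<equiv> eigval (sample_cov n X)"
  shows "Q_HPV \<theta> eigvec n X = (\<Sum>j\<in>{2..CARD('p)}. inverse (l 1) * inverse (l j) * (g j \<bullet> u)\<^sup>2)"
    and "(\<Sum>j\<in>{2..CARD('p)}. (g j \<bullet> u)\<^sup>2) = (norm u)\<^sup>2"
proof -
  let ?S = "sample_cov n X" and ?h = "eigvec n X"
  have sym: "transpose ?S = ?S" by (rule transpose_sample_cov)
  have hh: "?h j \<bullet> ?h k = (if j = k then 1 else 0)" if jk: "j \<in> {1..CARD('p)}" "k \<in> {1..CARD('p)}" for j k
  proof (cases "j = k")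
    case True
    then show ?thesis using sample_eigenvectorsD(2)[OF ev n jk(1) X] by (simp add: norm_eq_1)
  next
    case False
    have "l j * (?h j \<bullet> ?h k) = (?S *v ?h j) \<bullet> ?h k"
      using sample_eigenvectorsD(3)[OF ev n jk(1) X] by (simp add: l_def)
    also have "\<dots> = ?h j \<bullet> (?S *v ?h k)" by (rule symmetric_matrix_inner[OF sym])
    also have "\<dots> = l k * (?h j \<bullet> ?h k)"
      using sample_eigenvectorsD(3)[OF ev n jk(2) X] by (simp add: l_def)
    finally have "(l j - l k) * (?h j \<bullet> ?h k) = 0" by (simp add: algebra_simps)
    moreover have "l j \<noteq> l k" unfolding l_def by (rule eigval_distinct[OF sym cyc jk False])
    ultimately show ?thesis using False by simp
  qed
  have one: "1 \<in> {1..CARD('p)}" by (simp add: Suc_leI)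
  have ind: "\<theta> \<notin> span (?h ` {2..CARD('p)})"
  proof
    assume "\<theta> \<in> span (?h ` {2..CARD('p)})"
    then have "orthogonal (?h 1) \<theta>"
      by (rule orthogonal_to_span) (use hh[OF one] in \<open>auto simp: orthogonal_def\<close>)
    then have "\<theta> \<bullet> ?h 1 = 0" by (simp add: orthogonal_def inner_commute)
    then have "?h 1 = 0"
      using cyc sample_eigenvectorsD(3)[OF ev n one X] unfolding no_orthogonal_eigenvector_def by blast
    then show False using sample_eigenvectorsD(2)[OF ev n one X] by simp
  qed
  have hh2: "?h j \<bullet> ?h k = (if j = k then 1 else 0)" if "j \<in> {2..CARD('p)}" "k \<in> {2..CARD('p)}" for j k
    using hh[of j k] that by auto
  have \<theta>u: "\<theta> \<bullet> u = 0" using \<theta> by (simp add: u_def orth_part_def inner_diff_right norm_eq_1)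
  show "(\<Sum>j\<in>{2..CARD('p)}. (g j \<bullet> u)\<^sup>2) = (norm u)\<^sup>2"
    unfolding g_def by (rule gs_orthonormalized_parseval[OF \<theta> hh2 ind \<theta>u])
  have gu: "(g j \<bullet> u)\<^sup>2 = real n * (g j \<bullet> (?S *v \<theta>))\<^sup>2" if "j \<in> {2..CARD('p)}" for j
  proof -
    have "\<theta> \<bullet> g j = 0" unfolding g_def using gs_orthonormalized_props[OF \<theta> hh2 ind that] by blast
    then show ?thesis
      by (simp add: u_def orth_part_def inner_diff_right inner_commute[of _ \<theta>] power_mult_distrib)
  qed
  show "Q_HPV \<theta> eigvec n X = (\<Sum>j\<in>{2..CARD('p)}. inverse (l 1) * inverse (l j) * (g j \<bullet> u)\<^sup>2)"
    unfolding Q_HPV_def l_def[symmetric] g_def[symmetric] sum_distrib_left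
    by (intro sum.cong refl) (simp add: gu divide_inverse mult_ac)
qed

lemma sample_cov_stretch:
  "sample_cov n (\<lambda>i. stretch k \<theta> (Y i)) *v y = stretch k \<theta> (sample_cov n Y *v stretch k \<theta> y)"
proof -
  have lin: "linear (stretch k \<theta>)"
    by (rule linearI) (simp_all add: stretch_def inner_add_right algebra_simps)
  have adj: "stretch k \<theta> x \<bullet> y = x \<bullet> stretch k \<theta> y" for x y
    by (simp add: stretch_def inner_add_left inner_add_right inner_commute)
  have "sample_mean n (\<lambda>i. stretch k \<theta> (Y i)) = stretch k \<theta> (sample_mean n Y)"
    unfolding sample_mean_def by (simp add: linear_scale[OF lin] linear_sum[OF lin])
  then show ?thesis
    unfolding sample_cov_mult_vec
    by (simp add: linear_diff[OF lin, symmetric] adj linear_scale[OF lin] linear_sum[OF lin])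
qed

text \<open>The centring of the orthogonal parts of the sample drops out because the centred weights
  sum to zero, and the sum of squares \<open>q\<close> that normalizes the contrast is
  \<open>n * (\<theta> \<bullet> (sample_cov n Y *v \<theta>))\<close>. If \<open>q = 0\<close>, both sides vanish.\<close>

lemma orth_part_sample_cov:
  assumes n: "n \<ge> 1"
  shows "sqrt (real n) *\<^sub>R orth_part \<theta> (sample_cov n Y *v \<theta>) = sqrt (\<theta> \<bullet> (sample_cov n Y *v \<theta>)) *\<^sub>R score n \<theta> Y"
proof -
  define a where "a i = \<theta> \<bullet> Y i" for i
  define m where "m = (\<Sum>i\<in>{1..n}. a i) / real n"
  define q where "q = (\<Sum>i\<in>{1..n}. (a i - m)\<^sup>2)"
  have q0: "q \<ge> 0" unfolding q_def by (intro sum_nonneg) auto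
  have mean: "\<theta> \<bullet> sample_mean n Y = m"
    by (simp add: sample_mean_def inner_sum_right m_def a_def)
  have ctr: "(Y i - sample_mean n Y) \<bullet> \<theta> = a i - m" for i
    using mean by (simp add: inner_diff_right a_def inner_commute[of _ \<theta>])
  have sum0: "(\<Sum>i\<in>{1..n}. a i - m) = 0" using n by (simp add: sum_subtractf m_def)
  note lin = linear_orth_part[of \<theta>]
  define T where "T = (\<Sum>i\<in>{1..n}. (a i - m) *\<^sub>R orth_part \<theta> (Y i))"
  have "orth_part \<theta> (sample_cov n Y *v \<theta>) = (1 / real n) *\<^sub>R (\<Sum>i\<in>{1..n}. (a i - m) *\<^sub>R orth_part \<theta> (Y i - sample_mean n Y))"
    unfolding sample_cov_mult_vec ctr by (simp add: linear_scale[OF lin] linear_sum[OF lin])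
  also have "(\<Sum>i\<in>{1..n}. (a i - m) *\<^sub>R orth_part \<theta> (Y i - sample_mean n Y)) = T - (\<Sum>i\<in>{1..n}. a i - m) *\<^sub>R orth_part \<theta> (sample_mean n Y)"
    unfolding T_def scaleR_sum_left
    by (simp only: linear_diff[OF lin] scaleR_diff_right sum_subtractf)
  finally have P: "orth_part \<theta> (sample_cov n Y *v \<theta>) = (1 / real n) *\<^sub>R T"
    by (simp only: sum0 scaleR_zero_left diff_zero)
  have "\<theta> \<bullet> (sample_cov n Y *v \<theta>) = (1 / real n) * (\<Sum>i\<in>{1..n}. (a i - m) * (\<theta> \<bullet> (Y i - sample_mean n Y)))"
    unfolding sample_cov_mult_vec ctr by (simp add: inner_sum_right)
  then have qS: "\<theta> \<bullet> (sample_cov n Y *v \<theta>) = q / real n"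
    by (simp add: q_def power2_eq_square inner_diff_right mean a_def)
  have w: "contrast n (\<lambda>i. \<theta> \<bullet> Y i) i = (if q = 0 then (if i = 1 then 1 else 0) else (a i - m) / sqrt q)" for i
    by (simp add: contrast_def Let_def m_def q_def a_def)
  show ?thesis
  proof (cases "q = 0")
    case True
    then have "\<forall>i\<in>{1..n}. (a i - m)\<^sup>2 = 0"
      unfolding q_def by (subst (asm) sum_nonneg_eq_0_iff) auto
    then have "T = 0" unfolding T_def by (intro sum.neutral) auto
    then show ?thesis using True by (simp add: P qS)
  next
    case False
    then have "score n \<theta> Y = (1 / sqrt q) *\<^sub>R T"
      by (simp add: score_def w T_def scaleR_sum_right)
    then have "sqrt (\<theta> \<bullet> (sample_cov n Y *v \<theta>)) *\<^sub>R score n \<theta> Y = (1 / sqrt (real n)) *\<^sub>R T"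
      using False q0 by (simp add: qS real_sqrt_divide)
    also have "\<dots> = sqrt (real n) *\<^sub>R orth_part \<theta> (sample_cov n Y *v \<theta>)"
    proof -
      have "sqrt (real n) * (1 / real n) = 1 / sqrt (real n)" using n by (simp add: field_simps)
      then show ?thesis by (simp add: P)
    qed
    finally show ?thesis by simp
  qed
qed

lemma norm_matrix_vector_mult_le:
  fixes A :: "real ^ 'm ^ 'k"
  shows "norm (A *v x) \<le> norm A * norm x"
proof -
  have "norm (A *v x) = L2_set (\<lambda>i. \<bar>A $ i \<bullet> x\<bar>) UNIV"
    by (simp add: norm_vec_def[of "A *v x"] matrix_vector_mult_component inner_vec_def)
  also have "\<dots> \<le> L2_set (\<lambda>i. norm (A $ i) * norm x) UNIV"
    by (intro L2_set_mono Cauchy_Schwarz_ineq2) simp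
  also have "\<dots> = norm A * norm x"
    by (simp add: norm_vec_def[of A] L2_set_left_distrib)
  finally show ?thesis .
qed

lemma tendsto_matrix_vector_mult [tendsto_intros]:
  fixes A :: "'a \<Rightarrow> real ^ 'm ^ 'k"
  assumes "(A \<longlongrightarrow> a) F" "(x \<longlongrightarrow> b) F"
  shows "((\<lambda>z. A z *v x z) \<longlongrightarrow> a *v b) F"
  using assms unfolding matrix_vector_mult_def
  by (intro tendsto_vec_lambda tendsto_sum tendsto_mult tendsto_vec_nth)

section \<open>Convergence in law of the test statistic\<close>

text \<open>An eigenvalue is the Rayleigh quotient at its unit eigenvector \<open>v\<close>, and equals
  \<open>x \<bullet> (T *v x)\<close> with \<open>x = stretch k \<theta> v\<close> and \<open>T\<close> the covariance matrix of \<open>Y\<close>. Both \<open>T\<close> and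
  the stretch are close to the identity.\<close>

lemma eigval_stretched_near_one:
  fixes eigvec :: "nat \<Rightarrow> ('p::finite) sample \<Rightarrow> nat \<Rightarrow> real ^ 'p" and \<theta> :: "real ^ 'p"
  assumes ev: "sample_eigenvectors eigvec" and n: "n \<ge> 1" and j: "j \<in> {1..CARD('p)}" and \<theta>: "norm \<theta> = 1"
  shows "\<bar>eigval (sample_cov n (\<lambda>i\<in>{1..n}. stretch k \<theta> (Y i))) j - 1\<bar>
    \<le> norm (sample_cov n Y - mat 1) * (1 + \<bar>k\<bar>)\<^sup>2 + (2 * \<bar>k\<bar> + k\<^sup>2)"
proof -
  define X where "X = (\<lambda>i\<in>{1..n}. stretch k \<theta> (Y i))"
  define v where "v = eigvec n X j"
  define x where "x = stretch k \<theta> v"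
  let ?S = "sample_cov n Y"
  have X: "X \<in> space (sample_space n)" by (simp add: X_def space_PiM)
  have v: "norm v = 1" unfolding v_def by (rule sample_eigenvectorsD(2)[OF ev n j X])
  have cov: "sample_cov n X *v y = stretch k \<theta> (?S *v stretch k \<theta> y)" for y
    unfolding X_def sample_cov_restrict by (rule sample_cov_stretch)
  have "eigval (sample_cov n X) j = v \<bullet> (sample_cov n X *v v)"
    unfolding v_def by (rule sample_eigenvectorsD(4)[OF ev n j X])
  also have "\<dots> = x \<bullet> (?S *v x)"
    unfolding cov x_def[symmetric] by (simp add: x_def stretch_def inner_add_left inner_add_right inner_commute)
  also have "\<dots> = x \<bullet> ((?S - mat 1) *v x) + x \<bullet> x"
    by (simp add: matrix_vector_mult_diff_rdistrib inner_diff_right)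
  finally have eq: "eigval (sample_cov n X) j - 1 = x \<bullet> ((?S - mat 1) *v x) + (x \<bullet> x - 1)" by simp
  have \<theta>v: "\<bar>\<theta> \<bullet> v\<bar> \<le> 1" using Cauchy_Schwarz_ineq2[of \<theta> v] \<theta> v by simp
  have nx: "norm x \<le> 1 + \<bar>k\<bar>"
  proof -
    have "norm x \<le> norm v + norm ((k * (\<theta> \<bullet> v)) *\<^sub>R \<theta>)" unfolding x_def stretch_def by (rule norm_triangle_ineq)
    also have "\<dots> \<le> 1 + \<bar>k\<bar> * 1" using v \<theta> \<theta>v by (simp add: abs_mult mult_left_le)
    finally show ?thesis by simp
  qed
  have "x \<bullet> x - 1 = (2 * k + k\<^sup>2) * (\<theta> \<bullet> v)\<^sup>2"
    using v \<theta> by (simp add: x_def stretch_def inner_add_left inner_add_right norm_eq_1 inner_commute power2_eq_square algebra_simps)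
  also have "\<bar>\<dots>\<bar> \<le> (2 * \<bar>k\<bar> + k\<^sup>2) * 1"
  proof -
    have "(\<theta> \<bullet> v)\<^sup>2 \<le> 1" using \<theta>v by (simp add: abs_square_le_1)
    moreover have "\<bar>2 * k + k\<^sup>2\<bar> \<le> 2 * \<bar>k\<bar> + k\<^sup>2" using abs_triangle_ineq[of "2 * k" "k\<^sup>2"] by simp
    ultimately show ?thesis unfolding abs_mult by (intro mult_mono) auto
  qed
  finally have "\<bar>x \<bullet> x - 1\<bar> \<le> 2 * \<bar>k\<bar> + k\<^sup>2" by simp
  moreover have "\<bar>x \<bullet> ((?S - mat 1) *v x)\<bar> \<le> norm (?S - mat 1) * (1 + \<bar>k\<bar>)\<^sup>2"
  proof -
    have "\<bar>x \<bullet> ((?S - mat 1) *v x)\<bar> \<le> norm x * norm ((?S - mat 1) *v x)" by (rule Cauchy_Schwarz_ineq2)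
    also have "\<dots> \<le> norm x * (norm (?S - mat 1) * norm x)"
      by (intro mult_left_mono norm_matrix_vector_mult_le) simp
    also have "\<dots> = norm (?S - mat 1) * (norm x)\<^sup>2" by (simp add: power2_eq_square)
    also have "\<dots> \<le> norm (?S - mat 1) * (1 + \<bar>k\<bar>)\<^sup>2" using nx by (intro mult_left_mono power_mono) auto
    finally show ?thesis .
  qed
  ultimately show ?thesis unfolding eq[unfolded X_def] by linarith
qed

text \<open>The analytic core, without probability. The filter on pairs of a sample size and a
  sample expresses that the sample size grows, the covariance matrix of the sample approaches the
  identity, the score stays bounded and the Gram--Schmidt vectors are well defined. Along it,
  ordinary limits replace limits in probability.\<close>

lemma Q_HPV_minus_score_tendsto:
  fixes \<theta>0 \<theta> :: "real ^ ('p::finite)" and eigvec :: "nat \<Rightarrow> 'p sample \<Rightarrow> nat \<Rightarrow> real ^ 'p" and K :: real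
  assumes ev: "sample_eigenvectors eigvec" and \<theta>0: "norm \<theta>0 = 1"
    and \<theta>s: "\<And>n. n \<ge> 1 \<Longrightarrow> norm (\<theta>s n) = 1" "\<theta>s \<longlonglongrightarrow> \<theta>"
    and ks: "ks \<longlonglongrightarrow> 0" "(\<lambda>n. sqrt (real n) * ks n) \<longlonglongrightarrow> \<rho> / 2"
  defines "m \<equiv> (\<rho> * (\<theta>0 \<bullet> \<theta>)) *\<^sub>R orth_part \<theta>0 \<theta>"
    and "X \<equiv> (\<lambda>(n, Y). \<lambda>i\<in>{1..n}. stretch (ks n) (\<theta>s n) (Y i))"
  defines "F \<equiv> filtercomap fst sequentially \<sqinter> filtercomap (\<lambda>(n, Y). sample_cov n Y) (nhds (mat 1)) \<sqinter>
      principal {(n, Y). norm (score n \<theta>0 Y) \<le> K \<and> no_orthogonal_eigenvector (sample_cov n (X (n, Y))) \<theta>0}"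
  shows "((\<lambda>(n, Y). Q_HPV \<theta>0 eigvec n (X (n, Y)) - (norm (score n \<theta>0 Y + m))\<^sup>2) \<longlongrightarrow> 0) F"
proof -
  have F1: "F \<le> filtercomap fst sequentially" and F2: "F \<le> filtercomap (\<lambda>(n, Y). sample_cov n Y) (nhds (mat 1))"
    and F3: "F \<le> principal {(n, Y). norm (score n \<theta>0 Y) \<le> K \<and> no_orthogonal_eigenvector (sample_cov n (X (n, Y))) \<theta>0}"
    unfolding F_def by (simp_all add: le_infI1)
  have limfst: "filterlim fst sequentially F"
    using filterlim_filtercomap F1 by (rule filterlim_mono[OF _ order_refl])
  define S where "S = (\<lambda>z :: nat \<times> 'p sample. sample_cov (fst z) (snd z))"
  define W where "W = (\<lambda>z :: nat \<times> 'p sample. score (fst z) \<theta>0 (snd z))"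
  define k where "k = (\<lambda>z :: nat \<times> 'p sample. ks (fst z))"
  define \<kappa> where "\<kappa> = (\<lambda>z :: nat \<times> 'p sample. sqrt (real (fst z)) * ks (fst z))"
  define t where "t = (\<lambda>z :: nat \<times> 'p sample. \<theta>s (fst z))"
  have limS: "(S \<longlongrightarrow> mat 1) F"
    using filterlim_mono[OF filterlim_filtercomap order_refl F2] by (simp add: S_def case_prod_unfold)
  have limk: "(k \<longlongrightarrow> 0) F" unfolding k_def by (rule filterlim_compose[OF ks(1) limfst])
  have lim\<kappa>: "(\<kappa> \<longlongrightarrow> \<rho> / 2) F" unfolding \<kappa>_def by (rule filterlim_compose[OF ks(2) limfst])
  have limt: "(t \<longlongrightarrow> \<theta>) F" unfolding t_def by (rule filterlim_compose[OF \<theta>s(2) limfst])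
  have n1: "eventually (\<lambda>z. fst z \<ge> 1) F"
    using eventually_compose_filterlim[OF eventually_ge_at_top[of 1] limfst] .
  have good: "eventually (\<lambda>z. norm (W z) \<le> K \<and> no_orthogonal_eigenvector (sample_cov (fst z) (X z)) \<theta>0) F"
    by (rule filter_leD[OF F3]) (auto simp: eventually_principal W_def)
  have Xs: "X z \<in> space (sample_space (fst z))" for z by (cases z) (simp add: X_def space_PiM)
  define u where "u = (\<lambda>z. sqrt (real (fst z)) *\<^sub>R orth_part \<theta>0 (sample_cov (fst z) (X z) *v \<theta>0))"
  \<comment> \<open>The terms of \<open>u\<close> that contain a factor \<open>k\<close>, apart from their limit \<open>m\<close>: the first one is
    due to the stretch applied before the covariance matrix, the second one to that after it.\<close>
  define e where "e = (\<lambda>z. (\<kappa> z * (t z \<bullet> \<theta>0)) *\<^sub>R orth_part \<theta>0 (S z *v t z)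
      + (\<kappa> z * (t z \<bullet> (S z *v \<theta>0 + (k z * (t z \<bullet> \<theta>0)) *\<^sub>R (S z *v t z)))) *\<^sub>R orth_part \<theta>0 (t z) - m)"
  define d where "d = (\<lambda>z. u z - (W z + m))"
  note lin = linear_orth_part[of \<theta>0]
  have deq: "d z = (sqrt (\<theta>0 \<bullet> (S z *v \<theta>0)) - 1) *\<^sub>R W z + e z" if n: "fst z \<ge> 1" for z
  proof -
    have cov: "sample_cov (fst z) (X z) *v \<theta>0 = stretch (k z) (t z) (S z *v stretch (k z) (t z) \<theta>0)"
      unfolding X_def case_prod_unfold sample_cov_restrict S_def k_def t_def by (rule sample_cov_stretch)
    have 1: "S z *v stretch (k z) (t z) \<theta>0 = S z *v \<theta>0 + (k z * (t z \<bullet> \<theta>0)) *\<^sub>R (S z *v t z)"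
      by (simp add: stretch_def matrix_vector_right_distrib matrix_vector_mult_scaleR)
    have 2: "sqrt (real (fst z)) *\<^sub>R orth_part \<theta>0 (S z *v \<theta>0) = sqrt (\<theta>0 \<bullet> (S z *v \<theta>0)) *\<^sub>R W z"
      unfolding S_def W_def by (rule orth_part_sample_cov[OF n])
    have "u z = sqrt (real (fst z)) *\<^sub>R orth_part \<theta>0 (S z *v \<theta>0)
      + (\<kappa> z * (t z \<bullet> \<theta>0)) *\<^sub>R orth_part \<theta>0 (S z *v t z)
      + (\<kappa> z * (t z \<bullet> (S z *v \<theta>0 + (k z * (t z \<bullet> \<theta>0)) *\<^sub>R (S z *v t z)))) *\<^sub>R orth_part \<theta>0 (t z)"
      unfolding u_def cov 1 unfolding stretch_def[of _ _ "_ + _"]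
      by (simp add: linear_add[OF lin] linear_scale[OF lin] scaleR_add_right \<kappa>_def k_def mult.assoc)
    then show ?thesis unfolding d_def e_def 2 by (simp add: algebra_simps)
  qed
  have lime: "(e \<longlongrightarrow> 0) F"
  proof -
    have "(e \<longlongrightarrow> (\<rho> / 2 * (\<theta> \<bullet> \<theta>0)) *\<^sub>R orth_part \<theta>0 (mat 1 *v \<theta>)
      + (\<rho> / 2 * (\<theta> \<bullet> (mat 1 *v \<theta>0 + (0 * (\<theta> \<bullet> \<theta>0)) *\<^sub>R (mat 1 *v \<theta>)))) *\<^sub>R orth_part \<theta>0 \<theta> - m) F"
      unfolding e_def orth_part_def by (intro tendsto_intros limS limk lim\<kappa> limt)
    moreover have "(\<rho> / 2 * (\<theta> \<bullet> \<theta>0)) *\<^sub>R orth_part \<theta>0 (mat 1 *v \<theta>)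
      + (\<rho> / 2 * (\<theta> \<bullet> (mat 1 *v \<theta>0 + (0 * (\<theta> \<bullet> \<theta>0)) *\<^sub>R (mat 1 *v \<theta>)))) *\<^sub>R orth_part \<theta>0 \<theta> - m = 0"
      by (simp add: m_def inner_commute scaleR_add_left[symmetric])
    ultimately show ?thesis by simp
  qed
  have limd: "(d \<longlongrightarrow> 0) F"
  proof (rule Lim_null_comparison)
    show "eventually (\<lambda>z. norm (d z) \<le> \<bar>sqrt (\<theta>0 \<bullet> (S z *v \<theta>0)) - 1\<bar> * K + norm (e z)) F"
      using n1 good
    proof eventually_elim
      case (elim z)
      have "norm (d z) \<le> norm ((sqrt (\<theta>0 \<bullet> (S z *v \<theta>0)) - 1) *\<^sub>R W z) + norm (e z)"
        unfolding deq[OF elim(1)] by (rule norm_triangle_ineq)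
      also have "norm ((sqrt (\<theta>0 \<bullet> (S z *v \<theta>0)) - 1) *\<^sub>R W z) \<le> \<bar>sqrt (\<theta>0 \<bullet> (S z *v \<theta>0)) - 1\<bar> * K"
        using elim(2) by (simp add: mult_left_mono)
      finally show ?case by simp
    qed
    have "((\<lambda>z. \<bar>sqrt (\<theta>0 \<bullet> (S z *v \<theta>0)) - 1\<bar> * K + norm (e z)) \<longlongrightarrow> \<bar>sqrt (\<theta>0 \<bullet> (mat 1 *v \<theta>0)) - 1\<bar> * K + norm (0 :: real ^ 'p)) F"
      by (intro tendsto_intros limS lime)
    then show "((\<lambda>z. \<bar>sqrt (\<theta>0 \<bullet> (S z *v \<theta>0)) - 1\<bar> * K + norm (e z)) \<longlongrightarrow> 0) F"
      using \<theta>0 by (simp add: norm_eq_1)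
  qed
  have limu: "((\<lambda>z. (norm (u z))\<^sup>2 - (norm (W z + m))\<^sup>2) \<longlongrightarrow> 0) F"
  proof (rule Lim_null_comparison)
    show "eventually (\<lambda>z. norm ((norm (u z))\<^sup>2 - (norm (W z + m))\<^sup>2) \<le> norm (d z) * (norm (d z) + 2 * (K + norm m))) F"
      using good
    proof eventually_elim
      case (elim z)
      have "u z = d z + (W z + m)" by (simp add: d_def)
      then have "(norm (u z))\<^sup>2 - (norm (W z + m))\<^sup>2 = d z \<bullet> (d z + 2 *\<^sub>R (W z + m))"
        by (simp add: power2_norm_eq_inner inner_add_left inner_add_right inner_commute)
      also have "\<bar>\<dots>\<bar> \<le> norm (d z) * norm (d z + 2 *\<^sub>R (W z + m))" by (rule Cauchy_Schwarz_ineq2)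
      also have "\<dots> \<le> norm (d z) * (norm (d z) + 2 * (K + norm m))"
      proof (rule mult_left_mono)
        have "norm (d z + 2 *\<^sub>R (W z + m)) \<le> norm (d z) + 2 * norm (W z + m)"
          using norm_triangle_ineq[of "d z" "2 *\<^sub>R (W z + m)"] by simp
        also have "norm (W z + m) \<le> K + norm m" using norm_triangle_ineq[of "W z" m] elim by linarith
        finally show "norm (d z + 2 *\<^sub>R (W z + m)) \<le> norm (d z) + 2 * (K + norm m)" by simp
      qed simp
      finally show ?case by simp
    qed
    have "((\<lambda>z. norm (d z) * (norm (d z) + 2 * (K + norm m))) \<longlongrightarrow> norm (0::real ^ 'p) * (norm (0::real ^ 'p) + 2 * (K + norm m))) F"
      by (intro tendsto_intros limd)
    then show "((\<lambda>z. norm (d z) * (norm (d z) + 2 * (K + norm m))) \<longlongrightarrow> 0) F" by simp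
  qed
  define l where "l j z = eigval (sample_cov (fst z) (X z)) j" for j z
  define g where "g j z = gs_orthonormalized \<theta>0 (eigvec (fst z) (X z)) j" for j z
  have liml: "(l j \<longlongrightarrow> 1) F" if j: "j \<in> {1..CARD('p)}" for j
  proof -
    have "((\<lambda>z. l j z - 1) \<longlongrightarrow> 0) F"
    proof (rule Lim_null_comparison)
      show "eventually (\<lambda>z. norm (l j z - 1) \<le> norm (S z - mat 1) * (1 + \<bar>k z\<bar>)\<^sup>2 + (2 * \<bar>k z\<bar> + (k z)\<^sup>2)) F"
        using n1
      proof eventually_elim
        case (elim z)
        show ?case
          using eigval_stretched_near_one[OF ev elim j \<theta>s(1)[OF elim], of "ks (fst z)" "snd z"]
          by (simp add: l_def X_def case_prod_unfold S_def k_def)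
      qed
      have "((\<lambda>z. norm (S z - mat 1) * (1 + \<bar>k z\<bar>)\<^sup>2 + (2 * \<bar>k z\<bar> + (k z)\<^sup>2)) \<longlongrightarrow> norm (mat 1 - mat 1 :: real ^ 'p ^ 'p) * (1 + \<bar>0\<bar>)\<^sup>2 + (2 * \<bar>0\<bar> + 0\<^sup>2)) F"
        by (intro tendsto_intros limS limk)
      then show "((\<lambda>z. norm (S z - mat 1) * (1 + \<bar>k z\<bar>)\<^sup>2 + (2 * \<bar>k z\<bar> + (k z)\<^sup>2)) \<longlongrightarrow> 0) F" by simp
    qed
    then show ?thesis using Lim_null by blast
  qed
  define C where "C = (1 + (K + norm m))\<^sup>2"
  have bound: "eventually (\<lambda>z. (norm (u z))\<^sup>2 \<le> C) F"
  proof -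
    have "eventually (\<lambda>z. norm (d z) < 1) F"
      using limd order_tendstoD(2)[OF tendsto_norm_zero[OF limd], of 1] by simp
    then show ?thesis using good
    proof eventually_elim
      case (elim z)
      have "u z = d z + (W z + m)" by (simp add: d_def)
      then have "norm (u z) \<le> norm (d z) + norm (W z + m)" using norm_triangle_ineq[of "d z"] by simp
      also have "\<dots> \<le> 1 + (K + norm m)" using norm_triangle_ineq[of "W z" m] elim by linarith
      finally show ?case unfolding C_def by (intro power_mono) auto
    qed
  qed
  have "((\<lambda>z. Q_HPV \<theta>0 eigvec (fst z) (X z) - (norm (u z))\<^sup>2) \<longlongrightarrow> 0) F"
  proof (rule Lim_null_comparison)
    show "eventually (\<lambda>z. norm (Q_HPV \<theta>0 eigvec (fst z) (X z) - (norm (u z))\<^sup>2)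
       \<le> (\<Sum>j\<in>{2..CARD('p)}. \<bar>inverse (l 1 z) * inverse (l j z) - 1\<bar> * C)) F"
      using n1 good bound
    proof eventually_elim
      case (elim z)
      have uz: "sqrt (real (fst z)) *\<^sub>R orth_part \<theta>0 (sample_cov (fst z) (X z) *v \<theta>0) = u z" by (simp add: u_def)
      have Q1: "Q_HPV \<theta>0 eigvec (fst z) (X z) = (\<Sum>j\<in>{2..CARD('p)}. inverse (l 1 z) * inverse (l j z) * (g j z \<bullet> u z)\<^sup>2)"
        and Q2: "(\<Sum>j\<in>{2..CARD('p)}. (g j z \<bullet> u z)\<^sup>2) = (norm (u z))\<^sup>2"
        using Q_HPV_eq[OF ev elim(1) Xs \<theta>0 conjunct2[OF elim(2)]] unfolding uz l_def[symmetric] g_def[symmetric] by auto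
      have "Q_HPV \<theta>0 eigvec (fst z) (X z) - (norm (u z))\<^sup>2
         = (\<Sum>j\<in>{2..CARD('p)}. (inverse (l 1 z) * inverse (l j z) - 1) * (g j z \<bullet> u z)\<^sup>2)"
        unfolding Q1 Q2[symmetric] by (simp add: sum_subtractf[symmetric] left_diff_distrib)
      also have "\<bar>\<dots>\<bar> \<le> (\<Sum>j\<in>{2..CARD('p)}. \<bar>(inverse (l 1 z) * inverse (l j z) - 1) * (g j z \<bullet> u z)\<^sup>2\<bar>)"
        by (rule sum_abs)
      also have "\<dots> \<le> (\<Sum>j\<in>{2..CARD('p)}. \<bar>inverse (l 1 z) * inverse (l j z) - 1\<bar> * C)"
      proof (rule sum_mono)
        fix j assume "j \<in> {2..CARD('p)}"
        then have "(g j z \<bullet> u z)\<^sup>2 \<le> (\<Sum>j\<in>{2..CARD('p)}. (g j z \<bullet> u z)\<^sup>2)" by (intro member_le_sum) auto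
        then have "(g j z \<bullet> u z)\<^sup>2 \<le> C" using Q2 elim(3) by simp
        then show "\<bar>(inverse (l 1 z) * inverse (l j z) - 1) * (g j z \<bullet> u z)\<^sup>2\<bar> \<le> \<bar>inverse (l 1 z) * inverse (l j z) - 1\<bar> * C"
          unfolding abs_mult by (intro mult_left_mono) auto
      qed
      finally show ?case by simp
    qed
    have one: "1 \<in> {1..CARD('p)}" by (simp add: Suc_leI)
    show "((\<lambda>z. \<Sum>j\<in>{2..CARD('p)}. \<bar>inverse (l 1 z) * inverse (l j z) - 1\<bar> * C) \<longlongrightarrow> 0) F"
    proof (rule tendsto_null_sum)
      fix j assume "j \<in> {2..CARD('p)}"
      then have j: "j \<in> {1..CARD('p)}" by auto
      have "((\<lambda>z. \<bar>inverse (l 1 z) * inverse (l j z) - 1\<bar> * C) \<longlongrightarrow> \<bar>inverse 1 * inverse 1 - 1\<bar> * C) F"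
        by (intro tendsto_intros liml[OF one] liml[OF j]) simp_all
      then show "((\<lambda>z. \<bar>inverse (l 1 z) * inverse (l j z) - 1\<bar> * C) \<longlongrightarrow> 0) F" by simp
    qed
  qed
  from tendsto_add[OF this limu] show ?thesis
    by (simp add: case_prod_unfold W_def)
qed

text \<open>Slutsky's theorem for a law \<open>\<nu>\<close> that does not depend on \<open>n\<close>: outside an event of
  small probability, \<open>T n \<le> q\<close> implies \<open>U n \<le> q + \<epsilon>\<close> and is implied by \<open>U n \<le> q - \<epsilon>\<close>.\<close>

lemma cdf_tendsto_if_difference_negligible:
  fixes T U :: "nat \<Rightarrow> 'a \<Rightarrow> real"
  assumes M: "\<And>n. n \<ge> 1 \<Longrightarrow> prob_space (M n)"
    and T: "\<And>n. n \<ge> 1 \<Longrightarrow> T n \<in> borel_measurable (M n)" and U: "\<And>n. n \<ge> 1 \<Longrightarrow> U n \<in> borel_measurable (M n)"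
    and law: "\<And>n. n \<ge> 1 \<Longrightarrow> distr (M n) borel (U n) = \<nu>"
    and small: "\<And>\<epsilon>. \<epsilon> > 0 \<Longrightarrow> (\<lambda>n. measure (M n) {x \<in> space (M n). \<epsilon> \<le> \<bar>T n x - U n x\<bar>}) \<longlonglongrightarrow> 0"
    and cont: "isCont (cdf \<nu>) q"
  shows "(\<lambda>n. cdf (distr (M n) borel (T n)) q) \<longlonglongrightarrow> cdf \<nu> q"
proof (rule LIMSEQ_I)
  fix \<eta> :: real assume \<eta>: "\<eta> > 0"
  obtain \<delta> where \<delta>: "\<delta> > 0" "\<And>x. \<bar>x - q\<bar> < \<delta> \<Longrightarrow> \<bar>cdf \<nu> x - cdf \<nu> q\<bar> < \<eta> / 2"
    using cont \<eta> unfolding isCont_def LIM_eq real_norm_def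
    by (metis (no_types, opaque_lifting) abs_zero diff_self half_gt_zero)
  define \<epsilon> where "\<epsilon> = \<delta> / 2"
  have \<epsilon>: "\<epsilon> > 0" using \<delta> by (simp add: \<epsilon>_def)
  define B where "B n = {x \<in> space (M n). \<epsilon> \<le> \<bar>T n x - U n x\<bar>}" for n
  have "eventually (\<lambda>n. measure (M n) (B n) < \<eta> / 2) sequentially"
    using small[OF \<epsilon>] \<eta> unfolding B_def by (intro order_tendstoD(2)) auto
  then obtain N where N: "\<And>n. n \<ge> N \<Longrightarrow> measure (M n) (B n) < \<eta> / 2"
    by (auto simp: eventually_sequentially)
  show "\<exists>no. \<forall>n\<ge>no. norm (cdf (distr (M n) borel (T n)) q - cdf \<nu> q) < \<eta>"
  proof (intro exI allI impI)
    fix n assume "max N 1 \<le> n"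
    then have n: "n \<ge> N" "n \<ge> 1" by auto
    interpret prob_space "M n" by (rule M[OF n(2)])
    note [measurable] = T[OF n(2)] U[OF n(2)]
    have Bm [measurable]: "B n \<in> sets (M n)" unfolding B_def by measurable
    have cT: "cdf (distr (M n) borel (T n)) x = prob {z \<in> space (M n). T n z \<le> x}" for x
      by (simp add: cdf_def measure_distr vimage_def Int_def conj_commute)
    have cU: "cdf \<nu> x = prob {z \<in> space (M n). U n z \<le> x}" for x
      unfolding law[OF n(2), symmetric] by (simp add: cdf_def measure_distr vimage_def Int_def conj_commute)
    have "prob {z \<in> space (M n). T n z \<le> q} \<le> prob ({z \<in> space (M n). U n z \<le> q + \<epsilon>} \<union> B n)"
      by (rule finite_measure_mono) (auto simp: B_def)
    also have "\<dots> \<le> prob {z \<in> space (M n). U n z \<le> q + \<epsilon>} + prob (B n)"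
      by (rule measure_Un_le) measurable
    finally have 1: "cdf (distr (M n) borel (T n)) q \<le> cdf \<nu> (q + \<epsilon>) + prob (B n)" by (simp add: cT cU)
    have "prob {z \<in> space (M n). U n z \<le> q - \<epsilon>} \<le> prob ({z \<in> space (M n). T n z \<le> q} \<union> B n)"
      by (rule finite_measure_mono) (auto simp: B_def)
    also have "\<dots> \<le> prob {z \<in> space (M n). T n z \<le> q} + prob (B n)"
      by (rule measure_Un_le) measurable
    finally have 2: "cdf \<nu> (q - \<epsilon>) \<le> cdf (distr (M n) borel (T n)) q + prob (B n)" by (simp add: cT cU)
    have "\<bar>cdf \<nu> (q + \<epsilon>) - cdf \<nu> q\<bar> < \<eta> / 2" "\<bar>cdf \<nu> (q - \<epsilon>) - cdf \<nu> q\<bar> < \<eta> / 2"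
      using \<delta> by (auto simp: \<epsilon>_def)
    then show "norm (cdf (distr (M n) borel (T n)) q - cdf \<nu> q) < \<eta>"
      using 1 2 N[OF n(1)] unfolding real_norm_def by linarith
  qed
qed

lemma eventually_filtercomap2_principalE:
  assumes "eventually P (filtercomap f F \<sqinter> filtercomap g G \<sqinter> principal S)"
  obtains Q R where "eventually Q F" "eventually R G" "\<And>z. Q (f z) \<Longrightarrow> R (g z) \<Longrightarrow> z \<in> S \<Longrightarrow> P z"
proof -
  from assms have "\<exists>Q' R'. eventually Q' (filtercomap f F) \<and> eventually R' (filtercomap g G) \<and>
      (\<forall>z. Q' z \<and> R' z \<longrightarrow> z \<in> S \<longrightarrow> P z)"
    unfolding eventually_inf_principal by (simp only: eventually_inf)
  then obtain Q' R' where *: "eventually Q' (filtercomap f F) \<and> eventually R' (filtercomap g G) \<and>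
      (\<forall>z. Q' z \<and> R' z \<longrightarrow> z \<in> S \<longrightarrow> P z)"
    by (elim exE)
  from * have "\<exists>Q. eventually Q F \<and> (\<forall>z. Q (f z) \<longrightarrow> Q' z)" by (simp only: eventually_filtercomap)
  then obtain Q where Q: "eventually Q F \<and> (\<forall>z. Q (f z) \<longrightarrow> Q' z)" by (elim exE)
  from * have "\<exists>R. eventually R G \<and> (\<forall>z. R (g z) \<longrightarrow> R' z)" by (simp only: eventually_filtercomap)
  then obtain R where R: "eventually R G \<and> (\<forall>z. R (g z) \<longrightarrow> R' z)" by (elim exE)
  show thesis by (rule that[of Q R]) (use * Q R in auto)
qed

text \<open>The law of \<open>\<parallel>score\<parallel>\<^sup>2\<close> is the same for all \<open>n\<close>, so a single bound \<open>K\<close> holds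
  with high probability. Outside the events that this bound fails, that the covariance matrix
  is not close to the identity, and that some eigenvector is orthogonal to \<open>\<theta>0\<close>, the
  deterministic limit applies.\<close>

lemma Q_HPV_minus_score_in_probability:
  fixes \<theta>0 \<theta> :: "real ^ ('p::finite)" and eigvec :: "nat \<Rightarrow> 'p sample \<Rightarrow> nat \<Rightarrow> real ^ 'p"
  assumes p: "2 \<le> CARD('p)" and ev: "sample_eigenvectors eigvec" and \<theta>0: "norm \<theta>0 = 1"
    and \<theta>s: "\<And>n. n \<ge> 1 \<Longrightarrow> norm (\<theta>s n) = 1" "\<theta>s \<longlonglongrightarrow> \<theta>"
    and s: "\<And>n. n \<ge> 1 \<Longrightarrow> -1 < r n * v"
    and ks: "(\<lambda>n. sqrt (1 + r n * v) - 1) \<longlonglongrightarrow> 0" "(\<lambda>n. sqrt (real n) * (sqrt (1 + r n * v) - 1)) \<longlonglongrightarrow> \<rho> / 2"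
    and \<epsilon>: "\<epsilon> > 0"
  defines "m \<equiv> (\<rho> * (\<theta>0 \<bullet> \<theta>)) *\<^sub>R orth_part \<theta>0 \<theta>"
    and "X \<equiv> (\<lambda>n Y. \<lambda>i\<in>{1..n}. stretch (sqrt (1 + r n * v) - 1) (\<theta>s n) (Y i))"
  shows "(\<lambda>n. measure (gaussian_sample n) {Y \<in> space (gaussian_sample n).
      \<epsilon> \<le> \<bar>Q_HPV \<theta>0 eigvec n (X n Y) - (norm (score n \<theta>0 Y + m))\<^sup>2\<bar>}) \<longlonglongrightarrow> 0"
proof (rule LIMSEQ_I)
  let ?G = "\<lambda>n. gaussian_sample n :: 'p sample measure"
  let ?\<nu> = "noncentral_chi_square (CARD('p) - 1) 0"
  let ?D = "\<lambda>n Y. Q_HPV \<theta>0 eigvec n (X n Y) - (norm (score n \<theta>0 Y + m))\<^sup>2"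
  interpret \<nu>: real_distribution ?\<nu> by (rule real_distribution_noncentral_chi_square)
  fix \<eta> :: real assume \<eta>: "\<eta> > 0"
  have "eventually (\<lambda>x. cdf ?\<nu> x > 1 - \<eta> / 2) at_top"
    using \<nu>.cdf_lim_at_top_prob \<eta> by (intro order_tendstoD(1)) auto
  then obtain b where b: "\<And>x. x \<ge> b \<Longrightarrow> cdf ?\<nu> x > 1 - \<eta> / 2"
    unfolding eventually_at_top_linorder by blast
  define c where "c = max b 0"
  have c: "cdf ?\<nu> c > 1 - \<eta> / 2" "c \<ge> 0" using b[of c] by (simp_all add: c_def)
  define K where "K = sqrt c"
  have ev_small: "eventually (\<lambda>z. \<bar>case z of (n, Y) \<Rightarrow> ?D n Y\<bar> < \<epsilon>)
     (filtercomap fst sequentially \<sqinter> filtercomap (\<lambda>(n, Y). sample_cov n Y) (nhds (mat 1)) \<sqinter>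
      principal {(n, Y). norm (score n \<theta>0 Y) \<le> K \<and> no_orthogonal_eigenvector (sample_cov n (X n Y)) \<theta>0})"
    using tendstoD[OF Q_HPV_minus_score_tendsto[OF ev \<theta>0 \<theta>s ks, of K] \<epsilon>]
    unfolding m_def[symmetric] prod.case X_def dist_real_def diff_0_right .
  obtain P1 P2 where P: "eventually P1 sequentially" "eventually P2 (nhds (mat 1))"
    and imp': "\<And>z. P1 (fst z) \<Longrightarrow> P2 (case z of (n, Y) \<Rightarrow> sample_cov n Y) \<Longrightarrow>
       z \<in> {(n, Y). norm (score n \<theta>0 Y) \<le> K \<and> no_orthogonal_eigenvector (sample_cov n (X n Y)) \<theta>0} \<Longrightarrow>
       \<bar>case z of (n, Y) \<Rightarrow> ?D n Y\<bar> < \<epsilon>"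
    by (rule eventually_filtercomap2_principalE[OF ev_small], rule that)
  have imp: "\<bar>?D n Y\<bar> < \<epsilon>" if "P1 n" "P2 (sample_cov n Y)" "norm (score n \<theta>0 Y) \<le> K"
    "no_orthogonal_eigenvector (sample_cov n (X n Y)) \<theta>0" for n Y
    using imp'[of "(n, Y)"] that by simp
  obtain N1 where N1: "\<And>n. n \<ge> N1 \<Longrightarrow> P1 n" using P(1) by (auto simp: eventually_sequentially)
  obtain \<delta> where \<delta>: "\<delta> > 0" "\<And>S. dist S (mat 1) < \<delta> \<Longrightarrow> P2 S" using P(2) by (auto simp: eventually_nhds_metric)
  have "eventually (\<lambda>n. measure (?G n) {Y \<in> space (?G n). \<delta> \<le> norm (sample_cov n Y - mat 1)} < \<eta> / 2) sequentially"
    using sample_cov_tendsto_identity[OF \<delta>(1)] \<eta> by (intro order_tendstoD(2)) auto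
  then obtain N2 where N2: "\<And>n. n \<ge> N2 \<Longrightarrow> measure (?G n) {Y \<in> space (?G n). \<delta> \<le> norm (sample_cov n Y - mat 1)} < \<eta> / 2"
    by (auto simp: eventually_sequentially)
  show "\<exists>no. \<forall>n\<ge>no. norm (measure (?G n) {Y \<in> space (?G n). \<epsilon> \<le> \<bar>?D n Y\<bar>} - 0) < \<eta>"
  proof (intro exI allI impI)
    fix n assume "max (max N1 N2) (2 * CARD('p)) \<le> n"
    then have n: "n \<ge> N1" "n \<ge> N2" "n \<ge> 2 * CARD('p)" by auto
    then have n1: "n \<ge> 1" using p by linarith
    interpret prob_space "?G n" by (rule prob_space_gaussian_sample)
    define A where "A = {Y \<in> space (?G n). \<delta> \<le> norm (sample_cov n Y - mat 1)}"
    define C where "C = {Y \<in> space (?G n). K < norm (score n \<theta>0 Y)}"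
    have As: "A \<in> sets (?G n)" and Cs: "C \<in> sets (?G n)" unfolding A_def C_def by measurable
    have "AE Z in sample_law (\<theta>s n) r v n. no_orthogonal_eigenvector (sample_cov n Z) \<theta>0"
      by (rule AE_sample_law_no_orthogonal_eigenvector[where r = r and v = v and n = n, OF \<theta>0 \<theta>s(1)[OF n1] s[OF n1] n(3)])
    then have "AE Z in distr (?G n) (sample_space n) (X n). no_orthogonal_eigenvector (sample_cov n Z) \<theta>0"
      unfolding X_def sample_law_eq_distr[where r = r and v = v and n = n, OF \<theta>s(1)[OF n1] s[OF n1]] .
    then have AE: "AE Y in ?G n. no_orthogonal_eigenvector (sample_cov n (X n Y)) \<theta>0"
      by (rule AE_distrD[rotated]) (auto simp: X_def)
    have "measure (?G n) {Y \<in> space (?G n). \<epsilon> \<le> \<bar>?D n Y\<bar>} \<le> measure (?G n) (A \<union> C)"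
    proof (rule finite_measure_mono_AE)
      show "AE Y in ?G n. Y \<in> {Y \<in> space (?G n). \<epsilon> \<le> \<bar>?D n Y\<bar>} \<longrightarrow> Y \<in> A \<union> C"
        using AE AE_space
      proof eventually_elim
        case (elim Y)
        have small: "\<bar>?D n Y\<bar> < \<epsilon>" if "Y \<notin> A" "Y \<notin> C"
          using that elim N1[OF n(1)] \<delta>(2)[of "sample_cov n Y"]
          by (intro imp) (auto simp: A_def C_def dist_norm)
        show ?case
        proof
          assume "Y \<in> {Y \<in> space (?G n). \<epsilon> \<le> \<bar>?D n Y\<bar>}"
          then have "\<not> \<bar>?D n Y\<bar> < \<epsilon>" by simp
          then show "Y \<in> A \<union> C" using small by blast
        qed
      qed
    qed (use As Cs in auto)
    also have "\<dots> \<le> measure (?G n) A + measure (?G n) C" using As Cs by (rule measure_Un_le)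
    also have "measure (?G n) C \<le> \<eta> / 2"
    proof -
      have law: "distr (?G n) borel (\<lambda>Y. (norm (score n \<theta>0 Y))\<^sup>2) = ?\<nu>"
        using distr_score[OF p \<theta>0 _ n1, of 0] by simp
      have sm: "(\<lambda>Y. (norm (score n \<theta>0 Y))\<^sup>2) \<in> borel_measurable (?G n)" by measurable
      have "C = (\<lambda>Y. (norm (score n \<theta>0 Y))\<^sup>2) -` {c<..} \<inter> space (?G n)"
      proof -
        have "sqrt c < norm x \<longleftrightarrow> c < (norm x)\<^sup>2" for x :: "real ^ 'p"
          using real_sqrt_less_iff[of c "(norm x)\<^sup>2"] by simp
        then show ?thesis unfolding C_def K_def by auto
      qed
      then have "measure (?G n) C = measure ?\<nu> {c<..}"
        unfolding law[symmetric] by (subst measure_distr[OF sm]) auto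
      also have "{c<..} = space ?\<nu> - {..c}" unfolding \<nu>.space_eq_univ by auto
      also have "measure ?\<nu> (space ?\<nu> - {..c}) = 1 - cdf ?\<nu> c"
        unfolding cdf_def by (subst \<nu>.prob_compl) auto
      finally show ?thesis using c(1) by simp
    qed
    also have "measure (?G n) A < \<eta> / 2" unfolding A_def by (rule N2[OF n(2)])
    finally show "norm (measure (?G n) {Y \<in> space (?G n). \<epsilon> \<le> \<bar>?D n Y\<bar>} - 0) < \<eta>" by simp
  qed
qed

text \<open>Adding the fixed vector \<open>m\<close>, orthogonal to \<open>\<theta>0\<close>, to the score gives exactly the claimed
  limit law. Since \<open>sqrt (1 + s) - 1\<close> is asymptotically \<open>s / 2\<close>, the stretches contribute
  \<open>\<rho> / 2\<close> each.\<close>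

lemma Q_HPV_cdf_tendsto:
  fixes \<theta>0 \<theta> :: "real ^ ('p::finite)" and eigvec :: "nat \<Rightarrow> 'p sample \<Rightarrow> nat \<Rightarrow> real ^ 'p"
  assumes p: "2 \<le> CARD('p)" and ev: "sample_eigenvectors eigvec" and \<theta>0: "norm \<theta>0 = 1"
    and \<theta>s: "\<And>n. n \<ge> 1 \<Longrightarrow> norm (\<theta>s n) = 1" "\<theta>s \<longlonglongrightarrow> \<theta>"
    and s: "\<And>n. n \<ge> 1 \<Longrightarrow> 0 < r n * v" and \<rho>: "(\<lambda>n. sqrt (real n) * (r n * v)) \<longlonglongrightarrow> \<rho>"
  shows "(\<lambda>n. cdf (distr (sample_law (\<theta>s n) r v n) borel (Q_HPV \<theta>0 eigvec n)) q)
    \<longlonglongrightarrow> cdf (noncentral_chi_square (CARD('p) - 1) (\<rho>\<^sup>2 * (\<theta>0 \<bullet> \<theta>)\<^sup>2 * (1 - (\<theta>0 \<bullet> \<theta>)\<^sup>2))) q"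
proof -
  define k where "k n = sqrt (1 + r n * v) - 1" for n
  define m where "m = (\<rho> * (\<theta>0 \<bullet> \<theta>)) *\<^sub>R orth_part \<theta>0 \<theta>"
  define X where "X n Y = (\<lambda>i\<in>{1..n}. stretch (k n) (\<theta>s n) (Y i))" for n and Y :: "'p sample"
  let ?\<nu> = "noncentral_chi_square (CARD('p) - 1) ((norm m)\<^sup>2)"
  have s': "-1 < r n * v" if "n \<ge> 1" for n using s[OF that] by simp
  have s0: "(\<lambda>n. r n * v) \<longlonglongrightarrow> 0"
  proof -
    have "(\<lambda>n. (sqrt (real n) * (r n * v)) * inverse (sqrt (real n))) \<longlonglongrightarrow> \<rho> * 0"
      by (intro tendsto_mult \<rho> tendsto_inverse_0_at_top filterlim_compose[OF sqrt_at_top filterlim_real_sequentially])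
    moreover have "eventually (\<lambda>n. (sqrt (real n) * (r n * v)) * inverse (sqrt (real n)) = r n * v) sequentially"
      using eventually_ge_at_top[of 1] by eventually_elim (simp add: field_simps)
    ultimately show ?thesis by (simp add: tendsto_cong)
  qed
  have k0: "k \<longlonglongrightarrow> 0"
  proof -
    have "(\<lambda>n. sqrt (1 + r n * v) - 1) \<longlonglongrightarrow> sqrt (1 + 0) - 1" by (intro tendsto_intros s0)
    then show ?thesis by (simp add: k_def[abs_def])
  qed
  have k\<rho>: "(\<lambda>n. sqrt (real n) * k n) \<longlonglongrightarrow> \<rho> / 2"
  proof -
    have "(\<lambda>n. (sqrt (real n) * (r n * v)) / (sqrt (1 + r n * v) + 1)) \<longlonglongrightarrow> \<rho> / (sqrt (1 + 0) + 1)"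
      by (intro tendsto_intros \<rho> s0) simp
    moreover have "eventually (\<lambda>n. (sqrt (real n) * (r n * v)) / (sqrt (1 + r n * v) + 1) = sqrt (real n) * k n) sequentially"
      using eventually_ge_at_top[of 1]
    proof eventually_elim
      case (elim n)
      have "(sqrt (1 + r n * v) - 1) * (sqrt (1 + r n * v) + 1) = r n * v"
        using s[OF elim] by (simp add: algebra_simps flip: power2_eq_square)
      moreover have "sqrt (1 + r n * v) + 1 \<noteq> 0"
        using s[OF elim] by (smt (verit) real_sqrt_ge_zero)
      ultimately show ?case by (simp add: k_def field_simps)
    qed
    ultimately show ?thesis by (simp add: tendsto_cong)
  qed
  have \<theta>: "norm \<theta> = 1"
  proof (rule LIMSEQ_unique[OF tendsto_norm[OF \<theta>s(2)]])
    show "(\<lambda>n. norm (\<theta>s n)) \<longlonglongrightarrow> 1"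
      by (rule tendsto_eventually) (use \<theta>s(1) in \<open>auto simp: eventually_sequentially\<close>)
  qed
  have m: "\<theta>0 \<bullet> m = 0" using \<theta>0 by (simp add: m_def orth_part_def inner_diff_right norm_eq_1)
  have nm: "(norm m)\<^sup>2 = \<rho>\<^sup>2 * (\<theta>0 \<bullet> \<theta>)\<^sup>2 * (1 - (\<theta>0 \<bullet> \<theta>)\<^sup>2)"
  proof -
    have "(norm (orth_part \<theta>0 \<theta>))\<^sup>2 = 1 - (\<theta>0 \<bullet> \<theta>)\<^sup>2"
      using \<theta>0 \<theta> unfolding power2_norm_eq_inner
      by (simp add: orth_part_def inner_diff_left inner_diff_right norm_eq_1 inner_commute power2_eq_square)
    then show ?thesis by (simp add: m_def power_mult_distrib)
  qed
  have Xm: "X n \<in> measurable (gaussian_sample n) (sample_space n)" for n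
    unfolding X_def[abs_def] by measurable
  have Qm: "(\<lambda>Y. Q_HPV \<theta>0 eigvec n (X n Y)) \<in> borel_measurable (gaussian_sample n)" if "n \<ge> 1" for n
    using Xm measurable_Q_HPV[OF ev that] by (rule measurable_compose)
  have "(\<lambda>n. cdf (distr (gaussian_sample n) borel (\<lambda>Y. Q_HPV \<theta>0 eigvec n (X n Y))) q) \<longlonglongrightarrow> cdf ?\<nu> q"
  proof (rule cdf_tendsto_if_difference_negligible)
    show "(\<lambda>Y. (norm (score n \<theta>0 Y + m))\<^sup>2) \<in> borel_measurable (gaussian_sample n)" for n by measurable
    show "distr (gaussian_sample n) borel (\<lambda>Y. (norm (score n \<theta>0 Y + m))\<^sup>2) = ?\<nu>" if "n \<ge> 1" for n
      by (rule distr_score[OF p \<theta>0 m that])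
    show "isCont (cdf ?\<nu>) q" using p by (intro isCont_cdf_noncentral_chi_square) simp
    show "(\<lambda>n. measure (gaussian_sample n) {Y \<in> space (gaussian_sample n).
      \<epsilon> \<le> \<bar>Q_HPV \<theta>0 eigvec n (X n Y) - (norm (score n \<theta>0 Y + m))\<^sup>2\<bar>}) \<longlonglongrightarrow> 0" if "\<epsilon> > 0" for \<epsilon>
      using Q_HPV_minus_score_in_probability[OF p ev \<theta>0 \<theta>s s' k0[unfolded k_def[abs_def]] k\<rho>[unfolded k_def] that]
      by (simp only: X_def k_def m_def)
  qed (use Qm prob_space_gaussian_sample in auto)
  moreover have "eventually (\<lambda>n. cdf (distr (gaussian_sample n) borel (\<lambda>Y. Q_HPV \<theta>0 eigvec n (X n Y))) q
      = cdf (distr (sample_law (\<theta>s n) r v n) borel (Q_HPV \<theta>0 eigvec n)) q) sequentially"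
    using eventually_ge_at_top[of 1]
  proof eventually_elim
    case (elim n)
    have "distr (sample_law (\<theta>s n) r v n) borel (Q_HPV \<theta>0 eigvec n)
      = distr (distr (gaussian_sample n) (sample_space n) (X n)) borel (Q_HPV \<theta>0 eigvec n)"
      unfolding sample_law_eq_distr[where r = r and v = v and n = n, OF \<theta>s(1)[OF elim] s'[OF elim]] X_def k_def ..
    also have "\<dots> = distr (gaussian_sample n) borel (\<lambda>Y. Q_HPV \<theta>0 eigvec n (X n Y))"
      by (subst distr_distr[OF measurable_Q_HPV[OF ev elim] Xm]) (simp add: comp_def)
    finally show ?case by simp
  qed
  ultimately show ?thesis unfolding nm by (rule Lim_transform_eventually)
qed

section \<open>Likelihood ratios and the variation of power\<close>

text \<open>The likelihood ratio of the Gaussian law with covariance \<open>I + s \<theta>\<theta>'\<close> to the standard one.\<close>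

definition spiked_ratio :: "real \<Rightarrow> 'a::real_inner \<Rightarrow> 'a \<Rightarrow> real"
  where "spiked_ratio s \<theta> x = exp (s / (1 + s) * (\<theta> \<bullet> x)\<^sup>2 / 2) / sqrt (1 + s)"

lemma measurable_spiked_ratio [measurable]:
  "spiked_ratio s \<theta> \<in> borel_measurable (borel :: 'a::euclidean_space measure)"
  unfolding spiked_ratio_def[abs_def] by measurable

lemma spiked_ratio_nonneg: "-1 < s \<Longrightarrow> 0 \<le> spiked_ratio s \<theta> x"
  by (simp add: spiked_ratio_def)

lemma multivariate_normal_eq_density:
  fixes \<theta> :: "real ^ 'p"
  assumes \<theta>: "norm \<theta> = 1" and s: "-1 < s"
  shows "multivariate_normal 0 (mat 1 + s *\<^sub>R outer \<theta> \<theta>) = density std_gaussian (\<lambda>x. ennreal (spiked_ratio s \<theta> x))"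
proof -
  have "ennreal (exp (- (norm x)\<^sup>2 / 2) / sqrt ((2 * pi) ^ CARD('p))) * ennreal (spiked_ratio s \<theta> x)
    = ennreal (exp (- (norm x)\<^sup>2 / 2 + s / (1 + s) * (\<theta> \<bullet> x)\<^sup>2 / 2) / (sqrt (1 + s) * sqrt ((2 * pi) ^ CARD('p))))" for x
    unfolding exp_add spiked_ratio_def using s by (subst ennreal_mult''[symmetric]) (simp_all add: mult.commute)
  then show ?thesis
    unfolding std_gaussian_def multivariate_normal_spiked[OF assms]
    by (subst density_density_eq) simp_all
qed

lemma nn_integral_spiked_ratio:
  fixes \<theta> :: "real ^ 'p"
  assumes \<theta>: "norm \<theta> = 1" and s: "-1 < s"
  shows "(\<integral>\<^sup>+x. ennreal (spiked_ratio s \<theta> x) \<partial>std_gaussian) = 1"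
proof -
  have "prob_space (density std_gaussian (\<lambda>x. ennreal (spiked_ratio s \<theta> x)))"
    unfolding multivariate_normal_eq_density[OF assms, symmetric] multivariate_normal_spiked_eq_distr[OF assms]
    by (intro prob_space.prob_space_distr prob_space_std_gaussian) simp
  from prob_space.emeasure_space_1[OF this] show ?thesis by (simp add: emeasure_density)
qed

text \<open>The square of the ratio for \<open>s\<close> is a constant times the ratio for
  \<open>s' = 2 * s / (1 - s)\<close>, which has integral \<open>1\<close>; \<open>s'\<close> is found by comparing exponents.\<close>

lemma nn_integral_spiked_ratio_power2:
  fixes \<theta> :: "real ^ 'p"
  assumes \<theta>: "norm \<theta> = 1" and s: "0 \<le> s" "s < 1"
  shows "(\<integral>\<^sup>+x. ennreal ((spiked_ratio s \<theta> x)\<^sup>2) \<partial>std_gaussian) = ennreal (1 / sqrt (1 - s\<^sup>2))"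
proof -
  define s' where "s' = 2 * s / (1 - s)"
  have e: "1 + s' = (1 + s) / (1 - s)" using s by (simp add: s'_def field_simps)
  have "0 \<le> s'" using s by (simp add: s'_def)
  then have "-1 < s'" by linarith
  moreover have "s' / (1 + s') = 2 * (s / (1 + s))" unfolding e using s by (simp add: s'_def)
  ultimately have s': "-1 < s'" "s' / (1 + s') = 2 * (s / (1 + s))" "1 + s' = (1 + s) / (1 - s)"
    using e by auto
  have sq: "(spiked_ratio s \<theta> x)\<^sup>2 = (1 / sqrt (1 - s\<^sup>2)) * spiked_ratio s' \<theta> x" for x
  proof -
    have "(spiked_ratio s \<theta> x)\<^sup>2 = exp (s' / (1 + s') * (\<theta> \<bullet> x)\<^sup>2 / 2) / (1 + s)"
      using s unfolding s'(2) by (simp add: spiked_ratio_def power_divide exp_double[symmetric])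
    also have "1 + s = sqrt (1 - s\<^sup>2) * sqrt (1 + s')"
    proof -
      have "sqrt (1 - s\<^sup>2) * sqrt (1 + s') = sqrt ((1 - s\<^sup>2) * ((1 + s) / (1 - s)))" by (simp only: s'(3) real_sqrt_mult)
      also have "(1 - s\<^sup>2) * ((1 + s) / (1 - s)) = (1 + s)\<^sup>2" using s by (simp add: power2_eq_square field_simps)
      finally show ?thesis using s by simp
    qed
    finally show ?thesis by (simp add: spiked_ratio_def)
  qed
  have "s\<^sup>2 \<le> 1" using s by (simp add: abs_square_le_1)
  then have c0: "0 \<le> 1 / sqrt (1 - s\<^sup>2)" by simp
  have "(\<integral>\<^sup>+x. ennreal ((spiked_ratio s \<theta> x)\<^sup>2) \<partial>std_gaussian)
    = (\<integral>\<^sup>+x. ennreal (1 / sqrt (1 - s\<^sup>2)) * ennreal (spiked_ratio s' \<theta> x) \<partial>std_gaussian)"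
    unfolding sq ennreal_mult'[OF c0] ..
  also have "\<dots> = ennreal (1 / sqrt (1 - s\<^sup>2)) * (\<integral>\<^sup>+x. ennreal (spiked_ratio s' \<theta> x) \<partial>std_gaussian)"
    by (rule nn_integral_cmult) simp
  finally show ?thesis by (simp add: nn_integral_spiked_ratio[OF \<theta> s'(1)])
qed

text \<open>With the likelihood ratio \<open>L\<close> of the sample, the difference is at most
  \<open>E \<bar>L - 1\<bar> \<le> sqrt (E L\<^sup>2 - 1)\<close>, where \<open>E L\<^sup>2\<close> is the \<open>n\<close>-th power of the second moment of a
  single ratio. Bernoulli's inequality turns the power into an expression in \<open>n * s\<^sup>2\<close>.\<close>

lemma test_power_difference_le:
  fixes \<theta> :: "real ^ 'p"
  assumes \<theta>: "norm \<theta> = 1" and s: "0 \<le> r n * v" "real n * (r n * v)\<^sup>2 < 1" and n: "n \<ge> 1"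
    and \<psi>: "is_test_sequence \<psi>"
  shows "\<bar>test_power \<psi> \<theta> r v n - (\<integral>Y. \<psi> n Y \<partial>gaussian_sample n)\<bar> \<le> sqrt (1 / sqrt (1 - real n * (r n * v)\<^sup>2) - 1)"
proof -
  let ?G = "gaussian_sample n :: 'p sample measure" and ?s = "r n * v"
  interpret prob_space ?G by (rule prob_space_gaussian_sample)
  interpret N: product_sigma_finite "\<lambda>_::nat. std_gaussian :: (real ^ 'p) measure"
    by (intro product_sigma_finite_prob_spaces prob_space_std_gaussian)
  have "?s\<^sup>2 \<le> real n * ?s\<^sup>2" using n by (simp add: mult_le_cancel_right1)
  then have s2: "?s\<^sup>2 < 1" using s(2) by linarith
  then have s1: "?s < 1" using s(1) by (simp add: abs_square_less_1)
  have s': "-1 < ?s" using s(1) by simp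
  define L where "L Y = (\<Prod>i\<in>{1..n}. spiked_ratio ?s \<theta> (Y i))" for Y :: "'p sample"
  have Lm [measurable]: "L \<in> borel_measurable ?G" unfolding L_def[abs_def] by measurable
  have L0: "0 \<le> L Y" for Y unfolding L_def by (intro prod_nonneg ballI spiked_ratio_nonneg s')
  have law: "sample_law \<theta> r v n = density ?G (\<lambda>Y. ennreal (L Y))"
  proof -
    have pD: "prob_space (density std_gaussian (\<lambda>x. ennreal (spiked_ratio ?s \<theta> x)))"
      unfolding multivariate_normal_eq_density[OF \<theta> s', symmetric] multivariate_normal_spiked_eq_distr[OF \<theta> s']
      by (intro prob_space.prob_space_distr prob_space_std_gaussian) simp
    have "sample_law \<theta> r v n = density ?G (\<lambda>Y. \<Prod>i\<in>{1..n}. ennreal (spiked_ratio ?s \<theta> (Y i)))"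
      unfolding sample_law_def multivariate_normal_eq_density[OF \<theta> s']
      by (intro PiM_density) (simp_all add: product_sigma_finite_prob_spaces prob_space_std_gaussian pD)
    then show ?thesis by (simp add: L_def prod_ennreal spiked_ratio_nonneg[OF s'])
  qed
  have int: "(\<integral>\<^sup>+Y. ennreal (\<Prod>i\<in>{1..n}. h (Y i)) \<partial>?G) = (\<integral>\<^sup>+x. ennreal (h x) \<partial>std_gaussian) ^ n"
    if h [measurable]: "h \<in> borel_measurable borel" and h0: "\<And>x. 0 \<le> h x" for h :: "real ^ 'p \<Rightarrow> real"
  proof -
    have "(\<integral>\<^sup>+Y. ennreal (\<Prod>i\<in>{1..n}. h (Y i)) \<partial>?G) = (\<integral>\<^sup>+Y. (\<Prod>i\<in>{1..n}. ennreal (h (Y i))) \<partial>?G)"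
      using h0 by (simp add: prod_ennreal)
    also have "\<dots> = (\<Prod>i\<in>{1..n}. \<integral>\<^sup>+x. ennreal (h x) \<partial>std_gaussian)"
      by (rule N.product_nn_integral_prod) simp_all
    finally show ?thesis by simp
  qed
  define c where "c = (1 / sqrt (1 - ?s\<^sup>2)) ^ n"
  have nn1: "(\<integral>\<^sup>+Y. ennreal (L Y) \<partial>?G) = 1"
    unfolding L_def by (subst int) (simp_all add: spiked_ratio_nonneg[OF s'] nn_integral_spiked_ratio[OF \<theta> s'])
  have nn2: "(\<integral>\<^sup>+Y. ennreal ((L Y)\<^sup>2) \<partial>?G) = ennreal c"
  proof -
    have "(L Y)\<^sup>2 = (\<Prod>i\<in>{1..n}. (spiked_ratio ?s \<theta> (Y i))\<^sup>2)" for Y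
      by (simp add: L_def prod_power_distrib)
    then have "(\<integral>\<^sup>+Y. ennreal ((L Y)\<^sup>2) \<partial>?G) = (\<integral>\<^sup>+Y. ennreal (\<Prod>i\<in>{1..n}. (spiked_ratio ?s \<theta> (Y i))\<^sup>2) \<partial>?G)"
      by simp
    also have "\<dots> = (\<integral>\<^sup>+x. ennreal ((spiked_ratio ?s \<theta> x)\<^sup>2) \<partial>std_gaussian) ^ n"
      by (rule int) simp_all
    finally show ?thesis
      unfolding c_def using s2 by (simp add: nn_integral_spiked_ratio_power2[OF \<theta> s(1) s1] ennreal_power)
  qed
  have L1: "integrable ?G L" "expectation L = 1"
    using nn_integral_eq_integrable[OF Lm, of 1] nn1 L0 by simp_all
  have L2: "integrable ?G (\<lambda>Y. (L Y)\<^sup>2)" "expectation (\<lambda>Y. (L Y)\<^sup>2) = c"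
  proof -
    have m: "(\<lambda>Y. (L Y)\<^sup>2) \<in> borel_measurable ?G" using Lm by (rule borel_measurable_power)
    have "0 \<le> c" using s2 by (simp add: c_def)
    then show "integrable ?G (\<lambda>Y. (L Y)\<^sup>2)" "expectation (\<lambda>Y. (L Y)\<^sup>2) = c"
      using nn_integral_eq_integrable[OF m, of c] nn2 by simp_all
  qed
  have \<psi>m [measurable]: "\<psi> n \<in> borel_measurable ?G"
    using \<psi> n unfolding is_test_sequence_def measurable_cong_sets[OF sets_gaussian_sample refl] by blast
  have sp: "space ?G = space (sample_space n)" by (simp add: space_PiM)
  have \<psi>b: "0 \<le> \<psi> n Y" "\<psi> n Y \<le> 1" if "Y \<in> space ?G" for Y
    using \<psi> n that unfolding is_test_sequence_def sp by auto
  have \<psi>i: "integrable ?G (\<psi> n)"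
    by (rule integrable_const_bound[where B = 1, OF _ \<psi>m]) (use \<psi>b in auto)
  have \<psi>Li: "integrable ?G (\<lambda>Y. L Y * \<psi> n Y)"
    by (rule Bochner_Integration.integrable_bound[OF L1(1) borel_measurable_times[OF Lm \<psi>m]]) (use \<psi>b L0 in \<open>auto simp: abs_mult mult_left_le\<close>)
  have La: "integrable ?G (\<lambda>Y. \<bar>L Y - 1\<bar>)"
    by (intro integrable_abs Bochner_Integration.integrable_diff L1(1) integrable_const)
  have "test_power \<psi> \<theta> r v n = (\<integral>Y. L Y * \<psi> n Y \<partial>?G)"
    unfolding test_power_def law using L0 Lm \<psi>m by (subst integral_density) auto
  then have "test_power \<psi> \<theta> r v n - (\<integral>Y. \<psi> n Y \<partial>?G) = (\<integral>Y. (L Y - 1) * \<psi> n Y \<partial>?G)"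
    using \<psi>i \<psi>Li by (simp add: left_diff_distrib)
  also have "\<bar>\<dots>\<bar> \<le> (\<integral>Y. \<bar>L Y - 1\<bar> \<partial>?G)"
  proof -
    have "\<bar>\<integral>Y. (L Y - 1) * \<psi> n Y \<partial>?G\<bar> \<le> (\<integral>Y. \<bar>(L Y - 1) * \<psi> n Y\<bar> \<partial>?G)"
      by (rule integral_abs_bound)
    also have "\<dots> \<le> (\<integral>Y. \<bar>L Y - 1\<bar> \<partial>?G)"
    proof (rule integral_mono)
      show "integrable ?G (\<lambda>Y. \<bar>(L Y - 1) * \<psi> n Y\<bar>)"
        using \<psi>i \<psi>Li by (simp add: left_diff_distrib)
      show "integrable ?G (\<lambda>Y. \<bar>L Y - 1\<bar>)" by (rule La)
      show "\<bar>(L Y - 1) * \<psi> n Y\<bar> \<le> \<bar>L Y - 1\<bar>" if "Y \<in> space ?G" for Y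
        using \<psi>b[OF that] by (simp add: abs_mult mult_left_le)
    qed
    finally show ?thesis .
  qed
  also have "\<dots> \<le> sqrt (\<integral>Y. (L Y - 1)\<^sup>2 \<partial>?G)"
  proof (rule real_le_rsqrt)
    have "integrable ?G (\<lambda>Y. (L Y - 1)\<^sup>2)" unfolding power2_diff using L1(1) L2(1) by (simp del: One_nat_def)
    then have "variance (\<lambda>Y. \<bar>L Y - 1\<bar>) = expectation (\<lambda>Y. \<bar>L Y - 1\<bar>\<^sup>2) - (expectation (\<lambda>Y. \<bar>L Y - 1\<bar>))\<^sup>2"
      using La by (intro variance_eq) simp_all
    moreover have "0 \<le> variance (\<lambda>Y. \<bar>L Y - 1\<bar>)" by (rule variance_positive)
    ultimately show "(expectation (\<lambda>Y. \<bar>L Y - 1\<bar>))\<^sup>2 \<le> (\<integral>Y. (L Y - 1)\<^sup>2 \<partial>?G)" by simp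
  qed
  also have "(\<integral>Y. (L Y - 1)\<^sup>2 \<partial>?G) = c - 1"
    unfolding power2_diff using L1 L2 by (simp add: prob_space del: One_nat_def)
  also have "sqrt (c - 1) \<le> sqrt (1 / sqrt (1 - real n * ?s\<^sup>2) - 1)"
  proof -
    have "1 + real n * (- ?s\<^sup>2) \<le> (1 + (- ?s\<^sup>2)) ^ n" using s2 by (intro Bernoulli_inequality) simp
    then have "1 - real n * ?s\<^sup>2 \<le> (1 - ?s\<^sup>2) ^ n" by simp
    then have "1 / sqrt ((1 - ?s\<^sup>2) ^ n) \<le> 1 / sqrt (1 - real n * ?s\<^sup>2)"
      using s(2) s2 by (intro divide_left_mono real_sqrt_le_mono mult_pos_pos) auto
    then show ?thesis by (simp add: c_def power_one_over real_sqrt_power)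
  qed
  finally show ?thesis .
qed

section \<open>Asymptotic power and the maximin property\<close>

lemma is_test_sequence_HPV:
  fixes eigvec :: "nat \<Rightarrow> ('p::finite) sample \<Rightarrow> nat \<Rightarrow> real ^ 'p"
  assumes ev: "sample_eigenvectors eigvec"
  shows "is_test_sequence (\<phi>_HPV \<alpha> \<theta>0 eigvec)"
  unfolding is_test_sequence_def
proof (intro allI impI conjI ballI)
  fix n :: nat assume n: "1 \<le> n"
  note [measurable] = measurable_Q_HPV[OF ev n]
  show "\<phi>_HPV \<alpha> \<theta>0 eigvec n \<in> borel_measurable (sample_space n)"
    unfolding \<phi>_HPV_def[abs_def] by measurable
qed (simp_all add: \<phi>_HPV_def)

lemma prob_space_sample_law:
  fixes \<theta> :: "real ^ ('p::finite)"
  assumes "norm \<theta> = 1" "-1 < r n * v"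
  shows "prob_space (sample_law \<theta> r v n)"
  unfolding sample_law_eq_distr[where r = r and v = v and n = n, OF assms]
  by (intro prob_space.prob_space_distr prob_space_gaussian_sample) measurable

lemma test_power_HPV:
  fixes \<theta>0 \<theta> :: "real ^ ('p::finite)"
  assumes ev: "sample_eigenvectors eigvec" and \<theta>: "norm \<theta> = 1" and s: "-1 < r n * v" and n: "n \<ge> 1"
  shows "test_power (\<phi>_HPV \<alpha> \<theta>0 eigvec) \<theta> r v n
    = 1 - cdf (distr (sample_law \<theta> r v n) borel (Q_HPV \<theta>0 eigvec n)) (chi_square_quantile (CARD('p) - 1) (1 - \<alpha>))"
proof -
  let ?q = "chi_square_quantile (CARD('p) - 1) (1 - \<alpha>)" and ?P = "sample_law \<theta> r v n"
  interpret prob_space ?P by (rule prob_space_sample_law[where r = r and v = v and n = n, OF \<theta> s])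
  have sets: "sets ?P = sets (sample_space n)"
    unfolding sample_law_eq_distr[where r = r and v = v and n = n, OF \<theta> s] by simp
  have Q [measurable]: "Q_HPV \<theta>0 eigvec n \<in> borel_measurable ?P"
    using measurable_Q_HPV[OF ev n] unfolding measurable_cong_sets[OF sets refl] .
  have "test_power (\<phi>_HPV \<alpha> \<theta>0 eigvec) \<theta> r v n = (\<integral>X. indicator {X. Q_HPV \<theta>0 eigvec n X > ?q} X \<partial>?P)"
    unfolding test_power_def by (intro Bochner_Integration.integral_cong) (auto simp: \<phi>_HPV_def indicator_def)
  also have "\<dots> = measure ?P ({X. Q_HPV \<theta>0 eigvec n X > ?q} \<inter> space ?P)"
    by (rule Bochner_Integration.integral_indicator)
  also have "{X. Q_HPV \<theta>0 eigvec n X > ?q} \<inter> space ?P = space ?P - {X \<in> space ?P. Q_HPV \<theta>0 eigvec n X \<le> ?q}"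
    by auto
  also have "prob \<dots> = 1 - prob {X \<in> space ?P. Q_HPV \<theta>0 eigvec n X \<le> ?q}"
    by (rule prob_compl) measurable
  also have "prob {X \<in> space ?P. Q_HPV \<theta>0 eigvec n X \<le> ?q} = cdf (distr ?P borel (Q_HPV \<theta>0 eigvec n)) ?q"
    by (simp add: cdf_def measure_distr vimage_def Int_def conj_commute)
  finally show ?thesis .
qed

lemma test_power_HPV_tendsto:
  fixes \<theta>0 \<theta> :: "real ^ ('p::finite)" and eigvec :: "nat \<Rightarrow> 'p sample \<Rightarrow> nat \<Rightarrow> real ^ 'p"
  assumes p: "2 \<le> CARD('p)" and ev: "sample_eigenvectors eigvec" and \<theta>0: "norm \<theta>0 = 1"
    and \<theta>s: "\<And>n. n \<ge> 1 \<Longrightarrow> norm (\<theta>s n) = 1" "\<theta>s \<longlonglongrightarrow> \<theta>"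
    and s: "\<And>n. n \<ge> 1 \<Longrightarrow> 0 < r n * v" and \<rho>: "(\<lambda>n. sqrt (real n) * (r n * v)) \<longlonglongrightarrow> \<rho>"
  shows "(\<lambda>n. test_power (\<phi>_HPV \<alpha> \<theta>0 eigvec) (\<theta>s n) r v n) \<longlonglongrightarrow>
    1 - cdf (noncentral_chi_square (CARD('p) - 1) (\<rho>\<^sup>2 * (\<theta>0 \<bullet> \<theta>)\<^sup>2 * (1 - (\<theta>0 \<bullet> \<theta>)\<^sup>2)))
      (chi_square_quantile (CARD('p) - 1) (1 - \<alpha>))"
proof (rule Lim_transform_eventually)
  show "eventually (\<lambda>n. 1 - cdf (distr (sample_law (\<theta>s n) r v n) borel (Q_HPV \<theta>0 eigvec n)) (chi_square_quantile (CARD('p) - 1) (1 - \<alpha>))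
      = test_power (\<phi>_HPV \<alpha> \<theta>0 eigvec) (\<theta>s n) r v n) sequentially"
    using eventually_ge_at_top[of 1]
  proof eventually_elim
    case (elim n)
    have "-1 < r n * v" using s[OF elim] by simp
    then show ?case using test_power_HPV[OF ev \<theta>s(1)[OF elim] _ elim, of r v \<alpha> \<theta>0] by simp
  qed
  show "(\<lambda>n. 1 - cdf (distr (sample_law (\<theta>s n) r v n) borel (Q_HPV \<theta>0 eigvec n)) (chi_square_quantile (CARD('p) - 1) (1 - \<alpha>)))
    \<longlonglongrightarrow> 1 - cdf (noncentral_chi_square (CARD('p) - 1) (\<rho>\<^sup>2 * (\<theta>0 \<bullet> \<theta>)\<^sup>2 * (1 - (\<theta>0 \<bullet> \<theta>)\<^sup>2)))
      (chi_square_quantile (CARD('p) - 1) (1 - \<alpha>))"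
    by (intro tendsto_diff tendsto_const Q_HPV_cdf_tendsto[OF p ev \<theta>0 \<theta>s s \<rho>])
qed

text \<open>As \<open>\<theta>0\<close> and \<open>\<theta>0 + \<tau>\<close> are unit vectors, their inner product is
  \<open>1 - (norm \<tau>)\<^sup>2 / 2\<close>.\<close>

lemma hpv_noncentrality_eq:
  fixes \<theta>0 \<tau> :: "real ^ ('p::finite)"
  assumes \<theta>0: "norm \<theta>0 = 1" and \<tau>: "norm (\<theta>0 + \<tau>) = 1"
  shows "v\<^sup>2 * (\<theta>0 \<bullet> (\<theta>0 + \<tau>))\<^sup>2 * (1 - (\<theta>0 \<bullet> (\<theta>0 + \<tau>))\<^sup>2) = hpv_noncentrality v \<tau>"
proof -
  define t where "t = (norm \<tau>)\<^sup>2"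
  have "\<theta>0 \<bullet> \<theta>0 = 1" "(\<theta>0 + \<tau>) \<bullet> (\<theta>0 + \<tau>) = 1" using \<theta>0 \<tau> by (simp_all add: norm_eq_1)
  then have "\<theta>0 \<bullet> \<tau> = - t / 2"
    unfolding t_def power2_norm_eq_inner by (simp add: inner_add_left inner_add_right inner_commute)
  then have c: "\<theta>0 \<bullet> (\<theta>0 + \<tau>) = 1 - t / 2" using \<open>\<theta>0 \<bullet> \<theta>0 = 1\<close> by (simp add: inner_add_right)
  show ?thesis unfolding c hpv_noncentrality_def t_def[symmetric]
    by (simp add: power2_eq_square field_simps)
qed

text \<open>The unit sphere has points at distance exactly \<open>c\<close> from \<open>\<theta>0\<close>, found in the plane of
  \<open>\<theta>0\<close> and an orthogonal unit vector. Without them an infimum over the alternatives would be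
  infinite.\<close>

lemma alternatives_nonempty:
  fixes \<theta>0 :: "real ^ ('p::finite)"
  assumes p: "2 \<le> CARD('p)" and \<theta>0: "norm \<theta>0 = 1" and c: "0 < c" "c \<le> C" "c \<le> 2"
  shows "alternatives \<theta>0 c C \<noteq> {}"
proof -
  obtain e where "norm e = 1" and e0: "\<theta>0 \<bullet> e = 0"
    using exists_orthogonal_unit_vector[of \<theta>0] p \<theta>0 by auto
  then have e: "e \<bullet> e = 1" "\<theta>0 \<bullet> e = 0" by (simp_all add: norm_eq_1)
  have o: "\<theta>0 \<bullet> \<theta>0 = 1" using \<theta>0 by (simp add: norm_eq_1)
  define a where "a = 1 - c\<^sup>2 / 2"
  have "c\<^sup>2 \<le> 2\<^sup>2" using c by (intro power_mono) auto
  then have "\<bar>a\<bar> \<le> 1" by (simp add: a_def abs_le_iff)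
  then have a2: "a\<^sup>2 \<le> 1" by (simp add: abs_square_le_1)
  define \<theta> where "\<theta> = a *\<^sub>R \<theta>0 + sqrt (1 - a\<^sup>2) *\<^sub>R e"
  have "\<theta> \<bullet> \<theta> = 1"
  proof -
    have "\<theta> \<bullet> \<theta> = a * a + sqrt (1 - a\<^sup>2) * sqrt (1 - a\<^sup>2)"
      by (simp add: \<theta>_def inner_add_left inner_add_right o e inner_commute[of e \<theta>0])
    also have "\<dots> = 1" using a2 by (simp add: power2_eq_square)
    finally show ?thesis .
  qed
  moreover have "\<theta>0 \<bullet> \<theta> = a" by (simp add: \<theta>_def inner_add_right o e)
  ultimately have "(norm (\<theta> - \<theta>0))\<^sup>2 = c\<^sup>2"
    unfolding power2_norm_eq_inner by (simp add: inner_diff_left inner_diff_right o inner_commute[of \<theta> \<theta>0] a_def)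
  then have "norm (\<theta> - \<theta>0) = c" using c by (simp add: power2_eq_iff_nonneg)
  moreover have "norm \<theta> = 1" using \<open>\<theta> \<bullet> \<theta> = 1\<close> by (simp add: norm_eq_1)
  ultimately have "\<theta> \<in> alternatives \<theta>0 c C" using c by (simp add: alternatives_def)
  then show ?thesis by blast
qed

text \<open>A test cannot detect the direction of a spike that vanishes faster than
  \<open>1 / sqrt n\<close>. The bound \<open>\<eta>\<close> is uniform over tests, which allows infima over directions
  to be taken.\<close>

lemma test_power_asymptotically_constant:
  assumes s: "\<And>n. n \<ge> 1 \<Longrightarrow> 0 < r n * v" and \<rho>: "(\<lambda>n. sqrt (real n) * (r n * v)) \<longlonglongrightarrow> 0"
  shows "\<exists>\<eta>. \<eta> \<longlonglongrightarrow> 0 \<and> eventually (\<lambda>n. \<forall>(\<psi> :: nat \<Rightarrow> ('p::finite) sample \<Rightarrow> real) \<theta> \<theta>'. is_test_sequence \<psi> \<longrightarrow> norm \<theta> = 1 \<longrightarrow> norm \<theta>' = 1 \<longrightarrow>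
    \<bar>test_power \<psi> \<theta> r v n - test_power \<psi> \<theta>' r v n\<bar> \<le> \<eta> n) sequentially"
proof (intro exI conjI)
  let ?x = "\<lambda>n. real n * (r n * v)\<^sup>2"
  let ?\<eta> = "\<lambda>n. 2 * sqrt (1 / sqrt (1 - ?x n) - 1)"
  have x0: "?x \<longlonglongrightarrow> 0"
  proof -
    have "(\<lambda>n. (sqrt (real n) * (r n * v))\<^sup>2) \<longlonglongrightarrow> 0\<^sup>2" by (intro tendsto_power \<rho>)
    then show ?thesis by (simp add: power_mult_distrib)
  qed
  have "?\<eta> \<longlonglongrightarrow> 2 * sqrt (1 / sqrt (1 - 0) - 1)" by (intro tendsto_intros x0) simp
  then show "?\<eta> \<longlonglongrightarrow> 0" by simp
  have "eventually (\<lambda>n. ?x n < 1) sequentially" using x0 by (rule order_tendstoD(2)) simp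
  then show "eventually (\<lambda>n. \<forall>(\<psi> :: nat \<Rightarrow> 'p sample \<Rightarrow> real) \<theta> \<theta>'. is_test_sequence \<psi> \<longrightarrow> norm \<theta> = 1 \<longrightarrow> norm \<theta>' = 1 \<longrightarrow>
    \<bar>test_power \<psi> \<theta> r v n - test_power \<psi> \<theta>' r v n\<bar> \<le> ?\<eta> n) sequentially"
    using eventually_ge_at_top[of 1]
  proof eventually_elim
    case (elim n)
    show ?case
    proof (intro allI impI)
      fix \<psi> :: "nat \<Rightarrow> 'p sample \<Rightarrow> real" and \<theta> \<theta>' :: "real ^ 'p" assume \<psi>: "is_test_sequence \<psi>" and \<theta>: "norm \<theta> = 1" "norm \<theta>' = 1"
      have s0: "0 \<le> r n * v" using s[OF elim(2)] by simp
      show "\<bar>test_power \<psi> \<theta> r v n - test_power \<psi> \<theta>' r v n\<bar> \<le> ?\<eta> n"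
        using test_power_difference_le[where r = r and v = v and n = n, OF \<theta>(1) s0 elim(1,2) \<psi>]
          test_power_difference_le[where r = r and v = v and n = n, OF \<theta>(2) s0 elim(1,2) \<psi>] by linarith
    qed
  qed
qed

text \<open>When power is asymptotically constant in the direction, a test \<open>\<psi>\<close> of asymptotic
  level \<open>\<alpha>\<close> has at most the power \<open>\<alpha>\<close> in the limit at any single alternative, and \<open>\<phi>\<close> has the
  power \<open>\<alpha>\<close> in the limit uniformly over all alternatives.\<close>

lemma locally_asymptotically_maximin_if_power_constant:
  fixes \<phi> :: "nat \<Rightarrow> ('p::finite) sample \<Rightarrow> real"
  assumes p: "2 \<le> CARD('p)" and \<theta>0: "norm \<theta>0 = 1"
    and s: "\<And>n. n \<ge> 1 \<Longrightarrow> 0 < r n * v" and \<rho>: "(\<lambda>n. sqrt (real n) * (r n * v)) \<longlonglongrightarrow> 0"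
    and \<phi>: "is_test_sequence \<phi>" and lim: "(\<lambda>n. test_power \<phi> \<theta>0 r v n) \<longlonglongrightarrow> \<alpha>"
  shows "locally_asymptotically_maximin \<alpha> \<phi> \<theta>0 r v"
  unfolding locally_asymptotically_maximin_def
proof (intro conjI allI impI)
  obtain \<eta> where \<eta>: "\<eta> \<longlonglongrightarrow> 0" and close: "eventually (\<lambda>n. \<forall>(\<psi> :: nat \<Rightarrow> 'p sample \<Rightarrow> real) \<theta> \<theta>'. is_test_sequence \<psi> \<longrightarrow> norm \<theta> = 1 \<longrightarrow> norm \<theta>' = 1 \<longrightarrow>
    \<bar>test_power \<psi> \<theta> r v n - test_power \<psi> \<theta>' r v n\<bar> \<le> \<eta> n) sequentially"
    using test_power_asymptotically_constant[OF s \<rho>, where 'p = 'p] by blast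
  show "is_test_sequence \<phi>" by (rule \<phi>)
  show "asymptotic_level \<alpha> \<phi> \<theta>0 r v"
  proof -
    have "(\<lambda>n. ereal (test_power \<phi> \<theta>0 r v n)) \<longlonglongrightarrow> ereal \<alpha>" using lim by simp
    from lim_imp_Limsup[OF _ this] show ?thesis by (simp add: asymptotic_level_def)
  qed
  fix c C :: real and \<psi> assume c: "0 < c" "c \<le> C" "c \<le> 2"
    and \<psi>: "is_test_sequence \<psi>" and level: "asymptotic_level \<alpha> \<psi> \<theta>0 r v"
  obtain \<theta>1 where \<theta>1: "\<theta>1 \<in> alternatives \<theta>0 c C" using alternatives_nonempty[OF p \<theta>0 c] by blast
  then have n1: "norm \<theta>1 = 1" by (simp add: alternatives_def)
  have "limsup (\<lambda>n. INF \<theta>\<in>alternatives \<theta>0 c C. ereal (test_power \<psi> \<theta> r v n))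
     \<le> limsup (\<lambda>n. ereal (\<eta> n) + ereal (test_power \<psi> \<theta>0 r v n))"
  proof (rule Limsup_mono)
    show "eventually (\<lambda>n. (INF \<theta>\<in>alternatives \<theta>0 c C. ereal (test_power \<psi> \<theta> r v n))
       \<le> ereal (\<eta> n) + ereal (test_power \<psi> \<theta>0 r v n)) sequentially"
      using close
    proof eventually_elim
      case (elim n)
      have "\<bar>test_power \<psi> \<theta>1 r v n - test_power \<psi> \<theta>0 r v n\<bar> \<le> \<eta> n" using elim \<psi> n1 \<theta>0 by blast
      then have "ereal (test_power \<psi> \<theta>1 r v n) \<le> ereal (\<eta> n) + ereal (test_power \<psi> \<theta>0 r v n)" by simp
      with INF_lower[OF \<theta>1] show ?case by (rule order_trans)
    qed
  qed
  also have "\<dots> = 0 + limsup (\<lambda>n. ereal (test_power \<psi> \<theta>0 r v n))"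
    using \<eta> by (intro ereal_limsup_lim_add) (simp_all add: zero_ereal_def)
  also have "\<dots> \<le> ereal \<alpha>" using level by (simp add: asymptotic_level_def)
  also have "\<dots> = liminf (\<lambda>n. ereal (test_power \<phi> \<theta>0 r v n - \<eta> n))"
  proof -
    have "(\<lambda>n. test_power \<phi> \<theta>0 r v n - \<eta> n) \<longlonglongrightarrow> \<alpha> - 0" by (intro tendsto_diff lim \<eta>)
    then have "(\<lambda>n. ereal (test_power \<phi> \<theta>0 r v n - \<eta> n)) \<longlonglongrightarrow> ereal \<alpha>" by simp
    from lim_imp_Liminf[OF _ this] show ?thesis by simp
  qed
  also have "\<dots> \<le> liminf (\<lambda>n. INF \<theta>\<in>alternatives \<theta>0 c C. ereal (test_power \<phi> \<theta> r v n))"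
  proof (rule Liminf_mono)
    show "eventually (\<lambda>n. ereal (test_power \<phi> \<theta>0 r v n - \<eta> n)
       \<le> (INF \<theta>\<in>alternatives \<theta>0 c C. ereal (test_power \<phi> \<theta> r v n))) sequentially"
      using close
    proof eventually_elim
      case (elim n)
      show ?case
      proof (rule INF_greatest)
        fix \<theta> assume "\<theta> \<in> alternatives \<theta>0 c C"
        then have "norm \<theta> = 1" by (simp add: alternatives_def)
        then have "\<bar>test_power \<phi> \<theta> r v n - test_power \<phi> \<theta>0 r v n\<bar> \<le> \<eta> n" using elim \<phi> \<theta>0 by blast
        then show "ereal (test_power \<phi> \<theta>0 r v n - \<eta> n) \<le> ereal (test_power \<phi> \<theta> r v n)" by simp
      qed
    qed
  qed
  finally show "limsup (\<lambda>n. INF \<theta>\<in>alternatives \<theta>0 c C. ereal (test_power \<psi> \<theta> r v n))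
       \<le> liminf (\<lambda>n. INF \<theta>\<in>alternatives \<theta>0 c C. ereal (test_power \<phi> \<theta> r v n))" .
qed

theorem theorem4p3:
  fixes \<theta>0 :: "real ^ ('p::finite)" and v :: real and r :: "nat \<Rightarrow> real"
    and eigvec :: "nat \<Rightarrow> 'p sample \<Rightarrow> nat \<Rightarrow> real ^ 'p"
    and \<tau>s :: "nat \<Rightarrow> real ^ 'p" and \<tau> :: "real ^ 'p"
  assumes "CARD('p) \<ge> 2"
    and "norm \<theta>0 = 1"
    and "v > 0"
    and "\<forall>n\<ge>1. r n > 0"
    and "sample_eigenvectors eigvec"
    and "\<forall>n\<ge>1. norm (\<theta>0 + \<tau>s n) = 1"
    and "\<tau>s \<longlonglongrightarrow> \<tau>"
  shows "((\<forall>n\<ge>1. r n = 1 / sqrt (real n)) \<longrightarrow>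
            weak_conv_m
              (\<lambda>n. distr (sample_law (\<theta>0 + \<tau>s n) r v n) borel (Q_HPV \<theta>0 eigvec n))
              (noncentral_chi_square (CARD('p) - 1) (hpv_noncentrality v \<tau>)) \<and>
            (\<forall>\<alpha>\<in>{0<..<1}. rate_consistent \<alpha> (\<phi>_HPV \<alpha> \<theta>0 eigvec) \<theta>0 r v))
       \<and> (r \<in> o(\<lambda>n. 1 / sqrt (real n)) \<longrightarrow>
            (\<forall>\<alpha>\<in>{0<..<1}.
               locally_asymptotically_maximin \<alpha> (\<phi>_HPV \<alpha> \<theta>0 eigvec) \<theta>0 r v \<and>
               (\<lambda>n. test_power (\<phi>_HPV \<alpha> \<theta>0 eigvec) (\<theta>0 + \<tau>s n) r v n) \<longlonglongrightarrow> \<alpha>))"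
proof -
  note p = assms(1) and \<theta>0 = assms(2) and ev = assms(5)
  let ?k = "CARD('p) - 1"
  have k: "1 \<le> ?k" using p by simp
  have s: "0 < r n * v" if "n \<ge> 1" for n using assms(3,4) that by simp
  have quantile: "cdf (noncentral_chi_square ?k 0) (chi_square_quantile ?k (1 - \<alpha>)) = 1 - \<alpha>"
    if "\<alpha> \<in> {0<..<1}" for \<alpha>
    using that by (intro cdf_chi_square_quantile[OF k]) auto
  have unit: "norm (\<theta>0 + \<sigma>) = 1" if "\<forall>n\<ge>1. norm (\<theta>0 + \<sigma>s n) = 1" "\<sigma>s \<longlonglongrightarrow> \<sigma>" for \<sigma>s and \<sigma> :: "real ^ 'p"
  proof (rule LIMSEQ_unique)
    show "(\<lambda>n. norm (\<theta>0 + \<sigma>s n)) \<longlonglongrightarrow> norm (\<theta>0 + \<sigma>)" by (intro tendsto_intros that(2))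
    show "(\<lambda>n. norm (\<theta>0 + \<sigma>s n)) \<longlonglongrightarrow> 1"
      by (rule tendsto_eventually) (use that(1) in \<open>auto simp: eventually_sequentially\<close>)
  qed
  show ?thesis
  proof (intro conjI impI ballI)
    assume r: "\<forall>n\<ge>1. r n = 1 / sqrt (real n)"
    have \<rho>: "(\<lambda>n. sqrt (real n) * (r n * v)) \<longlonglongrightarrow> v"
      by (rule tendsto_eventually) (use r in \<open>auto simp: eventually_sequentially intro!: exI[of _ 1]\<close>)
    show "weak_conv_m (\<lambda>n. distr (sample_law (\<theta>0 + \<tau>s n) r v n) borel (Q_HPV \<theta>0 eigvec n))
        (noncentral_chi_square ?k (hpv_noncentrality v \<tau>))"
      unfolding weak_conv_m_def weak_conv_def
    proof (intro allI impI)
      fix q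
      have "(\<lambda>n. \<theta>0 + \<tau>s n) \<longlonglongrightarrow> \<theta>0 + \<tau>" by (intro tendsto_intros assms(7))
      from Q_HPV_cdf_tendsto[OF p ev \<theta>0 _ this s \<rho>, of q] assms(6)
      show "(\<lambda>n. cdf (distr (sample_law (\<theta>0 + \<tau>s n) r v n) borel (Q_HPV \<theta>0 eigvec n)) q)
        \<longlonglongrightarrow> cdf (noncentral_chi_square ?k (hpv_noncentrality v \<tau>)) q"
        unfolding hpv_noncentrality_eq[OF \<theta>0 unit[OF assms(6,7)]] by simp
    qed
    fix \<alpha> :: real assume \<alpha>: "\<alpha> \<in> {0<..<1}"
    let ?q = "chi_square_quantile ?k (1 - \<alpha>)"
    show "rate_consistent \<alpha> (\<phi>_HPV \<alpha> \<theta>0 eigvec) \<theta>0 r v"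
      unfolding rate_consistent_def
    proof (intro conjI allI impI is_test_sequence_HPV[OF ev])
      fix \<sigma>s and \<sigma> :: "real ^ 'p"
      assume \<sigma>: "\<forall>n\<ge>1. norm (\<theta>0 + \<sigma>s n) = 1" "\<sigma>s \<longlonglongrightarrow> \<sigma>" and pos: "0 < hpv_noncentrality v \<sigma>"
      have "(\<lambda>n. \<theta>0 + \<sigma>s n) \<longlonglongrightarrow> \<theta>0 + \<sigma>" by (intro tendsto_intros \<sigma>(2))
      from test_power_HPV_tendsto[OF p ev \<theta>0 _ this s \<rho>, of \<alpha>] \<sigma>(1)
      have lim: "(\<lambda>n. test_power (\<phi>_HPV \<alpha> \<theta>0 eigvec) (\<theta>0 + \<sigma>s n) r v n)
        \<longlonglongrightarrow> 1 - cdf (noncentral_chi_square ?k (hpv_noncentrality v \<sigma>)) ?q"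
        unfolding hpv_noncentrality_eq[OF \<theta>0 unit[OF \<sigma>]] by simp
      have "cdf (noncentral_chi_square ?k (hpv_noncentrality v \<sigma>)) ?q < cdf (noncentral_chi_square ?k 0) ?q"
        using quantile[OF \<alpha>] \<alpha> by (intro cdf_noncentral_chi_square_less[OF k pos]) simp
      then have "\<alpha> < 1 - cdf (noncentral_chi_square ?k (hpv_noncentrality v \<sigma>)) ?q"
        using quantile[OF \<alpha>] by simp
      then show "\<exists>\<beta>>\<alpha>. (\<lambda>n. test_power (\<phi>_HPV \<alpha> \<theta>0 eigvec) (\<theta>0 + \<sigma>s n) r v n) \<longlonglongrightarrow> \<beta>"
        using lim by blast
    qed
  next
    fix \<alpha> :: real assume r: "r \<in> o(\<lambda>n. 1 / sqrt (real n))" and \<alpha>: "\<alpha> \<in> {0<..<1}"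
    have \<rho>: "(\<lambda>n. sqrt (real n) * (r n * v)) \<longlonglongrightarrow> 0"
    proof -
      have "(\<lambda>n. r n / (1 / sqrt (real n))) \<longlonglongrightarrow> 0" using r by (rule smalloD_tendsto)
      from tendsto_mult_right[OF this, of v] show ?thesis by (simp add: mult_ac)
    qed
    have lim: "(\<lambda>n. test_power (\<phi>_HPV \<alpha> \<theta>0 eigvec) (\<theta>0 + \<sigma>s n) r v n) \<longlonglongrightarrow> \<alpha>"
      if \<sigma>: "\<forall>n\<ge>1. norm (\<theta>0 + \<sigma>s n) = 1" "\<sigma>s \<longlonglongrightarrow> \<sigma>" for \<sigma>s and \<sigma> :: "real ^ 'p"
    proof -
      have "(\<lambda>n. \<theta>0 + \<sigma>s n) \<longlonglongrightarrow> \<theta>0 + \<sigma>" by (intro tendsto_intros \<sigma>(2))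
      from test_power_HPV_tendsto[OF p ev \<theta>0 _ this s \<rho>, of \<alpha>] \<sigma>(1) quantile[OF \<alpha>]
      show ?thesis by simp
    qed
    show "locally_asymptotically_maximin \<alpha> (\<phi>_HPV \<alpha> \<theta>0 eigvec) \<theta>0 r v"
      using lim[of "\<lambda>_. 0" 0] \<theta>0
      by (intro locally_asymptotically_maximin_if_power_constant p \<theta>0 s \<rho> is_test_sequence_HPV ev) simp_all
    show "(\<lambda>n. test_power (\<phi>_HPV \<alpha> \<theta>0 eigvec) (\<theta>0 + \<tau>s n) r v n) \<longlonglongrightarrow> \<alpha>"
      by (rule lim[OF assms(6,7)])
  qed
qed

end
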